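(* If $\varphi$ is a strong finitary combinatorial principle without built-in symbols and $\tilde\varphi$ is a weak finitary combinatorial principle, then $Q_\varphi$ is independent from $Q_{\tilde\varphi}$ over $\forall\mathsf{T}^1_2(\mathsf{PV}(\alpha))$.
   Context: $\mathsf{PV}$: language with $<$ and a function symbol for every polynomial-time Turing machine; standard model $\mathbb N$. $|x|$ binary length, $\mathit{bit}(i,a)$ bits, $\langle\cdots\rangle$ a $\mathsf{PV}$-computable tupling with projections $(y)_j$. $\mathsf{PV}(\alpha)$ adds a unary relation symbol $\alpha$ and a symbol for every polynomial-time oracle machine, interpreted in $\langle\mathbb N,\alpha^{\mathbb N}\rangle$; $\forall\mathsf{PV}(\alpha)$ = universal $\mathsf{PV}(\alpha)$-sentences true in all $\langle\mathbb N,\alpha^{\mathbb N}\rangle$. $\Sigma^b_1(\mathsf{PV}(\alpha))$: closure of sharply bounded (quantifiers $\exists x{<}|t|,\forall x{<}|t|$) $\mathsf{PV}(\alpha)$-formulas under $\wedge,\vee$, sharply bounded quantifiers and $\exists x{<}t$. $\forall\mathsf{T}^1_2(\mathsf{PV}(\alpha))$ = $\forall\mathsf{PV}(\alpha)$ + minimization $\chi(x,\bar x)\to\exists y{\le}x(\chi(y,\bar x)\wedge\forall z{<}y\neg\chi(z,\bar x))$ for $\chi\in\Sigma^b_1(\mathsf{PV}(\alpha))$. Basic sentences, finitary combinatorial principles (possibly with built-in $\mathsf{PV}$), binary code $\mathbf B(L,n,X)$ and $Q_\varphi$: a basic $L$-sentence is $\exists\bar y\bigvee_i\bigwedge_j\lambda_{ij}$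 with literals $R(\bar u),\neg R(\bar u), f(\bar u)=v,\neg u=v,u=v$ ($R,f\in L\cup\mathsf{PV}$; on $[n]$, $<$ is the natural order and $f(\bar u)=v$ for $f\in\mathsf{PV}$ means $f^{\mathbb N}(\bar a)=b$); a finitary combinatorial principle is one true in all $L$-structures on $[n]$, $n\ge1$; without built-in symbols means no $\mathsf{PV}$ symbol occurs. $\mathbf B(L,n,X)$ interprets relation $S$ by $\{\bar a:\langle S,\bar a\rangle\in X\}$ and function $S$ by $\bar a\mapsto\min\{a,n-1\}$ where $a<2^{|n|}$, $\mathit{bit}(i,a)=1\iff\langle S,\bar a,i\rangle\in X$. For $\varphi=\exists y_0..y_{k-1}\psi$, $Q_\varphi(x,y)$ is the sharply bounded formula expressing $0<x\to\bigwedge_j(y)_j<x\wedge\mathbf B(L,x,\alpha)\models\psi((y)_0,\dots)$. Consequence/independence over $T$: $\theta$ is a consequence of $\theta'$ if $T\cup\{\forall u\bar z\exists v\,\theta'(u,v)[\alpha/f^{-1}_{\bar z}(0)]:f\in\mathsf{PV}(\alpha)\}\vdash\exists y\theta(x,y)$, where $[\alpha/f^{-1}_{\bar z}(0)]$ replaces atoms $\alpha(r)$ by $f(r,\bar z)=0$; independent otherwise. Partial structures: a partial $L$-structure on $A$ interprets function symbols as maps $A^{ar(S)}\to A\cup\{1/2\}$ and relation symbols as maps to $\{0,1,1/2\}$ ($1/2$ = undefined). Its size is the number of pairs $(S,\bar a)$ with value $\ne1/2$; $s_L(n)=\sum_{S\in L}n^{ar(S)}$. Sentences get strong Kleene three-valued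 truth values (a term is $1/2$ if any subterm is; an equation is $1/2$ if a side is $1/2$; $\neg$ is $1-v$, $\wedge,\forall$ min, $\vee,\exists$ max); the structure verifies a sentence if its value is $1$. For sentences with built-in $\mathsf{PV}$, a partial $L$-structure on $[n]$ verifies it if its expansion by the partial substructure induced on $[n]$ by the standard $\mathsf{PV}$-model does. The determinacy $d(n)$ of $\varphi$ is the least $m$ such that every partial $L$-structure with universe of cardinality $n$ and size $\ge m$ verifies $\varphi$; $\varphi$ is weak if there is $\varepsilon>0$ with $s_L(n)\ge n^{\varepsilon}d(n)$ for all sufficiently large $n$. A partial substructure of a partial structure has a subset as universe and some values changed to $1/2$; it is induced if values are kept except function values leaving the subuniverse, which become $1/2$; an embedding is an isomorphism onto a partial substructure. For $g:\mathbb N\setminus\{0\}\to\mathbb N$, an induced partial substructure $\mathbf B_0$ with finite universe $B_0$ of an infinite $L$-structure $\mathbf B$ is $g$-large if some $V\subseteq B\setminus B_0$ with $|V|\le g(|B_0|)$ satisfies $S^B(B_0^{ar(S)})\subseteq B_0\cup V$ for every function symbol $S$; $\mathbf B$ is $g$-large if every finite partial substructure of $\mathbf B$ embeds into a $g$-large induced partial substructure whose universe has the same cardinality. An $L$-sentence is strong if its negation has an infinite model that is $g$-large for some $g(n)=n^{o(1)}$. *)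

theory Defs
  imports
    Complex_Main
    "HOL-Library.Nat_Bijection"
    "HOL-Library.Log_Nat"
    "HOL-Computational_Algebra.Polynomial"
begin

section \<open>First-order logic\<close>

text \<open>Variables are de Bruijn indices: below a quantifier, \<open>Var 0\<close> is the bound variable. Arities are not
  part of the syntax; they are imposed by the predicates \<open>wf_fm\<close> and \<open>wf_basic\<close> below.\<close>

datatype 'f tm = Var nat | Fn 'f "'f tm list"

datatype ('f, 'r) fm =
    FBot
  | FEq "'f tm" "'f tm"
  | FRel 'r "'f tm list"
  | FNeg "('f, 'r) fm"
  | FAnd "('f, 'r) fm" "('f, 'r) fm"
  | FOr "('f, 'r) fm" "('f, 'r) fm"
  | FAll "('f, 'r) fm"
  | FEx "('f, 'r) fm"

abbreviation FImp :: "('f, 'r) fm \<Rightarrow> ('f, 'r) fm \<Rightarrow> ('f, 'r) fm" where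
  "FImp p q \<equiv> FOr (FNeg p) q"

primrec fv_tm :: "'f tm \<Rightarrow> nat set" where
  "fv_tm (Var n) = {n}"
| "fv_tm (Fn f ts) = \<Union> (set (map fv_tm ts))"

primrec fv :: "('f, 'r) fm \<Rightarrow> nat set" where
  "fv FBot = {}"
| "fv (FEq s t) = fv_tm s \<union> fv_tm t"
| "fv (FRel r ts) = \<Union> (fv_tm ` set ts)"
| "fv (FNeg p) = fv p"
| "fv (FAnd p q) = fv p \<union> fv q"
| "fv (FOr p q) = fv p \<union> fv q"
| "fv (FAll p) = {n. Suc n \<in> fv p}"
| "fv (FEx p) = {n. Suc n \<in> fv p}"

primrec subst_tm :: "(nat \<Rightarrow> 'f tm) \<Rightarrow> 'f tm \<Rightarrow> 'f tm" where
  "subst_tm \<sigma> (Var n) = \<sigma> n"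
| "subst_tm \<sigma> (Fn f ts) = Fn f (map (subst_tm \<sigma>) ts)"

abbreviation lift_tm :: "'f tm \<Rightarrow> 'f tm" where
  "lift_tm \<equiv> subst_tm (\<lambda>n. Var (Suc n))"

definition under :: "(nat \<Rightarrow> 'f tm) \<Rightarrow> nat \<Rightarrow> 'f tm" where
  "under \<sigma> n = (case n of 0 \<Rightarrow> Var 0 | Suc m \<Rightarrow> lift_tm (\<sigma> m))"

primrec subst :: "(nat \<Rightarrow> 'f tm) \<Rightarrow> ('f, 'r) fm \<Rightarrow> ('f, 'r) fm" where
  "subst \<sigma> FBot = FBot"
| "subst \<sigma> (FEq s t) = FEq (subst_tm \<sigma> s) (subst_tm \<sigma> t)"
| "subst \<sigma> (FRel r ts) = FRel r (map (subst_tm \<sigma>) ts)"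
| "subst \<sigma> (FNeg p) = FNeg (subst \<sigma> p)"
| "subst \<sigma> (FAnd p q) = FAnd (subst \<sigma> p) (subst \<sigma> q)"
| "subst \<sigma> (FOr p q) = FOr (subst \<sigma> p) (subst \<sigma> q)"
| "subst \<sigma> (FAll p) = FAll (subst (under \<sigma>) p)"
| "subst \<sigma> (FEx p) = FEx (subst (under \<sigma>) p)"

abbreviation lift :: "('f, 'r) fm \<Rightarrow> ('f, 'r) fm" where
  "lift \<equiv> subst (\<lambda>n. Var (Suc n))"

text \<open>\<open>inst t p\<close> instantiates \<open>Var 0\<close> in the body \<open>p\<close> of a quantifier by \<open>t\<close>.\<close>

definition inst :: "'f tm \<Rightarrow> ('f, 'r) fm \<Rightarrow> ('f, 'r) fm" where
  "inst t = subst (case_nat t Var)"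

primrec quantifier_free :: "('f, 'r) fm \<Rightarrow> bool" where
  "quantifier_free FBot = True"
| "quantifier_free (FEq s t) = True"
| "quantifier_free (FRel r ts) = True"
| "quantifier_free (FNeg p) = quantifier_free p"
| "quantifier_free (FAnd p q) = (quantifier_free p \<and> quantifier_free q)"
| "quantifier_free (FOr p q) = (quantifier_free p \<and> quantifier_free q)"
| "quantifier_free (FAll p) = False"
| "quantifier_free (FEx p) = False"

primrec wf_tm :: "'f set \<Rightarrow> ('f \<Rightarrow> nat) \<Rightarrow> 'f tm \<Rightarrow> bool" where
  "wf_tm F af (Var n) = True"
| "wf_tm F af (Fn f ts) = (f \<in> F \<and> length ts = af f \<and> list_all (\<lambda>b. b) (map (wf_tm F af) ts))"

primrec wf_fm :: "'f set \<Rightarrow> ('f \<Rightarrow> nat) \<Rightarrow> ('r \<Rightarrow> nat) \<Rightarrow> ('f, 'r) fm \<Rightarrow> bool" where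
  "wf_fm F af ar FBot = True"
| "wf_fm F af ar (FEq s t) = (wf_tm F af s \<and> wf_tm F af t)"
| "wf_fm F af ar (FRel r ts) = (length ts = ar r \<and> list_all (wf_tm F af) ts)"
| "wf_fm F af ar (FNeg p) = wf_fm F af ar p"
| "wf_fm F af ar (FAnd p q) = (wf_fm F af ar p \<and> wf_fm F af ar q)"
| "wf_fm F af ar (FOr p q) = (wf_fm F af ar p \<and> wf_fm F af ar q)"
| "wf_fm F af ar (FAll p) = wf_fm F af ar p"
| "wf_fm F af ar (FEx p) = wf_fm F af ar p"

record ('f, 'r, 'a) struct =
  univ :: "'a set"
  fn :: "'f \<Rightarrow> 'a list \<Rightarrow> 'a"
  rl :: "'r \<Rightarrow> 'a list \<Rightarrow> bool"

primrec tval :: "('f, 'r, 'a) struct \<Rightarrow> (nat \<Rightarrow> 'a) \<Rightarrow> 'f tm \<Rightarrow> 'a" where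
  "tval M e (Var n) = e n"
| "tval M e (Fn f ts) = fn M f (map (tval M e) ts)"

primrec sat :: "('f, 'r, 'a) struct \<Rightarrow> (nat \<Rightarrow> 'a) \<Rightarrow> ('f, 'r) fm \<Rightarrow> bool" where
  "sat M e FBot = False"
| "sat M e (FEq s t) = (tval M e s = tval M e t)"
| "sat M e (FRel r ts) = rl M r (map (tval M e) ts)"
| "sat M e (FNeg p) = (\<not> sat M e p)"
| "sat M e (FAnd p q) = (sat M e p \<and> sat M e q)"
| "sat M e (FOr p q) = (sat M e p \<or> sat M e q)"
| "sat M e (FAll p) = (\<forall>a\<in>univ M. sat M (case_nat a e) p)"
| "sat M e (FEx p) = (\<exists>a\<in>univ M. sat M (case_nat a e) p)"

definition models :: "('f, 'r, 'a) struct \<Rightarrow> ('f, 'r) fm \<Rightarrow> bool" where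
  "models M p \<longleftrightarrow> (\<forall>e. range e \<subseteq> univ M \<longrightarrow> sat M e p)"

text \<open>Classical natural deduction with equality. Free variables of the hypotheses are treated as fixed, so
  axioms have to be given as sentences. Derivations may mention terms that do not respect arities; these
  only act as additional uninterpreted function symbols, which is a conservative extension.\<close>

inductive nd :: "('f, 'r) fm set \<Rightarrow> ('f, 'r) fm \<Rightarrow> bool" (infix "\<turnstile>" 50) where
  Hyp: "p \<in> G \<Longrightarrow> G \<turnstile> p"
| Classical: "insert (FNeg p) G \<turnstile> FBot \<Longrightarrow> G \<turnstile> p"
| NegI: "insert p G \<turnstile> FBot \<Longrightarrow> G \<turnstile> FNeg p"
| NegE: "G \<turnstile> FNeg p \<Longrightarrow> G \<turnstile> p \<Longrightarrow> G \<turnstile> FBot"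
| AndI: "G \<turnstile> p \<Longrightarrow> G \<turnstile> q \<Longrightarrow> G \<turnstile> FAnd p q"
| AndE1: "G \<turnstile> FAnd p q \<Longrightarrow> G \<turnstile> p"
| AndE2: "G \<turnstile> FAnd p q \<Longrightarrow> G \<turnstile> q"
| OrI1: "G \<turnstile> p \<Longrightarrow> G \<turnstile> FOr p q"
| OrI2: "G \<turnstile> q \<Longrightarrow> G \<turnstile> FOr p q"
| OrE: "G \<turnstile> FOr p q \<Longrightarrow> insert p G \<turnstile> r \<Longrightarrow> insert q G \<turnstile> r \<Longrightarrow> G \<turnstile> r"
| AllI: "lift ` G \<turnstile> p \<Longrightarrow> G \<turnstile> FAll p"
| AllE: "G \<turnstile> FAll p \<Longrightarrow> G \<turnstile> inst t p"
| ExI: "G \<turnstile> inst t p \<Longrightarrow> G \<turnstile> FEx p"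
| ExE: "G \<turnstile> FEx p \<Longrightarrow> insert p (lift ` G) \<turnstile> lift r \<Longrightarrow> G \<turnstile> r"
| EqI: "G \<turnstile> FEq t t"
| EqE: "G \<turnstile> FEq s t \<Longrightarrow> G \<turnstile> inst s p \<Longrightarrow> G \<turnstile> inst t p"

lemma tval_subst: "tval M e (subst_tm \<sigma> t) = tval M (\<lambda>n. tval M e (\<sigma> n)) t"
  by (induction t) (auto cong: map_cong)

lemma sat_subst: "sat M e (subst \<sigma> p) = sat M (\<lambda>n. tval M e (\<sigma> n)) p"
proof (induction p arbitrary: e \<sigma>)
  case (FAll p)
  have "(\<lambda>n. tval M (case_nat a e) (under \<sigma> n)) = case_nat a (\<lambda>n. tval M e (\<sigma> n))" for a
    by (auto simp: under_def tval_subst fun_eq_iff split: nat.splits)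
  then show ?case using FAll by simp
next
  case (FEx p)
  have "(\<lambda>n. tval M (case_nat a e) (under \<sigma> n)) = case_nat a (\<lambda>n. tval M e (\<sigma> n))" for a
    by (auto simp: under_def tval_subst fun_eq_iff split: nat.splits)
  then show ?case using FEx by simp
qed (auto simp: tval_subst comp_def)

lemma sat_inst: "sat M e (inst t p) = sat M (case_nat (tval M e t) e) p"
proof -
  have "(\<lambda>n. tval M e (case_nat t Var n)) = case_nat (tval M e t) e"
    by (auto simp: fun_eq_iff split: nat.splits)
  then show ?thesis by (simp add: inst_def sat_subst)
qed

lemma soundness:
  assumes "G \<turnstile> p" and "univ M = UNIV" and "\<forall>q\<in>G. sat M e q"
  shows "sat M e p"
  using assms
proof (induction arbitrary: e rule: nd.induct)
  case (EqE G s t p) then show ?case by (simp add: sat_inst)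
next
  case (ExE G p r)
  have "sat M e (FEx p)" using ExE.IH(1) ExE.prems by blast
  then obtain a where a: "sat M (case_nat a e) p" by auto
  then have "\<forall>q\<in>insert p (lift ` G). sat M (case_nat a e) q" using ExE.prems by (simp add: sat_subst)
  then have "sat M (case_nat a e) (lift r)" using ExE.IH(2) ExE.prems(1) by blast
  then show ?case by (simp add: sat_subst)
next
  case (OrE G p q r) then show ?case by (metis insert_iff sat.simps(6))
qed (auto simp: sat_inst sat_subst)


section \<open>Polynomial-time oracle Turing machines\<close>

text \<open>A machine has \<open>otm_work\<close> work tapes besides tape 0 (input and output) and tape 1 (oracle queries), all
  two-way infinite. States and tape symbols are natural numbers, of which the finite transition table uses
  only finitely many; the start state is 0. Tape symbols: 0 is the blank, 1 and 2 are the bits 0 and 1, and 3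
  separates the inputs. A table entry maps a state and the scanned symbols to a new state and, for each tape,
  a symbol to write and a head move; the machine halts when no entry applies. If \<open>otm_query\<close> is
  \<open>Some (q, yes, no)\<close>, then in state \<open>q\<close> the machine moves to \<open>yes\<close> or \<open>no\<close> according to whether the number
  written on tape 1 is in the oracle. Machines with \<open>otm_query = None\<close> are plain Turing machines.\<close>

datatype move = MoveL | MoveR | Stay

datatype otm = OTM
  (otm_work: nat)
  (otm_table: "((nat \<times> nat list) \<times> (nat \<times> (nat \<times> move) list)) list")
  (otm_query: "(nat \<times> nat \<times> nat) option")

definition wf_otm :: "otm \<Rightarrow> bool" where
  "wf_otm M \<longleftrightarrow>
     (\<forall>((q, ss), (q', acts)) \<in> set (otm_table M).
        length ss = otm_work M + 2 \<and> length acts = otm_work M + 2)"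

type_synonym tape = "int \<times> (int \<Rightarrow> nat)"  \<comment> \<open>head position and cell contents\<close>
type_synonym config = "nat \<times> tape list"

abbreviation blen :: "nat \<Rightarrow> nat" where
  "blen a \<equiv> floorlog 2 a"

lemma blen_iff: "blen a \<le> l \<longleftrightarrow> a < 2 ^ l"
  using floorlog_leD [of 2 a l] floorlog_leI [of a 2 l] by auto

text \<open>Numbers are written in binary, least significant bit first, starting at cell 0 (\<open>0\<close> is the empty word).\<close>

definition num_word :: "nat \<Rightarrow> nat list" where
  "num_word a = map (\<lambda>i. if bit a i then 2 else 1) [0..<blen a]"

definition input_word :: "nat list \<Rightarrow> nat list" where
  "input_word xs = concat (map (\<lambda>a. num_word a @ [3]) xs)"

definition read_num :: "(int \<Rightarrow> nat) \<Rightarrow> nat" where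
  "read_num c =
     (let l = (LEAST l. c (int l) \<notin> {1, 2}) in \<Sum>i<l. (c (int i) - 1) * 2 ^ i)"

definition init_config :: "otm \<Rightarrow> nat list \<Rightarrow> config" where
  "init_config M xs =
     (let w = input_word xs in
      (0, (0, \<lambda>i. if 0 \<le> i \<and> nat i < length w then w ! nat i else 0)
          # replicate (otm_work M + 1) (0, \<lambda>_. 0)))"

fun tape_step :: "nat \<times> move \<Rightarrow> tape \<Rightarrow> tape" where
  "tape_step (s, m) (h, c) =
     (case m of MoveL \<Rightarrow> h - 1 | MoveR \<Rightarrow> h + 1 | Stay \<Rightarrow> h, c(h := s))"

definition table_step :: "otm \<Rightarrow> config \<Rightarrow> config option" where
  "table_step M = (\<lambda>(q, ts).
     map_option (\<lambda>(q', acts). (q', map2 tape_step acts ts))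
       (map_of (otm_table M) (q, map (\<lambda>(h, c). c h) ts)))"

definition step :: "nat set \<Rightarrow> otm \<Rightarrow> config \<Rightarrow> config option" where
  "step A M = (\<lambda>(q, ts).
     case otm_query M of
       None \<Rightarrow> table_step M (q, ts)
     | Some (qq, yes, no) \<Rightarrow>
         if q = qq then Some (if read_num (snd (ts ! 1)) \<in> A then yes else no, ts)
         else table_step M (q, ts))"

definition run :: "nat set \<Rightarrow> otm \<Rightarrow> nat list \<Rightarrow> nat \<Rightarrow> config" where
  "run A M xs n = ((\<lambda>c. case step A M c of None \<Rightarrow> c | Some c' \<Rightarrow> c') ^^ n) (init_config M xs)"

definition halts_in :: "nat set \<Rightarrow> otm \<Rightarrow> nat list \<Rightarrow> nat \<Rightarrow> bool" where
  "halts_in A M xs n \<longleftrightarrow> step A M (run A M xs n) = None"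

definition otm_output :: "nat set \<Rightarrow> otm \<Rightarrow> nat list \<Rightarrow> nat" where
  "otm_output A M xs = read_num (snd (snd (run A M xs (LEAST n. halts_in A M xs n)) ! 0))"

definition poly_time :: "nat \<Rightarrow> otm \<Rightarrow> bool" where
  "poly_time k M \<longleftrightarrow>
     (\<exists>p :: nat poly. \<forall>A xs. length xs = k \<longrightarrow>
        (\<exists>n \<le> poly p (sum_list (map blen xs)). halts_in A M xs n))"


section \<open>The languages PV and PV(alpha)\<close>

text \<open>A function symbol is a machine together with the arity at which it is used.\<close>

type_synonym psym = "nat \<times> otm"

definition PVa :: "psym set" where
  "PVa = {(k, M). wf_otm M \<and> poly_time k M}"

definition PV :: "psym set" where
  "PV = {f \<in> PVa. otm_query (snd f) = None}"

datatype prel = Less | Alpha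

type_synonym pfm = "(psym, prel) fm"

fun prel_ar :: "prel \<Rightarrow> nat" where
  "prel_ar Less = 2"
| "prel_ar Alpha = 1"

abbreviation wf_pfm :: "psym set \<Rightarrow> pfm \<Rightarrow> bool" where
  "wf_pfm F \<equiv> wf_fm F fst prel_ar"

abbreviation FLess :: "psym tm \<Rightarrow> psym tm \<Rightarrow> pfm" where
  "FLess s t \<equiv> FRel Less [s, t]"

definition pv_val :: "nat set \<Rightarrow> psym \<Rightarrow> nat list \<Rightarrow> nat" where
  "pv_val A f = otm_output A (snd f)"

definition std :: "nat set \<Rightarrow> (psym, prel, nat) struct" where
  "std A = \<lparr>univ = UNIV, fn = pv_val A,
            rl = (\<lambda>r as. case r of Less \<Rightarrow> as ! 0 < as ! 1 | Alpha \<Rightarrow> as ! 0 \<in> A)\<rparr>"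

text \<open>The constant \<open>0\<close>: the nullary machine that halts immediately on the empty tape.\<close>

definition zero_sym :: psym where
  "zero_sym = (0, OTM 0 [] None)"

lemma zero_sym_halts: "halts_in A (snd zero_sym) xs n"
  by (simp add: halts_in_def step_def table_step_def zero_sym_def split: prod.splits)

lemma zero_sym_PV: "zero_sym \<in> PV"
  using zero_sym_halts by (auto simp: PV_def PVa_def wf_otm_def poly_time_def zero_sym_def)

lemma zero_sym_val: "pv_val A zero_sym [] = 0"
proof -
  have "(LEAST n. halts_in A (snd zero_sym) [] n) = 0"
    using zero_sym_halts by (simp add: Least_eq_0)
  moreover have "(LEAST l::nat. True) = 0"
    by (rule Least_eq_0) simp
  ultimately show ?thesis
    by (simp add: pv_val_def otm_output_def run_def init_config_def input_word_def read_num_def)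
qed


section \<open>The theory T(1,2) over PV(alpha)\<close>

definition all_PVa :: "pfm set" where
  "all_PVa = {p. \<exists>n q. p = (FAll ^^ n) q \<and> quantifier_free q \<and> wf_pfm PVa q \<and> fv p = {} \<and>
                       (\<forall>A. models (std A) p)}"

text \<open>The length function, as any of the symbols of PV that compute it. Any two of them are provably equal
  in \<open>all_PVa\<close>, so it is immaterial which of them are used in sharply bounded quantifiers.\<close>

definition len_syms :: "psym set" where
  "len_syms = {g \<in> PV. fst g = 1 \<and> (\<forall>a. pv_val {} g [a] = blen a)}"

definition ex_less :: "psym tm \<Rightarrow> pfm \<Rightarrow> pfm" where
  "ex_less t p = FEx (FAnd (FLess (Var 0) (lift_tm t)) p)"

definition all_less :: "psym tm \<Rightarrow> pfm \<Rightarrow> pfm" where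
  "all_less t p = FAll (FImp (FLess (Var 0) (lift_tm t)) p)"

inductive_set sharply_bounded :: "psym set \<Rightarrow> pfm set" for F where
  qf: "quantifier_free p \<Longrightarrow> wf_pfm F p \<Longrightarrow> p \<in> sharply_bounded F"
| Neg: "p \<in> sharply_bounded F \<Longrightarrow> FNeg p \<in> sharply_bounded F"
| And: "p \<in> sharply_bounded F \<Longrightarrow> q \<in> sharply_bounded F \<Longrightarrow> FAnd p q \<in> sharply_bounded F"
| Or: "p \<in> sharply_bounded F \<Longrightarrow> q \<in> sharply_bounded F \<Longrightarrow> FOr p q \<in> sharply_bounded F"
| Ex: "p \<in> sharply_bounded F \<Longrightarrow> wf_tm F fst t \<Longrightarrow> g \<in> len_syms \<Longrightarrow>
        ex_less (Fn g [t]) p \<in> sharply_bounded F"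
| All: "p \<in> sharply_bounded F \<Longrightarrow> wf_tm F fst t \<Longrightarrow> g \<in> len_syms \<Longrightarrow>
        all_less (Fn g [t]) p \<in> sharply_bounded F"

inductive_set Sigma_b_1 :: "pfm set" where
  sharp: "p \<in> sharply_bounded PVa \<Longrightarrow> p \<in> Sigma_b_1"
| And: "p \<in> Sigma_b_1 \<Longrightarrow> q \<in> Sigma_b_1 \<Longrightarrow> FAnd p q \<in> Sigma_b_1"
| Or: "p \<in> Sigma_b_1 \<Longrightarrow> q \<in> Sigma_b_1 \<Longrightarrow> FOr p q \<in> Sigma_b_1"
| sharp_Ex: "p \<in> Sigma_b_1 \<Longrightarrow> wf_tm PVa fst t \<Longrightarrow> g \<in> len_syms \<Longrightarrow>
        ex_less (Fn g [t]) p \<in> Sigma_b_1"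
| sharp_All: "p \<in> Sigma_b_1 \<Longrightarrow> wf_tm PVa fst t \<Longrightarrow> g \<in> len_syms \<Longrightarrow>
        all_less (Fn g [t]) p \<in> Sigma_b_1"
| Ex: "p \<in> Sigma_b_1 \<Longrightarrow> wf_tm PVa fst t \<Longrightarrow> ex_less t p \<in> Sigma_b_1"

text \<open>In \<open>p\<close> the variable to be minimized is \<open>Var 0\<close>, all others are parameters. The two renamings shift the
  parameters past the new quantifiers.\<close>

definition minimization :: "pfm \<Rightarrow> pfm" where
  "minimization p =
     FImp p
       (FEx (FAnd (FOr (FLess (Var 0) (Var 1)) (FEq (Var 0) (Var 1)))
            (FAnd (subst (case_nat (Var 0) (\<lambda>i. Var (i + 2))) p)
                  (all_less (Var 0) (FNeg (subst (case_nat (Var 0) (\<lambda>i. Var (i + 3))) p))))))"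

definition all_T12 :: "pfm set" where
  "all_T12 = all_PVa \<union>
     {q. \<exists>n. \<exists>p\<in>Sigma_b_1. q = (FAll ^^ n) (minimization p) \<and> fv q = {}}"


section \<open>Consequence and independence\<close>

text \<open>For a formula \<open>\<theta>'(u, v)\<close> with \<open>v = Var 0\<close>, \<open>u = Var 1\<close>, replace every atom \<open>\<alpha>(r)\<close> by \<open>f(r, z) = 0\<close>, where the
  parameters \<open>z\<close> are the \<open>m\<close> fresh variables \<open>Var 2, \<dots>, Var (m + 1)\<close>; \<open>d\<close> is the quantifier depth.
  The block of universal quantifiers in \<open>consequence\<close> binds \<open>u\<close> and all of \<open>z\<close>; in \<open>FEx \<theta>\<close> the variable \<open>x\<close> is free.\<close>

fun subst_alpha :: "psym \<Rightarrow> nat \<Rightarrow> nat \<Rightarrow> pfm \<Rightarrow> pfm" where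
  "subst_alpha f m d (FRel Alpha [r]) =
     FEq (Fn f (r # map (\<lambda>i. Var (d + 2 + i)) [0..<m])) (Fn zero_sym [])"
| "subst_alpha f m d (FNeg p) = FNeg (subst_alpha f m d p)"
| "subst_alpha f m d (FAnd p q) = FAnd (subst_alpha f m d p) (subst_alpha f m d q)"
| "subst_alpha f m d (FOr p q) = FOr (subst_alpha f m d p) (subst_alpha f m d q)"
| "subst_alpha f m d (FAll p) = FAll (subst_alpha f m (Suc d) p)"
| "subst_alpha f m d (FEx p) = FEx (subst_alpha f m (Suc d) p)"
| "subst_alpha f m d p = p"

definition consequence :: "pfm set \<Rightarrow> pfm \<Rightarrow> pfm \<Rightarrow> bool" where
  "consequence T \<theta> \<theta>' \<longleftrightarrow>
     T \<union> {(FAll ^^ Suc m) (FEx (subst_alpha f m 0 \<theta>')) | f m. f \<in> PVa \<and> fst f = Suc m} \<turnstile> FEx \<theta>"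

definition independent :: "pfm set \<Rightarrow> pfm \<Rightarrow> pfm \<Rightarrow> bool" where
  "independent T \<theta> \<theta>' \<longleftrightarrow> \<not> consequence T \<theta> \<theta>'"


section \<open>Basic sentences and finitary combinatorial principles\<close>

text \<open>The symbols of a finite language \<open>L\<close> are natural numbers, so that they can be components of tuples.\<close>

record lang =
  funs :: "nat set"
  rels :: "nat set"
  ar :: "nat \<Rightarrow> nat"

definition finite_lang :: "lang \<Rightarrow> bool" where
  "finite_lang L \<longleftrightarrow> finite (funs L) \<and> finite (rels L) \<and> funs L \<inter> rels L = {}"

datatype fsym = LF nat | PVF psym
datatype rsym = LR nat | PVLess

type_synonym bfm = "(fsym, rsym) fm"

text \<open>The arguments of literals are variables: \<open>j\<close> stands for \<open>y\<^sub>j\<close>, which is \<open>Var j\<close> in the matrix. The outermost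
  existential quantifier of \<open>sentence \<phi>\<close> below thus binds the variable of largest index.\<close>

datatype literal =
    PosRel rsym "nat list"
  | NegRel rsym "nat list"
  | FunEq fsym "nat list" nat
  | NegEq nat nat
  | PosEq nat nat

record basic =
  nvars :: nat
  dnf :: "literal list list"


fun wf_rel_args :: "lang \<Rightarrow> rsym \<Rightarrow> nat list \<Rightarrow> bool" where
  "wf_rel_args L (LR S) us = (S \<in> rels L \<and> length us = ar L S)"
| "wf_rel_args L PVLess us = (length us = 2)"

fun wf_fun_args :: "lang \<Rightarrow> fsym \<Rightarrow> nat list \<Rightarrow> bool" where
  "wf_fun_args L (LF S) us = (S \<in> funs L \<and> length us = ar L S)"
| "wf_fun_args L (PVF f) us = (f \<in> PV \<and> length us = fst f)"

fun wf_literal :: "lang \<Rightarrow> nat \<Rightarrow> literal \<Rightarrow> bool" where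
  "wf_literal L k (PosRel r us) = (wf_rel_args L r us \<and> set us \<subseteq> {..<k})"
| "wf_literal L k (NegRel r us) = (wf_rel_args L r us \<and> set us \<subseteq> {..<k})"
| "wf_literal L k (FunEq f us v) = (wf_fun_args L f us \<and> set us \<subseteq> {..<k} \<and> v < k)"
| "wf_literal L k (NegEq u v) = (u < k \<and> v < k)"
| "wf_literal L k (PosEq u v) = (u < k \<and> v < k)"

definition wf_basic :: "lang \<Rightarrow> basic \<Rightarrow> bool" where
  "wf_basic L \<phi> \<longleftrightarrow> (\<forall>c\<in>set (dnf \<phi>). \<forall>l\<in>set c. wf_literal L (nvars \<phi>) l)"

fun builtin_literal :: "literal \<Rightarrow> bool" where
  "builtin_literal (PosRel r us) = (r = PVLess)"
| "builtin_literal (NegRel r us) = (r = PVLess)"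
| "builtin_literal (FunEq f us v) = (\<exists>g. f = PVF g)"
| "builtin_literal (NegEq u v) = False"
| "builtin_literal (PosEq u v) = False"

definition without_builtin :: "basic \<Rightarrow> bool" where
  "without_builtin \<phi> \<longleftrightarrow> (\<forall>c\<in>set (dnf \<phi>). \<forall>l\<in>set c. \<not> builtin_literal l)"

fun literal_fm :: "literal \<Rightarrow> bfm" where
  "literal_fm (PosRel r us) = FRel r (map Var us)"
| "literal_fm (NegRel r us) = FNeg (FRel r (map Var us))"
| "literal_fm (FunEq f us v) = FEq (Fn f (map Var us)) (Var v)"
| "literal_fm (NegEq u v) = FNeg (FEq (Var u) (Var v))"
| "literal_fm (PosEq u v) = FEq (Var u) (Var v)"

definition matrix :: "basic \<Rightarrow> bfm" where
  "matrix \<phi> = foldr FOr (map (\<lambda>c. foldr FAnd (map literal_fm c) (FNeg FBot)) (dnf \<phi>)) FBot"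

definition sentence :: "basic \<Rightarrow> bfm" where
  "sentence \<phi> = (FEx ^^ nvars \<phi>) (matrix \<phi>)"

definition tuples :: "'a set \<Rightarrow> nat \<Rightarrow> 'a list set" where
  "tuples A k = {as. set as \<subseteq> A \<and> length as = k}"

text \<open>Structures for a language \<open>L\<close> interpret all of \<open>fsym\<close> and \<open>rsym\<close>, but only the values at symbols of
  \<open>L\<close>, on tuples of the right length from the universe, are relevant. On universes \<open>[n]\<close> the built-in symbols
  are reset by \<open>with_PV\<close>; a value of a built-in function may then lie outside of \<open>[n]\<close>, so that the literal
  \<open>f(u) = v\<close> holds on \<open>[n]\<close> iff it holds in the standard model.\<close>

type_synonym 'a lstr = "(fsym, rsym, 'a) struct"

definition is_structure :: "lang \<Rightarrow> 'a lstr \<Rightarrow> bool" where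
  "is_structure L B \<longleftrightarrow> univ B \<noteq> {} \<and>
     (\<forall>S\<in>funs L. \<forall>as\<in>tuples (univ B) (ar L S). fn B (LF S) as \<in> univ B)"

definition with_PV :: "nat lstr \<Rightarrow> nat lstr" where
  "with_PV B = \<lparr>univ = univ B,
     fn = (\<lambda>s. case s of LF S \<Rightarrow> fn B (LF S) | PVF f \<Rightarrow> pv_val {} f),
     rl = (\<lambda>s. case s of LR S \<Rightarrow> rl B (LR S) | PVLess \<Rightarrow> (\<lambda>as. as ! 0 < as ! 1))\<rparr>"

definition finitary_principle :: "lang \<Rightarrow> basic \<Rightarrow> bool" where
  "finitary_principle L \<phi> \<longleftrightarrow> finite_lang L \<and> wf_basic L \<phi> \<and>
     (\<forall>n\<ge>1. \<forall>B. univ B = {..<n} \<and> is_structure L B \<longrightarrow> models (with_PV B) (sentence \<phi>))"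


section \<open>The search problem of a finitary combinatorial principle\<close>

text \<open>The tupling \<open>\<langle>\<dots>\<rangle>\<close> is iterated Cantor pairing.\<close>

definition tup :: "nat list \<Rightarrow> nat" where
  "tup = list_encode"

definition proj :: "nat \<Rightarrow> nat \<Rightarrow> nat" where
  "proj y j = (let ys = list_decode y in if j < length ys then ys ! j else 0)"

definition bin_code :: "nat \<Rightarrow> nat set \<Rightarrow> nat lstr" where
  "bin_code n X = with_PV
     \<lparr>univ = {..<n},
      fn = (\<lambda>s as. case s of
              LF S \<Rightarrow> min (\<Sum>i<blen n. of_bool (tup (S # as @ [i]) \<in> X) * 2 ^ i) (n - 1)
            | PVF f \<Rightarrow> 0),
      rl = (\<lambda>s as. case s of LR S \<Rightarrow> tup (S # as) \<in> X | PVLess \<Rightarrow> False)\<rparr>"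

lemma bin_code_number:
  fixes P :: "nat \<Rightarrow> bool" and l :: nat
  defines "a \<equiv> (\<Sum>i<l. of_bool (P i) * 2 ^ i :: nat)"
  shows "a < 2 ^ l" and "i < l \<Longrightarrow> bit a i \<longleftrightarrow> P i"
proof -
  have a: "a = horner_sum of_bool 2 (map P [0..<l])"
    by (simp add: a_def horner_sum_eq_sum lessThan_atLeast0)
  then have "take_bit l a = a"
    by (simp add: take_bit_horner_sum_bit_eq)
  then show "a < 2 ^ l"
    by (metis take_bit_nat_less_exp)
  show "i < l \<Longrightarrow> bit a i \<longleftrightarrow> P i"
    unfolding a by (simp add: bit_horner_sum_bit_iff)
qed

text \<open>\<open>expresses_Q \<phi> Q\<close>: the formula \<open>Q(x, y)\<close>, with \<open>y = Var 0\<close> and \<open>x = Var 1\<close>, is a choice for \<open>Q\<^sub>\<phi>\<close>. It contains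
  \<open>\<alpha>\<close> only as a relation symbol and no proper oracle machines, as required for the substitution of \<open>\<alpha>\<close>. Any two
  choices are provably equivalent in \<open>all_PVa\<close>, also after substituting for \<open>\<alpha>\<close>.\<close>

definition expresses_Q :: "basic \<Rightarrow> pfm \<Rightarrow> bool" where
  "expresses_Q \<phi> Q \<longleftrightarrow> Q \<in> sharply_bounded PV \<and> fv Q \<subseteq> {0, 1} \<and>
     (\<forall>A x y e. sat (std A) (case_nat y (case_nat x e)) Q \<longleftrightarrow>
        (0 < x \<longrightarrow> (\<forall>j<nvars \<phi>. proj y j < x) \<and> sat (bin_code x A) (proj y) (matrix \<phi>)))"


section \<open>Partial structures and determinacy\<close>

record ('f, 'r, 'a) pstruct =
  puniv :: "'a set"
  pfn :: "'f \<Rightarrow> 'a list \<Rightarrow> 'a option"  \<comment> \<open>\<open>None\<close> is the value 1/2\<close>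
  prl :: "'r \<Rightarrow> 'a list \<Rightarrow> bool option"

primrec ptval :: "('f, 'r, 'a) pstruct \<Rightarrow> (nat \<Rightarrow> 'a) \<Rightarrow> 'f tm \<Rightarrow> 'a option" where
  "ptval P e (Var n) = Some (e n)"
| "ptval P e (Fn f ts) =
     (let vs = map (ptval P e) ts in if None \<in> set vs then None else pfn P f (map the vs))"

definition tv :: "bool option \<Rightarrow> real" where
  "tv b = (case b of None \<Rightarrow> 1 / 2 | Some b \<Rightarrow> of_bool b)"

text \<open>Strong Kleene truth values. As there are only three values, \<open>Min\<close> and \<open>Max\<close> below range over finite sets,
  even if the universe is infinite.\<close>

primrec kval :: "('f, 'r, 'a) pstruct \<Rightarrow> (nat \<Rightarrow> 'a) \<Rightarrow> ('f, 'r) fm \<Rightarrow> real" where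
  "kval P e FBot = 0"
| "kval P e (FEq s t) =
     (case (ptval P e s, ptval P e t) of (Some a, Some b) \<Rightarrow> of_bool (a = b) | _ \<Rightarrow> 1 / 2)"
| "kval P e (FRel r ts) =
     (let vs = map (ptval P e) ts in if None \<in> set vs then 1 / 2 else tv (prl P r (map the vs)))"
| "kval P e (FNeg p) = 1 - kval P e p"
| "kval P e (FAnd p q) = min (kval P e p) (kval P e q)"
| "kval P e (FOr p q) = max (kval P e p) (kval P e q)"
| "kval P e (FAll p) = Min ((\<lambda>a. kval P (case_nat a e) p) ` puniv P)"
| "kval P e (FEx p) = Max ((\<lambda>a. kval P (case_nat a e) p) ` puniv P)"

definition verifies :: "('f, 'r, 'a) pstruct \<Rightarrow> ('f, 'r) fm \<Rightarrow> bool" where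
  "verifies P p \<longleftrightarrow> (\<forall>e. range e \<subseteq> puniv P \<longrightarrow> kval P e p = 1)"

type_synonym 'a plstr = "(fsym, rsym, 'a) pstruct"

definition is_pstructure :: "lang \<Rightarrow> 'a plstr \<Rightarrow> bool" where
  "is_pstructure L P \<longleftrightarrow> puniv P \<noteq> {} \<and>
     (\<forall>S\<in>funs L. \<forall>as\<in>tuples (puniv P) (ar L S). \<forall>b. pfn P (LF S) as = Some b \<longrightarrow> b \<in> puniv P)"

definition psize :: "lang \<Rightarrow> 'a plstr \<Rightarrow> nat" where
  "psize L P = card
     ({(S, as). S \<in> funs L \<and> as \<in> tuples (puniv P) (ar L S) \<and> pfn P (LF S) as \<noteq> None} \<union>
      {(S, as). S \<in> rels L \<and> as \<in> tuples (puniv P) (ar L S) \<and> prl P (LR S) as \<noteq> None})"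

definition max_size :: "lang \<Rightarrow> nat \<Rightarrow> nat" where
  "max_size L n = (\<Sum>S\<in>funs L \<union> rels L. n ^ ar L S)"

text \<open>Expansion of a partial structure by the partial substructure that the standard PV-model induces on its universe.\<close>

definition pwith_PV :: "nat plstr \<Rightarrow> nat plstr" where
  "pwith_PV P = \<lparr>puniv = puniv P,
     pfn = (\<lambda>s as. case s of
              LF S \<Rightarrow> pfn P (LF S) as
            | PVF f \<Rightarrow> (if pv_val {} f as \<in> puniv P then Some (pv_val {} f as) else None)),
     prl = (\<lambda>s as. case s of LR S \<Rightarrow> prl P (LR S) as | PVLess \<Rightarrow> Some (as ! 0 < as ! 1))\<rparr>"

text \<open>Only the universe \<open>[n]\<close> is considered: verification of sentences with built-in symbols is defined for no
  other universe of cardinality \<open>n\<close>, and that of other sentences is invariant under isomorphism.\<close>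

definition determinacy :: "lang \<Rightarrow> basic \<Rightarrow> nat \<Rightarrow> nat" where
  "determinacy L \<phi> n = (LEAST m. \<forall>P. puniv P = {..<n} \<and> is_pstructure L P \<and> m \<le> psize L P
                                   \<longrightarrow> verifies (pwith_PV P) (sentence \<phi>))"

definition weak :: "lang \<Rightarrow> basic \<Rightarrow> bool" where
  "weak L \<phi> \<longleftrightarrow> (\<exists>\<epsilon>>0. \<forall>\<^sub>F n in sequentially.
     real (max_size L n) \<ge> real n powr \<epsilon> * real (determinacy L \<phi> n))"


section \<open>Large structures and strong sentences\<close>

definition psubstructure :: "lang \<Rightarrow> 'a plstr \<Rightarrow> 'a plstr \<Rightarrow> bool" where
  "psubstructure L P Q \<longleftrightarrow> is_pstructure L P \<and> is_pstructure L Q \<and> puniv P \<subseteq> puniv Q \<and>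
     (\<forall>S\<in>funs L. \<forall>as\<in>tuples (puniv P) (ar L S). pfn P (LF S) as \<in> {pfn Q (LF S) as, None}) \<and>
     (\<forall>S\<in>rels L. \<forall>as\<in>tuples (puniv P) (ar L S). prl P (LR S) as \<in> {prl Q (LR S) as, None})"

definition induced_psubstructure :: "lang \<Rightarrow> 'a plstr \<Rightarrow> 'a plstr \<Rightarrow> bool" where
  "induced_psubstructure L P Q \<longleftrightarrow> psubstructure L P Q \<and>
     (\<forall>S\<in>funs L. \<forall>as\<in>tuples (puniv P) (ar L S).
        pfn P (LF S) as = (case pfn Q (LF S) as of
                             None \<Rightarrow> None
                           | Some b \<Rightarrow> if b \<in> puniv P then Some b else None)) \<and>
     (\<forall>S\<in>rels L. \<forall>as\<in>tuples (puniv P) (ar L S). prl P (LR S) as = prl Q (LR S) as)"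

definition piso :: "lang \<Rightarrow> ('a \<Rightarrow> 'b) \<Rightarrow> 'a plstr \<Rightarrow> 'b plstr \<Rightarrow> bool" where
  "piso L h P Q \<longleftrightarrow> bij_betw h (puniv P) (puniv Q) \<and>
     (\<forall>S\<in>funs L. \<forall>as\<in>tuples (puniv P) (ar L S).
        pfn Q (LF S) (map h as) = map_option h (pfn P (LF S) as)) \<and>
     (\<forall>S\<in>rels L. \<forall>as\<in>tuples (puniv P) (ar L S). prl Q (LR S) (map h as) = prl P (LR S) as)"

definition embeds :: "lang \<Rightarrow> 'a plstr \<Rightarrow> 'b plstr \<Rightarrow> bool" where
  "embeds L P Q \<longleftrightarrow> (\<exists>h R. piso L h P R \<and> psubstructure L R Q)"

definition as_partial :: "'a lstr \<Rightarrow> 'a plstr" where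
  "as_partial B = \<lparr>puniv = univ B, pfn = (\<lambda>s as. Some (fn B s as)), prl = (\<lambda>s as. Some (rl B s as))\<rparr>"

definition large_sub :: "lang \<Rightarrow> (nat \<Rightarrow> nat) \<Rightarrow> 'a lstr \<Rightarrow> 'a plstr \<Rightarrow> bool" where
  "large_sub L g B P \<longleftrightarrow> induced_psubstructure L P (as_partial B) \<and> finite (puniv P) \<and>
     (\<exists>V \<subseteq> univ B - puniv P. finite V \<and> card V \<le> g (card (puniv P)) \<and>
        (\<forall>S\<in>funs L. fn B (LF S) ` tuples (puniv P) (ar L S) \<subseteq> puniv P \<union> V))"

definition large :: "lang \<Rightarrow> (nat \<Rightarrow> nat) \<Rightarrow> 'a lstr \<Rightarrow> bool" where
  "large L g B \<longleftrightarrow>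
     (\<forall>P. psubstructure L P (as_partial B) \<and> finite (puniv P) \<longrightarrow>
        (\<exists>P'. large_sub L g B P' \<and> card (puniv P') = card (puniv P) \<and> embeds L P P'))"

definition subpolynomial :: "(nat \<Rightarrow> nat) \<Rightarrow> bool" where
  "subpolynomial g \<longleftrightarrow>
     (\<exists>h. h \<longlonglongrightarrow> 0 \<and> (\<forall>\<^sub>F n in sequentially. real (g n) = real n powr h n))"

text \<open>Universes are subsets of the type \<open>'a\<close>; a theorem with hypothesis \<open>strong TYPE('a) L \<phi>\<close> for a type
  variable \<open>'a\<close> covers models of every kind.\<close>

definition strong :: "'a itself \<Rightarrow> lang \<Rightarrow> basic \<Rightarrow> bool" where
  "strong T L \<phi> \<longleftrightarrow>
     (\<exists>(B :: 'a lstr) g. is_structure L B \<and> infinite (univ B) \<and> models B (FNeg (sentence \<phi>)) \<and>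
        subpolynomial g \<and> large L g B)"

end

(*
  A forcing argument. An index n that ranges over infinite sets of natural numbers plays the role of a nonstandard
  number, and "small" means polynomial in the length of n. A condition names a small set of elements of a large infinite
  model B of the negation of \<phi> by numbers below n; it thereby decides bits of the oracle, which is to be the binary code
  of a structure on [n]. Elements of the forced structure are computed from the oracle by small decision trees, so
  some extension of every condition decides a given element or a given sharply bounded formula.

  Minimization is forced, because bounded existential formulas have small certificates: choose the least number for
  which a certificate is contained in some small extension.

  No condition forces a solution of the search problem of \<phi> for x = n, since B satisfies the negation of \<phi>.

  For an oracle that is itself computed by small decision trees, the values of its binary code on [u] are given by a
  family of trees. As B is large, a single naming of n elements of B decides almost all of them. The principle is weak,
  so it is verified already by the partial structure with these values, and the verification uses boundedly many of
  them, which are decided by a small condition.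
*)

theory Submission
  imports Defs
begin

section \<open>Weak forcing over a family of structures\<close>

text \<open>Conditions grow polynomially in the length of n so that repeated refinement stays within
  such a bound, while for large n there is always room for further names below n. The obstacle for
  minimization is that forcing an existential formula says nothing about the size of the extensions
  that witness it, so that no least value can be read off. The size of certificates is therefore
  bounded uniformly, by the formula and the lengths of its parameters alone, and any extension can
  be cut down to the names that support a given certificate. Extensions preserve the decided
  literals, not the named elements themselves. This freedom matters for the weak principle: the
  binary code of a structure on [u] may have more entries than a condition can decide, but elements
  can be renamed within a large structure so that at most g n elements are unnamed function values.
  Each round of queries then loses only a small proportion of the decision trees, since a polynomial
  in the length of n times a subpolynomial g is eventually below n. Half of the entries survive,
  which suffices for large u; for the finitely many small u no entry is lost.\<close>

text \<open>Elements of the forced structure are families of elements of the structures \<open>St w\<close>. An atom is strongly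
  forced by \<open>P\<close> if it holds at all \<open>w \<in> pts P\<close>; the double negation closure of this makes classical logic sound.\<close>

locale forcing =
  fixes Pos :: "'p set" and below :: "'p \<Rightarrow> 'p set" and pts :: "'p \<Rightarrow> 'w set"
    and St :: "'w \<Rightarrow> ('f, 'r, 'v) struct" and Nm :: "('w \<Rightarrow> 'v) set"
  assumes below_refl: "P \<in> Pos \<Longrightarrow> P \<in> below P"
    and below_Pos: "Q \<in> below P \<Longrightarrow> Q \<in> Pos"
    and below_trans: "R \<in> below Q \<Longrightarrow> Q \<in> below P \<Longrightarrow> R \<in> below P"
    and pts_mono: "Q \<in> below P \<Longrightarrow> pts Q \<subseteq> pts P"
    and Nm_fn: "set ts \<subseteq> Nm \<Longrightarrow> (\<lambda>w. fn (St w) f (map (\<lambda>t. t w) ts)) \<in> Nm"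
begin

lemma below_self: "Q \<in> below P \<Longrightarrow> Q \<in> below Q"
  by (rule below_refl [OF below_Pos])

definition dense_below :: "'p \<Rightarrow> ('p \<Rightarrow> bool) \<Rightarrow> bool" where
  "dense_below P \<Phi> \<longleftrightarrow> (\<forall>Q\<in>below P. \<exists>R\<in>below Q. \<Phi> R)"

lemma dense_belowI: "(\<And>Q. Q \<in> below P \<Longrightarrow> \<exists>R\<in>below Q. \<Phi> R) \<Longrightarrow> dense_below P \<Phi>"
  by (auto simp: dense_below_def)

lemma dense_belowD: "dense_below P \<Phi> \<Longrightarrow> Q \<in> below P \<Longrightarrow> \<exists>R\<in>below Q. \<Phi> R"
  by (auto simp: dense_below_def)

lemma dense_below_always: "(\<And>Q. Q \<in> below P \<Longrightarrow> \<Phi> Q) \<Longrightarrow> dense_below P \<Phi>"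
  unfolding dense_below_def by (blast intro: below_self)

lemma dense_below_mono: "dense_below P \<Phi> \<Longrightarrow> Q \<in> below P \<Longrightarrow> dense_below Q \<Phi>"
  unfolding dense_below_def using below_trans by blast

lemma dense_below_idem: "dense_below P (\<lambda>Q. dense_below Q \<Phi>) \<Longrightarrow> dense_below P \<Phi>"
  unfolding dense_below_def using below_trans below_self by meson

primrec forces :: "'p \<Rightarrow> (nat \<Rightarrow> 'w \<Rightarrow> 'v) \<Rightarrow> ('f, 'r) fm \<Rightarrow> bool" where
  "forces P e FBot = False"
| "forces P e (FEq s t) =
     dense_below P (\<lambda>Q. \<forall>w\<in>pts Q. tval (St w) (\<lambda>i. e i w) s = tval (St w) (\<lambda>i. e i w) t)"
| "forces P e (FRel r ts) =
     dense_below P (\<lambda>Q. \<forall>w\<in>pts Q. rl (St w) r (map (tval (St w) (\<lambda>i. e i w)) ts))"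
| "forces P e (FNeg p) = (\<forall>Q\<in>below P. \<not> forces Q e p)"
| "forces P e (FAnd p q) = (forces P e p \<and> forces P e q)"
| "forces P e (FOr p q) = dense_below P (\<lambda>Q. forces Q e p \<or> forces Q e q)"
| "forces P e (FAll p) = (\<forall>x\<in>Nm. forces P (case_nat x e) p)"
| "forces P e (FEx p) = dense_below P (\<lambda>Q. \<exists>x\<in>Nm. forces Q (case_nat x e) p)"

lemma forces_mono: "forces P e p \<Longrightarrow> Q \<in> below P \<Longrightarrow> forces Q e p"
proof (induction p arbitrary: e P Q)
  case (FNeg p)
  then show ?case by (meson below_trans forces.simps(4))
next
  case (FAll p)
  then show ?case by auto
qed (auto intro: dense_below_mono)

text \<open>Regularity of weak forcing: atoms, disjunctions and existential formulas carry the
  density in their clauses, and the other connectives inherit it. Rules that reach their conclusion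
  only below some extension of each condition are sound for this reason.\<close>

lemma forces_dense: "dense_below P (\<lambda>Q. forces Q e p) \<Longrightarrow> P \<in> Pos \<Longrightarrow> forces P e p"
proof (induction p arbitrary: e P)
  case FBot
  then show ?case using below_refl by (metis forces.simps(1) dense_belowD)
next
  case (FNeg p)
  show ?case
  proof (simp, intro ballI notI)
    fix Q assume Q: "Q \<in> below P" "forces Q e p"
    then obtain R where "R \<in> below Q" "forces R e (FNeg p)"
      using dense_belowD [OF FNeg.prems(1) Q(1)] by blast
    then show False using Q forces_mono below_self by (metis forces.simps(4))
  qed
next
  case (FAnd p q)
  have "dense_below P (\<lambda>Q. forces Q e p)" "dense_below P (\<lambda>Q. forces Q e q)"
    using FAnd.prems(1) unfolding dense_below_def forces.simps by meson+
  then show ?case using FAnd by simp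
next
  case (FAll p)
  have "dense_below P (\<lambda>Q. forces Q (case_nat x e) p)" if "x \<in> Nm" for x
    using FAll.prems(1) that unfolding dense_below_def forces.simps by meson
  then show ?case using FAll by simp
qed (auto intro: dense_below_idem)

definition tname :: "(nat \<Rightarrow> 'w \<Rightarrow> 'v) \<Rightarrow> 'f tm \<Rightarrow> 'w \<Rightarrow> 'v" where
  "tname e t w = tval (St w) (\<lambda>i. e i w) t"

lemma tname_Nm: "range e \<subseteq> Nm \<Longrightarrow> tname e t \<in> Nm"
proof (induction t)
  case (Var n)
  then show ?case by (auto simp: tname_def [abs_def])
next
  case (Fn f ts)
  then have "set (map (tname e) ts) \<subseteq> Nm" by auto
  from Nm_fn [OF this, of f] show ?case by (simp add: tname_def [abs_def] comp_def)
qed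

lemma tname_Var: "tname e (Var n) = e n"
  by (simp add: tname_def [abs_def])

lemma case_nat_at: "(\<lambda>i. case_nat x e i w) = case_nat (x w) (\<lambda>i. e i w)"
  by (auto simp: fun_eq_iff split: nat.splits)

lemma tname_under: "(\<lambda>n. tname (case_nat x e) (under \<sigma> n)) = case_nat x (\<lambda>n. tname e (\<sigma> n))"
  by (auto simp: fun_eq_iff tname_def under_def tval_subst split: nat.splits)

lemma forces_subst: "forces P e (subst \<sigma> p) = forces P (\<lambda>n. tname e (\<sigma> n)) p"
proof (induction p arbitrary: e \<sigma> P)
  case (FAll p)
  then show ?case by (simp add: tname_under)
next
  case (FEx p)
  then show ?case by (simp add: tname_under)
next
  case (FRel r ts)
  then show ?case by (simp add: tval_subst tname_def comp_def)
qed (auto simp: tval_subst tname_def)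

lemma forces_lift: "forces P (case_nat x e) (lift p) = forces P e p"
  by (simp add: forces_subst tname_Var)

lemma forces_inst: "forces P e (inst t p) = forces P (case_nat (tname e t) e) p"
proof -
  have "(\<lambda>n. tname e (case_nat t Var n)) = case_nat (tname e t) e"
    by (auto simp: fun_eq_iff tname_Var split: nat.splits)
  then show ?thesis by (simp add: inst_def forces_subst)
qed

text \<open>Only one variable \<open>k\<close> is exchanged at a time, so that a single condition below can decide the equality.\<close>

lemma forces_cong:
  assumes "dense_below P (\<lambda>Q. \<forall>w\<in>pts Q. e k w = e' k w)" and "\<And>i. i \<noteq> k \<Longrightarrow> e i = e' i"
    and "forces P e p"
  shows "forces P e' p"
  using assms
proof (induction p arbitrary: e e' k P)
  case (FEq s t)
  show ?case unfolding forces.simps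
  proof (rule dense_belowI)
    fix Q assume "Q \<in> below P"
    then obtain Q' where Q': "Q' \<in> below Q" "\<forall>w\<in>pts Q'. e k w = e' k w"
      using dense_belowD [OF FEq.prems(1)] by blast
    then obtain R where R: "R \<in> below Q'"
      "\<forall>w\<in>pts R. tval (St w) (\<lambda>i. e i w) s = tval (St w) (\<lambda>i. e i w) t"
      using dense_belowD [OF FEq.prems(3) [unfolded forces.simps]] \<open>Q \<in> below P\<close> below_trans
      by blast
    have "(\<lambda>i. e' i w) = (\<lambda>i. e i w)" if "w \<in> pts R" for w
      using that Q' subsetD [OF pts_mono [OF R(1)]] FEq.prems(2) by (metis (no_types, lifting))
    then have "\<forall>w\<in>pts R. tval (St w) (\<lambda>i. e' i w) s = tval (St w) (\<lambda>i. e' i w) t"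
      using R(2) by simp
    then show "\<exists>R\<in>below Q. \<forall>w\<in>pts R. tval (St w) (\<lambda>i. e' i w) s = tval (St w) (\<lambda>i. e' i w) t"
      using below_trans [OF R(1) Q'(1)] by blast
  qed
next
  case (FRel r ts)
  show ?case unfolding forces.simps
  proof (rule dense_belowI)
    fix Q assume "Q \<in> below P"
    then obtain Q' where Q': "Q' \<in> below Q" "\<forall>w\<in>pts Q'. e k w = e' k w"
      using dense_belowD [OF FRel.prems(1)] by blast
    then obtain R where R: "R \<in> below Q'" "\<forall>w\<in>pts R. rl (St w) r (map (tval (St w) (\<lambda>i. e i w)) ts)"
      using dense_belowD [OF FRel.prems(3) [unfolded forces.simps]] \<open>Q \<in> below P\<close> below_trans
      by blast
    have "(\<lambda>i. e' i w) = (\<lambda>i. e i w)" if "w \<in> pts R" for w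
      using that Q' subsetD [OF pts_mono [OF R(1)]] FRel.prems(2) by (metis (no_types, lifting))
    then have "\<forall>w\<in>pts R. rl (St w) r (map (tval (St w) (\<lambda>i. e' i w)) ts)"
      using R(2) by simp
    then show "\<exists>R\<in>below Q. \<forall>w\<in>pts R. rl (St w) r (map (tval (St w) (\<lambda>i. e' i w)) ts)"
      using below_trans [OF R(1) Q'(1)] by blast
  qed
next
  case (FNeg p)
  have "forces Q e p" if "Q \<in> below P" "forces Q e' p" for Q
    using FNeg.IH [of Q e' k e] that FNeg.prems(1,2) dense_below_mono [OF _ that(1)]
    by (simp add: eq_commute)
  then show ?case using FNeg.prems(3) by auto
next
  case (FAnd p q)
  then have "forces P e p" "forces P e q" by simp_all
  then show ?case
    using FAnd.IH(1) [of P e k e'] FAnd.IH(2) [of P e k e'] FAnd.prems(1,2) by simp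
next
  case (FOr p q)
  have "forces Q e' r" if "Q \<in> below P" "forces Q e r" "r = p \<or> r = q" for Q r
    using that(2,3) FOr.IH(1) [of Q e k e'] FOr.IH(2) [of Q e k e'] FOr.prems(2)
      dense_below_mono [OF FOr.prems(1) that(1)] by auto
  then show ?case
    using FOr.prems(3) below_trans unfolding forces.simps dense_below_def by (metis (no_types, lifting))
next
  case (FAll p)
  have "forces P (case_nat x e') p" if "x \<in> Nm" for x
    by (rule FAll.IH [of P "case_nat x e" "Suc k"])
      (use that FAll.prems in \<open>auto split: nat.splits\<close>)
  then show ?case by simp
next
  case (FEx p)
  have "forces Q (case_nat x e') p" if "Q \<in> below P" "forces Q (case_nat x e) p" for x Q
    by (rule FEx.IH [of Q "case_nat x e" "Suc k"])
      (use that FEx.prems dense_below_mono in \<open>auto split: nat.splits\<close>)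
  then show ?case
    using FEx.prems(3) below_trans unfolding forces.simps dense_below_def by (metis (no_types, lifting))
qed simp

theorem forces_sound:
  assumes "G \<turnstile> p" "P \<in> Pos" "range e \<subseteq> Nm" "\<forall>q\<in>G. forces P e q"
  shows "forces P e p"
  using assms
proof (induction arbitrary: P e rule: nd.induct)
  case (Classical p G)
  have "\<exists>R\<in>below Q. forces R e p" if "Q \<in> below P" for Q
  proof (rule ccontr)
    assume "\<not> ?thesis"
    \<comment> \<open>Negation is forced when no extension forces the formula, so the premise of the
      rule applies at Q.\<close>
    then have "forces Q e (FNeg p)" by auto
    moreover have "\<forall>q\<in>G. forces Q e q" using that Classical.prems(3) forces_mono by blast
    ultimately have "forces Q e FBot"
      using Classical.IH Classical.prems(2) that below_Pos by blast
    then show False by simp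
  qed
  then show ?case by (intro forces_dense dense_belowI Classical.prems(1))
next
  case (NegI p G)
  have "\<not> forces Q e p" if "Q \<in> below P" for Q
  proof
    assume "forces Q e p"
    moreover have "\<forall>q\<in>G. forces Q e q" using that NegI.prems(3) forces_mono by blast
    ultimately show False using NegI.IH [of Q e] below_Pos [OF that] NegI.prems(2) by simp
  qed
  then show ?case by simp
next
  case (NegE G p)
  then have "forces P e (FNeg p)" "forces P e p" by blast+
  then show ?case using below_refl [OF NegE.prems(1)] by simp
next
  case (OrI1 G p q)
  then have "forces P e p" by blast
  then show ?case using forces_mono by (auto intro!: dense_below_always)
next
  case (OrI2 G q p)
  then have "forces P e q" by blast
  then show ?case using forces_mono by (auto intro!: dense_below_always)
next
  case (OrE G p q r)
  have "\<exists>R\<in>below Q. forces R e r" if Q: "Q \<in> below P" for Q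
  proof -
    have "forces P e (FOr p q)" using OrE by blast
    then obtain R where R: "R \<in> below Q" "forces R e p \<or> forces R e q"
      using dense_belowD [OF _ Q] unfolding forces.simps by blast
    have RP: "R \<in> below P" using R Q below_trans by blast
    then have "\<forall>q\<in>G. forces R e q" using OrE.prems(3) forces_mono by blast
    then have "forces R e r" using R OrE.IH(2,3) [of R e] OrE.prems(2) RP below_Pos by auto
    then show ?thesis using R by blast
  qed
  then show ?case by (intro forces_dense dense_belowI OrE.prems(1))
next
  case (AllI G p)
  have "forces P (case_nat x e) p" if "x \<in> Nm" for x
    by (rule AllI.IH) (use that AllI.prems in \<open>auto simp: forces_lift range_subsetD split: nat.splits\<close>)
  then show ?case by simp
next
  case (AllE G p t)
  then show ?case by (simp add: forces_inst tname_Nm)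
next
  case (ExI G t p)
  then have "forces P (case_nat (tname e t) e) p" by (simp add: forces_inst)
  then have "\<exists>x\<in>Nm. forces Q (case_nat x e) p" if "Q \<in> below P" for Q
    using forces_mono [OF _ that] tname_Nm [OF ExI.prems(2)] by blast
  then show ?case unfolding forces.simps by (rule dense_below_always)
next
  case (ExE G p r)
  have "\<exists>R\<in>below Q. forces R e r" if Q: "Q \<in> below P" for Q
  proof -
    have "forces P e (FEx p)" using ExE by blast
    then obtain R x where R: "R \<in> below Q" "x \<in> Nm" "forces R (case_nat x e) p"
      using dense_belowD [OF _ Q] unfolding forces.simps by blast
    have RP: "R \<in> below P" using R Q below_trans by blast
    then have "\<forall>q\<in>G. forces R e q" using ExE.prems(3) forces_mono by blast
    then have "\<forall>q\<in>insert p (lift ` G). forces R (case_nat x e) q"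
      using R(3) by (simp add: forces_lift)
    moreover have "range (case_nat x e) \<subseteq> Nm"
      using R(2) ExE.prems(2) by (auto simp: range_subsetD split: nat.splits)
    ultimately have "forces R (case_nat x e) (lift r)" by (intro ExE.IH(2) [OF below_Pos [OF RP]])
    then have "forces R e r" unfolding forces_lift .
    then show ?thesis using R(1) by blast
  qed
  then show ?case by (intro forces_dense dense_belowI ExE.prems(1))
next
  case (EqI G t)
  show ?case by (simp add: dense_below_always)
next
  case (EqE G s t p)
  have "forces P e (FEq s t)" using EqE by blast
  have "forces P e (inst s p)" using EqE by blast
  then have "forces P (case_nat (tname e s) e) p" by (simp only: forces_inst)
  have "forces P (case_nat (tname e t) e) p"
  proof (rule forces_cong)
    show "dense_below P (\<lambda>Q. \<forall>w\<in>pts Q. case_nat (tname e s) e 0 w = case_nat (tname e t) e 0 w)"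
      using \<open>forces P e (FEq s t)\<close> by (simp add: tname_def)
    show "forces P (case_nat (tname e s) e) p" by fact
  qed (simp split: nat.splits)
  then show ?case by (simp only: forces_inst)
next
  case (AndI G p q)
  have "forces P e p" using AndI by blast
  moreover have "forces P e q" using AndI by blast
  ultimately show ?case by simp
next
  case (AndE1 G p q)
  have "forces P e (FAnd p q)" using AndE1 by blast
  then show ?case by simp
next
  case (AndE2 G p q)
  have "forces P e (FAnd p q)" using AndE2 by blast
  then show ?case by simp
qed simp

lemma forces_FAll_funpow:
  assumes "\<And>e. range e \<subseteq> Nm \<Longrightarrow> forces P e p" "range e \<subseteq> Nm"
  shows "forces P e ((FAll ^^ n) p)"
  using assms(2)
proof (induction n arbitrary: e)
  case (Suc n)
  have "range (case_nat x e) \<subseteq> Nm" if "x \<in> Nm" for x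
    using that Suc.prems by (auto simp: range_subsetD split: nat.splits)
  then show ?case using Suc.IH by simp
qed (use assms(1) in simp)

end


section \<open>Decision trees\<close>

text \<open>\<open>dtree t\<close> consists of the functions of an oracle that are computed by decision trees of depth exactly \<open>t\<close>;
  shorter trees are padded by queries whose answer is ignored.\<close>

primrec dtree :: "nat \<Rightarrow> (nat set \<Rightarrow> 'v) set" where
  "dtree 0 = {F. \<exists>v. F = (\<lambda>A. v)}"
| "dtree (Suc t) = {F. \<exists>x F1 F0. F1 \<in> dtree t \<and> F0 \<in> dtree t \<and> F = (\<lambda>A. if x \<in> A then F1 A else F0 A)}"

lemma dtree_0 [simp]: "(\<lambda>A. v) \<in> dtree 0"
  by (auto intro: exI [of _ v])

lemma dtree_const [simp]: "(\<lambda>A. v) \<in> dtree t"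
proof (induction t)
  case (Suc t)
  have "(\<lambda>A. v) = (\<lambda>A. if 0 \<in> A then v else v)" by simp
  then show ?case using Suc unfolding dtree.simps by blast
qed (rule dtree_0)

lemma dtree_Suc: "F \<in> dtree t \<Longrightarrow> F \<in> dtree (Suc t)"
proof -
  assume "F \<in> dtree t"
  moreover have "F = (\<lambda>A. if 0 \<in> A then F A else F A)" by simp
  ultimately show ?thesis unfolding dtree.simps by blast
qed

lemma dtree_mono: "F \<in> dtree s \<Longrightarrow> s \<le> t \<Longrightarrow> F \<in> dtree t"
  by (induction t) (auto simp: le_Suc_eq dtree_Suc simp del: dtree.simps)

lemma dtree_mem: "(\<lambda>A. x \<in> A) \<in> dtree 1"
  unfolding One_nat_def dtree.simps(2)
  by (intro CollectI exI [of _ x] exI [of _ "\<lambda>_. True"] exI [of _ "\<lambda>_. False"] conjI dtree_0) auto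

text \<open>Run the tree of F and continue at each leaf with the tree belonging to the value found
  there.\<close>

lemma dtree_bind:
  assumes "F \<in> dtree s" and "\<And>v. G v \<in> dtree t"
  shows "(\<lambda>A. G (F A) A) \<in> dtree (s + t)"
  using assms(1)
proof (induction s arbitrary: F)
  case 0
  then show ?case using assms(2) by auto
next
  case (Suc s)
  then obtain x F1 F0 where F: "F1 \<in> dtree s" "F0 \<in> dtree s" "F = (\<lambda>A. if x \<in> A then F1 A else F0 A)"
    by auto
  have "(\<lambda>A. G (F A) A) = (\<lambda>A. if x \<in> A then G (F1 A) A else G (F0 A) A)"
    by (auto simp: F fun_eq_iff)
  then show ?case using Suc.IH F by auto
qed

text \<open>Values that violate P are never attained, so the trees for them may be replaced by a
  constant.\<close>

lemma dtree_bind_on: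
  assumes "F \<in> dtree s" and "\<And>A. P (F A)" and "\<And>v. P v \<Longrightarrow> G v \<in> dtree t"
  shows "(\<lambda>A. G (F A) A) \<in> dtree (s + t)"
  using dtree_bind [OF assms(1), of "\<lambda>v. if P v then G v else (\<lambda>A. undefined)" t] assms(2,3) by simp

lemma dtree_map: "F \<in> dtree t \<Longrightarrow> (\<lambda>A. h (F A)) \<in> dtree t"
  using dtree_bind [of F t "\<lambda>v A. h v" 0, OF _ dtree_0] by simp

lemma dtree_list:
  "(\<And>F. F \<in> set Fs \<Longrightarrow> F \<in> dtree t) \<Longrightarrow> (\<lambda>A. map (\<lambda>F. F A) Fs) \<in> dtree (length Fs * t)"
proof (induction Fs)
  case (Cons F Fs)
  have "(\<lambda>A. map (\<lambda>F. F A) Fs) \<in> dtree (length Fs * t)" using Cons by simp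
  then have "(\<lambda>A. v # map (\<lambda>F. F A) Fs) \<in> dtree (length Fs * t)" for v
    using dtree_map [of _ _ "(#) v"] by fastforce
  from dtree_bind [OF Cons.prems [of F] this] show ?case by simp
qed (simp del: dtree.simps)

lemma dtree_upt:
  assumes "\<And>i. i < m \<Longrightarrow> F i \<in> dtree t"
  shows "(\<lambda>A. map (\<lambda>i. F i A) [0..<m]) \<in> dtree (m * t)"
  using dtree_list [of "map F [0..<m]" t] assms by (fastforce simp: comp_def)


section \<open>Polynomial bounds\<close>

text \<open>From N = 2 on, a pure power absorbs constant factors and sums, so a single exponent
  describes a polynomial bound. The summand 2 in \<open>size_of\<close> keeps all arguments in this
  range.\<close>

definition poly_bounded :: "(nat \<Rightarrow> nat) \<Rightarrow> bool" where
  "poly_bounded h \<longleftrightarrow> (\<exists>c. \<forall>N\<ge>2. h N \<le> N ^ c)"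

lemma poly_bounded_const: "poly_bounded (\<lambda>N. k)"
proof -
  have "k \<le> N ^ k" if "N \<ge> 2" for N :: nat
    using less_exp [of k] power_mono [of 2 N k] that by linarith
  then show ?thesis unfolding poly_bounded_def by blast
qed

lemma poly_bounded_power: "poly_bounded (\<lambda>N. N ^ c)"
  by (auto simp: poly_bounded_def)

lemma poly_bounded_mult:
  assumes "poly_bounded h1" "poly_bounded h2"
  shows "poly_bounded (\<lambda>N. h1 N * h2 N)"
proof -
  obtain c d where "\<forall>N\<ge>2. h1 N \<le> N ^ c" "\<forall>N\<ge>2. h2 N \<le> N ^ d"
    using assms by (auto simp: poly_bounded_def)
  then have "\<forall>N\<ge>2. h1 N * h2 N \<le> N ^ (c + d)" by (simp add: mult_le_mono power_add)
  then show ?thesis by (auto simp: poly_bounded_def)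
qed

lemma poly_bounded_add:
  assumes "poly_bounded h1" "poly_bounded h2"
  shows "poly_bounded (\<lambda>N. h1 N + h2 N)"
proof -
  obtain c d where c: "\<forall>N\<ge>2. h1 N \<le> N ^ c" "\<forall>N\<ge>2. h2 N \<le> N ^ d"
    using assms by (auto simp: poly_bounded_def)
  have "h1 N + h2 N \<le> N ^ Suc (max c d)" if N: "N \<ge> 2" for N
  proof -
    have "h1 N \<le> N ^ max c d" "h2 N \<le> N ^ max c d"
      using c N by (meson le_trans max.cobounded1 max.cobounded2 one_le_numeral power_increasing)+
    then have "h1 N + h2 N \<le> 2 * N ^ max c d" by simp
    also have "\<dots> \<le> N * N ^ max c d" using N by simp
    finally show ?thesis by simp
  qed
  then show ?thesis unfolding poly_bounded_def by blast
qed

lemma poly_bounded_compose: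
  fixes p :: "nat poly"
  assumes "poly_bounded h"
  shows "poly_bounded (\<lambda>N. poly p (h N))"
  by (induction p) (auto simp: poly_bounded_const intro!: poly_bounded_add poly_bounded_mult assms)

lemma poly_nat_mono: "x \<le> y \<Longrightarrow> poly p x \<le> poly p y" for p :: "nat poly"
  by (induction p) (auto intro: mult_le_mono add_mono)

lemma poly_boundedE:
  assumes "poly_bounded h"
  obtains c where "\<And>N. N \<ge> 2 \<Longrightarrow> h N \<le> N ^ c"
  using assms by (auto simp: poly_bounded_def)

lemma blen_0: "blen 0 = 0"
  by (simp add: floorlog_def)

lemma le_blen: "blen x \<le> x"
  using blen_iff [of x x] less_exp by blast

text \<open>Depth and output length are bounded together: running times are measured in the lengths
  of the inputs, so a bound on the depth alone would not survive composition with a machine.\<close>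

definition small :: "nat \<Rightarrow> nat \<Rightarrow> (nat set \<Rightarrow> nat) \<Rightarrow> bool" where
  "small c N F \<longleftrightarrow> F \<in> dtree (N ^ c) \<and> (\<forall>A. blen (F A) \<le> N ^ c)"

lemma small_mono: "small c N F \<Longrightarrow> c \<le> d \<Longrightarrow> N \<ge> 2 \<Longrightarrow> small d N F"
proof -
  assume a: "small c N F" "c \<le> d" "N \<ge> 2"
  then have "N ^ c \<le> N ^ d" by (simp add: power_increasing)
  then show ?thesis using a by (auto simp: small_def intro: dtree_mono order_trans)
qed

lemma small_const: "blen x \<le> N ^ c \<Longrightarrow> small c N (\<lambda>A. x)"
  by (simp add: small_def)


section \<open>Query complexity of polynomial-time oracle machines\<close>

abbreviation stepc :: "nat set \<Rightarrow> otm \<Rightarrow> config \<Rightarrow> config" where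
  "stepc A M c \<equiv> (case step A M c of None \<Rightarrow> c | Some c' \<Rightarrow> c')"

lemma run_0: "run A M xs 0 = init_config M xs"
  by (simp add: run_def)

lemma run_Suc: "run A M xs (Suc n) = stepc A M (run A M xs n)"
  by (simp only: run_def funpow.simps comp_def)

lemma run_halted:
  assumes "halts_in A M xs n" "n \<le> m"
  shows "run A M xs m = run A M xs n"
  using assms(2) by (induction m rule: dec_induct) (use assms(1) in \<open>auto simp: run_Suc halts_in_def\<close>)

lemma otm_output_run:
  assumes "halts_in A M xs n" "n \<le> T"
  shows "otm_output A M xs = read_num (snd (snd (run A M xs T) ! 0))"
proof -
  let ?l = "LEAST n. halts_in A M xs n"
  have "halts_in A M xs ?l" "?l \<le> T"
    using LeastI [of "halts_in A M xs", OF assms(1)] Least_le [of "halts_in A M xs", OF assms(1)]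
      assms(2) by linarith+
  then have "run A M xs T = run A M xs ?l" by (rule run_halted)
  then show ?thesis by (simp add: otm_output_def)
qed

text \<open>In the query state the successor depends on the membership of one number, in every other
  state on none.\<close>

lemma dtree_step: "(\<lambda>A. stepc A M c) \<in> dtree 1"
proof (cases c)
  case (Pair q ts)
  define C where "C = (\<lambda>b. case (case otm_query M of None \<Rightarrow> table_step M (q, ts)
     | Some (qq, yes, no) \<Rightarrow> if q = qq then Some (if b then yes else no, ts) else table_step M (q, ts))
     of None \<Rightarrow> c | Some c' \<Rightarrow> c')"
  have "(\<lambda>A. stepc A M c) = (\<lambda>A. C (read_num (snd (ts ! 1)) \<in> A))"
    by (simp add: C_def step_def Pair fun_eq_iff split: option.splits prod.splits)
  then show ?thesis using dtree_map [OF dtree_mem] by metis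
qed

lemma dtree_run: "(\<lambda>A. run A M xs n) \<in> dtree n"
proof (induction n)
  case 0
  show ?case unfolding run_0 by (rule dtree_0)
next
  case (Suc n)
  then show ?case using dtree_bind [OF Suc, of "\<lambda>c A. stepc A M c" 1, OF dtree_step] by (simp add: run_Suc)
qed

lemma table_step_tape0:
  assumes "wf_otm M" "table_step M (q, ts) = Some (q', ts')" "length ts = otm_work M + 2"
  shows "length ts' = otm_work M + 2" and "fst (ts' ! 0) \<le> fst (ts ! 0) + 1"
    and "i > fst (ts ! 0) \<Longrightarrow> snd (ts' ! 0) i = snd (ts ! 0) i"
proof -
  obtain acts where "map_of (otm_table M) (q, map (\<lambda>(h, c). c h) ts) = Some (q', acts)"
    and ts': "ts' = map2 tape_step acts ts"
    using assms(2) by (auto simp: table_step_def)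
  then have "length acts = otm_work M + 2"
    using assms(1) by (force simp: wf_otm_def dest: map_of_SomeD)
  then show "length ts' = otm_work M + 2" using ts' assms(3) by simp
  have *: "ts' ! 0 = tape_step (acts ! 0) (ts ! 0)"
    using ts' assms(3) \<open>length acts = otm_work M + 2\<close> by simp
  obtain s m where sm: "acts ! 0 = (s, m)" by fastforce
  obtain h c where hc: "ts ! 0 = (h, c)" by fastforce
  show "fst (ts' ! 0) \<le> fst (ts ! 0) + 1" "i > fst (ts ! 0) \<Longrightarrow> snd (ts' ! 0) i = snd (ts ! 0) i"
    using * by (auto simp: sm hc split: move.splits)
qed

text \<open>The head moves by at most one cell per step, so n steps write only to cells left of n.
  The blank cells beyond the time and the input bound the length of the output.\<close>

lemma run_tape0:
  assumes "wf_otm M"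
  shows "length (snd (run A M xs n)) = otm_work M + 2 \<and> fst (snd (run A M xs n) ! 0) \<le> int n \<and>
    (\<forall>i \<ge> int n. i \<ge> int (length (input_word xs)) \<longrightarrow> snd (snd (run A M xs n) ! 0) i = 0)"
proof (induction n)
  case 0
  have "\<not> nat i < length (input_word xs)" if "i \<ge> int (length (input_word xs))" for i
    using that by linarith
  then show ?case by (auto simp: run_0 init_config_def Let_def)
next
  case (Suc n)
  obtain q ts where qt: "run A M xs n = (q, ts)" by fastforce
  show ?case
  proof (cases "step A M (q, ts)")
    case None
    then show ?thesis using Suc by (simp add: run_Suc qt)
  next
    case (Some c')
    obtain q' ts' where c': "c' = (q', ts')" by fastforce
    have "ts' = ts \<or> table_step M (q, ts) = Some (q', ts')"
      using Some by (auto simp: step_def c' split: option.splits prod.splits if_splits)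
    then show ?thesis
    proof
      assume "ts' = ts"
      then show ?thesis using Suc Some by (simp add: run_Suc qt c')
    next
      assume "table_step M (q, ts) = Some (q', ts')"
      note t = table_step_tape0 [OF assms this]
      show ?thesis using Suc Some t by (fastforce simp: run_Suc qt c')
    qed
  qed
qed

lemma read_num_bound:
  assumes "c (int l) \<notin> {1, 2}"
  shows "read_num c < 2 ^ l"
proof -
  define m where "m = (LEAST l. c (int l) \<notin> {1, 2})"
  have m: "m \<le> l" using assms unfolding m_def by (rule Least_le)
  have c: "c (int i) \<in> {1, 2}" if "i < m" for i using not_less_Least that unfolding m_def by blast
  have "(\<Sum>i<k. (c (int i) - 1) * 2 ^ i) < 2 ^ k" if "k \<le> m" for k
    using that
  proof (induction k)
    case (Suc k)
    have "c (int k) - 1 \<le> 1" using c [of k] Suc.prems by auto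
    then have "(c (int k) - 1) * 2 ^ k \<le> 1 * 2 ^ k" by (rule mult_right_mono) simp
    then have "(\<Sum>i<Suc k. (c (int i) - 1) * 2 ^ i) < 2 ^ k + 2 ^ k"
      unfolding sum.lessThan_Suc using Suc by (intro add_less_le_mono) simp_all
    then show ?case by simp
  qed simp
  from this [of m] have "read_num c < 2 ^ m" by (simp add: read_num_def m_def)
  also have "(2::nat) ^ m \<le> 2 ^ l" using m by simp
  finally show ?thesis .
qed

lemma length_input_word: "length (input_word xs) = sum_list (map blen xs) + length xs"
  by (induction xs) (auto simp: input_word_def num_word_def)

lemma output_bound:
  assumes "wf_otm M"
  shows "blen (read_num (snd (snd (run A M xs T) ! 0))) \<le> sum_list (map blen xs) + length xs + T"
proof -
  have "snd (snd (run A M xs T) ! 0) (int (length (input_word xs) + T)) = 0"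
    using run_tape0 [OF assms] by simp
  then show ?thesis
    unfolding blen_iff length_input_word [symmetric] by (intro read_num_bound) simp
qed

lemma sum_list_blen_le: "(\<And>x. x \<in> set xs \<Longrightarrow> blen x \<le> b) \<Longrightarrow> sum_list (map blen xs) \<le> length xs * b"
  by (induction xs) (auto simp: add_mono)

lemma small_pv_val:
  assumes "f \<in> PVa"
  obtains d where "\<And>N Fs. N \<ge> 2 \<Longrightarrow> length Fs = fst f \<Longrightarrow> (\<And>F. F \<in> set Fs \<Longrightarrow> small c N F) \<Longrightarrow>
    small d N (\<lambda>A. pv_val A f (map (\<lambda>F. F A) Fs))"
proof -
  obtain k M where f: "f = (k, M)" by fastforce
  then have wf: "wf_otm M" and "poly_time k M" using assms by (auto simp: PVa_def)
  then obtain p :: "nat poly" where p: "\<And>A xs. length xs = k \<Longrightarrow>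
      \<exists>n \<le> poly p (sum_list (map blen xs)). halts_in A M xs n"
    by (auto simp: poly_time_def)
  \<comment> \<open>The time bound in \<open>poly_time\<close> is uniform in the oracle, and a
    halted configuration persists. Hence the output can be read at the common time
    \<open>T N\<close>, and a tree of this depth simulates the machine for all oracles at
    once.\<close>
  define T where "T N = poly p (k * N ^ c)" for N
  have out: "otm_output A M xs = read_num (snd (snd (run A M xs (T N)) ! 0))"
    if "length xs = k" "\<And>x. x \<in> set xs \<Longrightarrow> blen x \<le> N ^ c" for A xs N
  proof -
    obtain n where n: "n \<le> poly p (sum_list (map blen xs))" "halts_in A M xs n"
      using p \<open>length xs = k\<close> by blast
    have "poly p (sum_list (map blen xs)) \<le> T N"
      unfolding T_def using poly_nat_mono sum_list_blen_le that by metis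
    then show ?thesis using otm_output_run [OF n(2)] n(1) by (meson order_trans)
  qed
  have "poly_bounded (\<lambda>N. k * N ^ c + k + T N)"
    unfolding T_def
    by (intro poly_bounded_add poly_bounded_compose poly_bounded_mult poly_bounded_const poly_bounded_power)
  then obtain d where d: "\<And>N. N \<ge> 2 \<Longrightarrow> k * N ^ c + k + T N \<le> N ^ d" by (rule poly_boundedE) blast
  show ?thesis
  proof (rule that)
    fix N Fs assume N: "N \<ge> (2::nat)" and Fs: "length Fs = fst f" "\<And>F. F \<in> set Fs \<Longrightarrow> small c N F"
    let ?xs = "\<lambda>A. map (\<lambda>F. F A) Fs"
    let ?P = "\<lambda>xs. length xs = k \<and> (\<forall>x\<in>set xs. blen x \<le> N ^ c)"
    have P: "?P (?xs A)" for A using Fs by (auto simp: f small_def)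
    have val: "pv_val A f xs = read_num (snd (snd (run A M xs (T N)) ! 0))" if "?P xs" for A xs
      using out that by (simp add: pv_val_def f)
    have "?xs \<in> dtree (k * N ^ c)" using dtree_list [of Fs "N ^ c"] Fs by (simp add: f small_def)
    moreover have "(\<lambda>A. pv_val A f xs) \<in> dtree (T N)" if "?P xs" for xs
      unfolding val [OF that] using dtree_map [OF dtree_run] .
    ultimately have "(\<lambda>A. pv_val A f (?xs A)) \<in> dtree (k * N ^ c + T N)"
      by (rule dtree_bind_on [where P = ?P, OF _ P])
    moreover have "blen (pv_val A f (?xs A)) \<le> N ^ d" for A
    proof -
      have "sum_list (map blen (?xs A)) \<le> k * N ^ c"
        using sum_list_blen_le [of "?xs A" "N ^ c"] P [of A] by simp
      then have "blen (pv_val A f (?xs A)) \<le> k * N ^ c + k + T N"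
        using output_bound [OF wf, of A "?xs A" "T N"] P [of A] unfolding val [OF P] by simp
      then show ?thesis using d [OF N] by simp
    qed
    ultimately show "small d N (\<lambda>A. pv_val A f (?xs A))"
      using d [OF N] dtree_mono by (fastforce simp: small_def)
  qed
qed

lemma pv_val_PV: "g \<in> PV \<Longrightarrow> pv_val A g = pv_val B g"
proof -
  assume "g \<in> PV"
  then have "step A (snd g) = step B (snd g)" by (auto simp: step_def PV_def)
  then have "run A (snd g) = run B (snd g)" by (intro ext) (simp only: run_def)
  moreover have "halts_in A (snd g) = halts_in B (snd g)"
    using \<open>step A (snd g) = step B (snd g)\<close> calculation
    by (intro ext) (simp only: halts_in_def)
  ultimately show ?thesis by (simp add: pv_val_def otm_output_def fun_eq_iff)
qed

lemma len_syms_val: "g \<in> len_syms \<Longrightarrow> pv_val A g [a] = blen a"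
  using pv_val_PV [of g A "{}"] by (auto simp: len_syms_def)


section \<open>Query complexity of sharply bounded formulas\<close>

lemma small_max:
  assumes "\<forall>x\<in>set xs. \<exists>d. \<forall>N\<ge>2. \<forall>E. R N E \<longrightarrow> small d N (F x N E)"
  shows "\<exists>d. \<forall>x\<in>set xs. \<forall>N\<ge>2. \<forall>E. R N E \<longrightarrow> small d N (F x N E)"
  using assms
proof (induction xs)
  case (Cons x xs)
  then obtain d1 d2 where "\<forall>y\<in>set xs. \<forall>N\<ge>2. \<forall>E. R N E \<longrightarrow> small d1 N (F y N E)"
    "\<forall>N\<ge>2. \<forall>E. R N E \<longrightarrow> small d2 N (F x N E)" by auto
  then have "\<forall>y\<in>set (x # xs). \<forall>N\<ge>2. \<forall>E. R N E \<longrightarrow> small (max d1 d2) N (F y N E)"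
    using small_mono max.cobounded1 max.cobounded2 by (metis set_ConsD)
  then show ?case by blast
qed simp

lemma fn_std [simp]: "fn (std A) = pv_val A"
  by (simp add: std_def)

lemma rl_std [simp]:
  "rl (std A) Less as \<longleftrightarrow> as ! 0 < as ! 1" "rl (std A) Alpha as \<longleftrightarrow> as ! 0 \<in> A"
  by (simp_all add: std_def)

lemma univ_std [simp]: "univ (std A) = UNIV"
  by (simp add: std_def)

lemma small_tval:
  assumes "wf_tm PVa fst t"
  shows "\<exists>d. \<forall>N\<ge>2. \<forall>E. (\<forall>i\<in>fv_tm t. small c N (E i)) \<longrightarrow> small d N (\<lambda>A. tval (std A) (\<lambda>i. E i A) t)"
  using assms
proof (induction t)
  case (Var n)
  then show ?case by auto
next
  case (Fn f ts)
  have "\<exists>d. \<forall>N\<ge>2. \<forall>E. (\<forall>i\<in>fv_tm (Fn f ts). small c N (E i)) \<longrightarrow>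
      small d N (\<lambda>A. tval (std A) (\<lambda>i. E i A) t)" if "t \<in> set ts" for t
  proof -
    have "wf_tm PVa fst t" using Fn.prems that by (auto simp: list_all_iff)
    from Fn.IH [OF that this] obtain d where "\<forall>N\<ge>2. \<forall>E. (\<forall>i\<in>fv_tm t. small c N (E i)) \<longrightarrow>
        small d N (\<lambda>A. tval (std A) (\<lambda>i. E i A) t)"
      by blast
    moreover have "fv_tm t \<subseteq> fv_tm (Fn f ts)" using that by auto
    ultimately show ?thesis by blast
  qed
  then obtain d where d: "\<forall>t\<in>set ts. \<forall>N\<ge>2. \<forall>E. (\<forall>i\<in>fv_tm (Fn f ts). small c N (E i)) \<longrightarrow>
      small d N (\<lambda>A. tval (std A) (\<lambda>i. E i A) t)"
    using small_max [of ts "\<lambda>N E. \<forall>i\<in>fv_tm (Fn f ts). small c N (E i)"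
        "\<lambda>t N E A. tval (std A) (\<lambda>i. E i A) t"] by blast
  have f: "f \<in> PVa" "length ts = fst f" using Fn.prems by auto
  obtain d' where d': "\<And>N Fs. N \<ge> 2 \<Longrightarrow> length Fs = fst f \<Longrightarrow> (\<And>F. F \<in> set Fs \<Longrightarrow> small d N F) \<Longrightarrow>
      small d' N (\<lambda>A. pv_val A f (map (\<lambda>F. F A) Fs))"
    by (rule small_pv_val [OF f(1), where c = d]) blast
  have "small d' N (\<lambda>A. tval (std A) (\<lambda>i. E i A) (Fn f ts))"
    if "N \<ge> 2" "\<forall>i\<in>fv_tm (Fn f ts). small c N (E i)" for N E
  proof -
    have "small d' N (\<lambda>A. pv_val A f (map (\<lambda>F. F A) (map (\<lambda>t A. tval (std A) (\<lambda>i. E i A) t) ts)))"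
      by (rule d') (use that d f in auto)
    then show ?thesis by (simp add: comp_def)
  qed
  then show ?case by blast
qed

lemma tval_cong: "(\<And>i. i \<in> fv_tm t \<Longrightarrow> e i = e' i) \<Longrightarrow> tval M e t = tval M e' t"
proof (induction t)
  case (Fn f ts)
  have "tval M e t = tval M e' t" if "t \<in> set ts" for t
    by (rule Fn.IH [OF that]) (use that Fn.prems in auto)
  then show ?case by (simp cong: map_cong)
qed simp

lemma sat_cong: "(\<And>i. i \<in> fv p \<Longrightarrow> e i = e' i) \<Longrightarrow> sat M e p = sat M e' p"
proof (induction p arbitrary: e e')
  case (FEq s t)
  then show ?case using tval_cong [of s e e' M] tval_cong [of t e e' M] by simp
next
  case (FRel r ts)
  have "map (tval M e) ts = map (tval M e') ts"
    using FRel by (auto intro!: tval_cong)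
  then show ?case by (simp only: sat.simps)
next
  case (FNeg p)
  then show ?case by (metis fv.simps(4) sat.simps(4))
next
  case (FAnd p q)
  then show ?case by (metis UnCI fv.simps(5) sat.simps(5))
next
  case (FOr p q)
  then show ?case by (metis UnCI fv.simps(6) sat.simps(6))
next
  case (FAll p)
  have "sat M (case_nat a e) p = sat M (case_nat a e') p" for a
    by (rule FAll.IH) (use FAll.prems in \<open>auto split: nat.splits\<close>)
  then show ?case by simp
next
  case (FEx p)
  have "sat M (case_nat a e) p = sat M (case_nat a e') p" for a
    by (rule FEx.IH) (use FEx.prems in \<open>auto split: nat.splits\<close>)
  then show ?case by simp
qed simp

lemma fv_lift_tm: "fv_tm (lift_tm t) = Suc ` fv_tm t"
  by (induction t) auto

lemma fv_ex_less: "fv (ex_less t p) = fv_tm t \<union> {n. Suc n \<in> fv p}"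
  by (auto simp: ex_less_def fv_lift_tm)

lemma fv_all_less: "fv (all_less t p) = fv_tm t \<union> {n. Suc n \<in> fv p}"
  by (auto simp: all_less_def fv_lift_tm)

lemma sat_Less [simp]: "sat (std A) e (FLess s t) \<longleftrightarrow> tval (std A) e s < tval (std A) e t"
  by simp

lemma tval_lift [simp]: "tval M (case_nat a e) (lift_tm t) = tval M e t"
  by (simp add: tval_subst)

lemma sat_ex_less: "sat (std A) e (ex_less t p) \<longleftrightarrow>
    (\<exists>a < tval (std A) e t. sat (std A) (case_nat a e) p)"
  by (simp add: ex_less_def del: sat.simps(3))

lemma sat_all_less: "sat (std A) e (all_less t p) \<longleftrightarrow>
    (\<forall>a < tval (std A) e t. sat (std A) (case_nat a e) p)"
  by (auto simp add: all_less_def simp del: sat.simps(3))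

lemma tval_len: "g \<in> len_syms \<Longrightarrow> tval (std A) e (Fn g [t]) = blen (tval (std A) e t)"
  by (simp add: len_syms_val)

lemma dtree_comb:
  assumes "F \<in> dtree s" "G \<in> dtree t"
  shows "(\<lambda>A. h (F A) (G A)) \<in> dtree (s + t)"
  by (rule dtree_bind [OF assms(1), of "\<lambda>v A. h v (G A)"]) (rule dtree_map [OF assms(2)])

lemma dtree_sat_boolean:
  assumes "\<exists>d. \<forall>N\<ge>2. \<forall>E. R N E \<longrightarrow> F N E \<in> dtree (N ^ d)"
    and "\<exists>d. \<forall>N\<ge>2. \<forall>E. R N E \<longrightarrow> G N E \<in> dtree (N ^ d)"
  shows "\<exists>d. \<forall>N\<ge>2. \<forall>E. R N E \<longrightarrow> (\<lambda>A. h (F N E A) (G N E A)) \<in> dtree (N ^ d)"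
proof -
  obtain d1 d2 where d: "\<forall>N\<ge>2. \<forall>E. R N E \<longrightarrow> F N E \<in> dtree (N ^ d1)"
    "\<forall>N\<ge>2. \<forall>E. R N E \<longrightarrow> G N E \<in> dtree (N ^ d2)"
    using assms by blast
  have "poly_bounded (\<lambda>N. N ^ d1 + N ^ d2)"
    by (intro poly_bounded_add poly_bounded_power)
  then obtain d3 where d3: "\<forall>N::nat\<ge>2. N ^ d1 + N ^ d2 \<le> N ^ d3"
    unfolding poly_bounded_def by blast
  have "(\<lambda>A. h (F N E A) (G N E A)) \<in> dtree (N ^ d3)" if "N \<ge> 2" "R N E" for N E
    by (rule dtree_mono [OF dtree_comb d3 [rule_format]]) (use d that in auto)
  then show ?thesis by blast
qed

lemma dtree_sat_bounded:
  assumes t: "\<exists>d. \<forall>N\<ge>2. \<forall>E. R N E \<longrightarrow> small d N (T N E)"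
    and F: "\<And>c. \<exists>d. \<forall>N\<ge>2. \<forall>E x. R N E \<longrightarrow> x < N ^ c \<longrightarrow> F N E x \<in> dtree (N ^ d)"
  shows "\<exists>d. \<forall>N\<ge>2. \<forall>E. R N E \<longrightarrow>
    (\<lambda>A. h (T N E A) (map (\<lambda>x. F N E x A) [0..<blen (T N E A)])) \<in> dtree (N ^ d)"
proof -
  obtain c where c: "\<forall>N\<ge>2. \<forall>E. R N E \<longrightarrow> small c N (T N E)" using t by blast
  obtain d where d: "\<forall>N\<ge>2. \<forall>E x. R N E \<longrightarrow> x < N ^ c \<longrightarrow> F N E x \<in> dtree (N ^ d)"
    using F by blast
  have "poly_bounded (\<lambda>N. N ^ c + N ^ c * N ^ d)"
    by (intro poly_bounded_add poly_bounded_mult poly_bounded_power)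
  then obtain d' where d': "\<forall>N::nat\<ge>2. N ^ c + N ^ c * N ^ d \<le> N ^ d'"
    unfolding poly_bounded_def by blast
  have "(\<lambda>A. h (T N E A) (map (\<lambda>x. F N E x A) [0..<blen (T N E A)])) \<in> dtree (N ^ d')"
    if N: "N \<ge> 2" and "R N E" for N E
  proof -
    have T: "T N E \<in> dtree (N ^ c)" "\<And>A. blen (T N E A) \<le> N ^ c"
      using c that by (auto simp: small_def)
    have "(\<lambda>A. h v (map (\<lambda>x. F N E x A) [0..<blen v])) \<in> dtree (N ^ c * N ^ d)"
      if v: "blen v \<le> N ^ c" for v
    proof -
      have "(\<lambda>A. map (\<lambda>x. F N E x A) [0..<blen v]) \<in> dtree (blen v * N ^ d)"
        by (rule dtree_upt) (use d N \<open>R N E\<close> v in auto)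
      then have "(\<lambda>A. h v (map (\<lambda>x. F N E x A) [0..<blen v])) \<in> dtree (blen v * N ^ d)"
        by (rule dtree_map)
      then show ?thesis by (rule dtree_mono) (use v in auto)
    qed
    from dtree_bind_on [where P = "\<lambda>v. blen v \<le> N ^ c" and
        G = "\<lambda>v A. h v (map (\<lambda>x. F N E x A) [0..<blen v])", OF T(1) T(2) this]
    have "(\<lambda>A. h (T N E A) (map (\<lambda>x. F N E x A) [0..<blen (T N E A)])) \<in> dtree (N ^ c + N ^ c * N ^ d)" .
    then show ?thesis by (rule dtree_mono) (use d' N in blast)
  qed
  then show ?thesis by blast
qed

definition fv_small :: "nat \<Rightarrow> pfm \<Rightarrow> nat \<Rightarrow> (nat \<Rightarrow> nat set \<Rightarrow> nat) \<Rightarrow> bool" where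
  "fv_small c p N E \<longleftrightarrow> (\<forall>i\<in>fv p. small c N (E i))"

lemma dtree_weaken:
  assumes "\<exists>d. \<forall>N\<ge>2. \<forall>E. R N E \<longrightarrow> F N E \<in> dtree (N ^ d)" "\<And>N E. R' N E \<Longrightarrow> R N E"
  shows "\<exists>d. \<forall>N\<ge>2. \<forall>E. R' N E \<longrightarrow> F N E \<in> dtree (N ^ d)"
  using assms by meson

lemma small_dtree:
  assumes "\<exists>d. \<forall>N\<ge>2. \<forall>E. R N E \<longrightarrow> small d N (F N E)" "\<And>N E. R' N E \<Longrightarrow> R N E"
  shows "\<exists>d. \<forall>N\<ge>2. \<forall>E. R' N E \<longrightarrow> F N E \<in> dtree (N ^ d)"
  using assms unfolding small_def by meson

lemma dtree_sat_qf:
  assumes "quantifier_free p" "wf_pfm PVa p"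
  shows "\<exists>d. \<forall>N\<ge>2. \<forall>E. fv_small c p N E \<longrightarrow> (\<lambda>A. sat (std A) (\<lambda>i. E i A) p) \<in> dtree (N ^ d)"
  using assms
proof (induction p)
  case FBot
  then show ?case by (auto intro: dtree_const)
next
  case (FEq s t)
  have "\<exists>d. \<forall>N\<ge>2. \<forall>E. fv_small c (FEq s t) N E \<longrightarrow> (\<lambda>A. tval (std A) (\<lambda>i. E i A) u) \<in> dtree (N ^ d)"
    if "u = s \<or> u = t" for u
    by (rule small_dtree [OF small_tval [of u c]]) (use that FEq.prems in \<open>auto simp: fv_small_def\<close>)
  from dtree_sat_boolean [OF this [of s] this [of t], of "(=)"] show ?case by simp
next
  case (FRel r ts)
  have t: "\<exists>d. \<forall>N\<ge>2. \<forall>E. fv_small c (FRel r ts) N E \<longrightarrow> (\<lambda>A. tval (std A) (\<lambda>i. E i A) u) \<in> dtree (N ^ d)"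
    if "u \<in> set ts" for u
    by (rule small_dtree [OF small_tval [of u c]])
      (use that FRel.prems in \<open>auto simp: fv_small_def list_all_iff\<close>)
  show ?case
  proof (cases r)
    case Less
    then obtain s u where ts: "ts = [s, u]"
      using FRel.prems(2) by (auto simp: length_Suc_conv numeral_2_eq_2)
    from dtree_sat_boolean [OF t [of s] t [of u], of "(<)"] show ?thesis
      by (simp add: ts Less)
  next
    case Alpha
    then obtain s where ts: "ts = [s]" using FRel.prems(2) by (auto simp: length_Suc_conv)
    then obtain d where d: "\<forall>N\<ge>2. \<forall>E. fv_small c (FRel r ts) N E \<longrightarrow>
        (\<lambda>A. tval (std A) (\<lambda>i. E i A) s) \<in> dtree (N ^ d)"
      using t by auto
    have "poly_bounded (\<lambda>N. N ^ d + 1)"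
      by (intro poly_bounded_add poly_bounded_const poly_bounded_power)
    then obtain d' where d': "\<forall>N::nat\<ge>2. N ^ d + 1 \<le> N ^ d'"
      unfolding poly_bounded_def by blast
    have "(\<lambda>A. tval (std A) (\<lambda>i. E i A) s \<in> A) \<in> dtree (N ^ d')"
      if "N \<ge> 2" "fv_small c (FRel r ts) N E" for N E
      by (rule dtree_mono [OF dtree_bind [where G = "\<lambda>v A. v \<in> A"] d' [rule_format]])
        (use d that dtree_mem in auto)
    then show ?thesis unfolding Alpha ts by auto
  qed
next
  case (FNeg p)
  then obtain d where "\<forall>N\<ge>2. \<forall>E. fv_small c p N E \<longrightarrow> (\<lambda>A. sat (std A) (\<lambda>i. E i A) p) \<in> dtree (N ^ d)"
    by auto
  then show ?case using dtree_map [of _ _ Not] by (fastforce simp: fv_small_def)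
next
  case (FAnd p q)
  have "\<exists>d. \<forall>N\<ge>2. \<forall>E. fv_small c (FAnd p q) N E \<longrightarrow> (\<lambda>A. sat (std A) (\<lambda>i. E i A) u) \<in> dtree (N ^ d)"
    if "u = p \<or> u = q" for u
    by (rule dtree_weaken [where R = "fv_small c u"]) (use that FAnd in \<open>auto simp: fv_small_def\<close>)
  from dtree_sat_boolean [OF this [of p] this [of q], of "(\<and>)"] show ?case by simp
next
  case (FOr p q)
  have "\<exists>d. \<forall>N\<ge>2. \<forall>E. fv_small c (FOr p q) N E \<longrightarrow> (\<lambda>A. sat (std A) (\<lambda>i. E i A) u) \<in> dtree (N ^ d)"
    if "u = p \<or> u = q" for u
    by (rule dtree_weaken [where R = "fv_small c u"]) (use that FOr in \<open>auto simp: fv_small_def\<close>)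
  from dtree_sat_boolean [OF this [of p] this [of q], of "(\<or>)"] show ?case by simp
qed simp_all

text \<open>The range of the quantifier is a length, hence polynomial, and its members are short
  constants, so one tree evaluates all instances. The function h of the truth values is left open:
  both quantifiers and the search for a least witness are obtained by a choice of h.\<close>

lemma dtree_sat_quantifier:
  assumes IH: "\<And>c. \<exists>d. \<forall>N\<ge>2. \<forall>E. fv_small c p N E \<longrightarrow> (\<lambda>A. sat (std A) (\<lambda>i. E i A) p) \<in> dtree (N ^ d)"
    and t: "wf_tm PVa fst t"
  shows "\<exists>d. \<forall>N\<ge>2. \<forall>E. (\<forall>i\<in>fv_tm t \<union> {n. Suc n \<in> fv p}. small c N (E i)) \<longrightarrow>
    (\<lambda>A. h (map (\<lambda>x. sat (std A) (case_nat x (\<lambda>i. E i A)) p) [0..<blen (tval (std A) (\<lambda>i. E i A) t)]))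
    \<in> dtree (N ^ d)"
proof (rule dtree_sat_bounded [where h = "\<lambda>_. h" and F = "\<lambda>N E x A. sat (std A) (case_nat x (\<lambda>i. E i A)) p"])
  let ?R = "\<lambda>N E. \<forall>i\<in>fv_tm t \<union> {n. Suc n \<in> fv p}. small c N (E i)"
  show "\<exists>d. \<forall>N\<ge>2. \<forall>E. ?R N E \<longrightarrow> small d N (\<lambda>A. tval (std A) (\<lambda>i. E i A) t)"
    using small_tval [OF t, of c] by (meson UnI1)
  fix c'
  obtain d where d: "\<forall>N\<ge>2. \<forall>E. fv_small (max c c') p N E \<longrightarrow>
      (\<lambda>A. sat (std A) (\<lambda>i. E i A) p) \<in> dtree (N ^ d)"
    using IH by blast
  have "(\<lambda>A. sat (std A) (case_nat x (\<lambda>i. E i A)) p) \<in> dtree (N ^ d)"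
    if N: "N \<ge> 2" and "?R N E" "x < N ^ c'" for N E x
  proof -
    have "blen x \<le> N ^ c'" using le_blen [of x] that by linarith
    then have "small (max c c') N (\<lambda>A. x)" using small_mono [OF small_const] N by simp
    moreover have "small (max c c') N (E i)" if "Suc i \<in> fv p" for i
      using that \<open>?R N E\<close> N small_mono by (metis (lifting) UnCI max.cobounded1 mem_Collect_eq)
    ultimately have "fv_small (max c c') p N (case_nat (\<lambda>A. x) E)"
      by (auto simp: fv_small_def split: nat.splits)
    then have "(\<lambda>A. sat (std A) (\<lambda>i. case_nat (\<lambda>A. x) E i A) p) \<in> dtree (N ^ d)" using d N by blast
    moreover have "(\<lambda>i. case_nat (\<lambda>A. x) E i A) = case_nat x (\<lambda>i. E i A)" for A
      by (auto simp: fun_eq_iff split: nat.splits)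
    ultimately show ?thesis by simp
  qed
  then show "\<exists>d. \<forall>N\<ge>2. \<forall>E x. ?R N E \<longrightarrow> x < N ^ c' \<longrightarrow>
      (\<lambda>A. sat (std A) (case_nat x (\<lambda>i. E i A)) p) \<in> dtree (N ^ d)"
    by blast
qed

lemma dtree_sat:
  assumes "p \<in> sharply_bounded PVa"
  shows "\<exists>d. \<forall>N\<ge>2. \<forall>E. fv_small c p N E \<longrightarrow> (\<lambda>A. sat (std A) (\<lambda>i. E i A) p) \<in> dtree (N ^ d)"
  using assms
proof (induction arbitrary: c rule: sharply_bounded.induct)
  case (qf p)
  then show ?case by (rule dtree_sat_qf)
next
  case (Neg p)
  obtain d where "\<forall>N\<ge>2. \<forall>E. fv_small c p N E \<longrightarrow> (\<lambda>A. sat (std A) (\<lambda>i. E i A) p) \<in> dtree (N ^ d)"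
    using Neg.IH by blast
  then show ?case using dtree_map [of _ _ Not] by (fastforce simp: fv_small_def)
next
  case (And p q)
  have "\<exists>d. \<forall>N\<ge>2. \<forall>E. fv_small c (FAnd p q) N E \<longrightarrow> (\<lambda>A. sat (std A) (\<lambda>i. E i A) u) \<in> dtree (N ^ d)"
    if "u = p \<or> u = q" for u
    by (rule dtree_weaken [where R = "fv_small c u"]) (use that And.IH in \<open>auto simp: fv_small_def\<close>)
  from dtree_sat_boolean [OF this [of p] this [of q], of "(\<and>)"] show ?case by simp
next
  case (Or p q)
  have "\<exists>d. \<forall>N\<ge>2. \<forall>E. fv_small c (FOr p q) N E \<longrightarrow> (\<lambda>A. sat (std A) (\<lambda>i. E i A) u) \<in> dtree (N ^ d)"
    if "u = p \<or> u = q" for u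
    by (rule dtree_weaken [where R = "fv_small c u"]) (use that Or.IH in \<open>auto simp: fv_small_def\<close>)
  from dtree_sat_boolean [OF this [of p] this [of q], of "(\<or>)"] show ?case by simp
next
  case (Ex p t g)
  have eq: "sat (std A) e (ex_less (Fn g [t]) p) =
      list_ex id (map (\<lambda>x. sat (std A) (case_nat x e) p) [0..<blen (tval (std A) e t)])" for A e
    unfolding sat_ex_less tval_len [OF Ex.hyps(3)] by (auto simp: list_ex_iff)
  show ?case unfolding eq fv_small_def fv_ex_less
    using dtree_sat_quantifier [OF Ex.IH Ex.hyps(2), of c "list_ex id"] by simp
next
  case (All p t g)
  have eq: "sat (std A) e (all_less (Fn g [t]) p) =
      list_all id (map (\<lambda>x. sat (std A) (case_nat x e) p) [0..<blen (tval (std A) e t)])" for A e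
    unfolding sat_all_less tval_len [OF All.hyps(3)] by (auto simp: list_all_iff)
  show ?case unfolding eq fv_small_def fv_all_less
    using dtree_sat_quantifier [OF All.IH All.hyps(2), of c "list_all id"] by simp
qed


section \<open>Substitution for the oracle\<close>

lemma PV_subset: "PV \<subseteq> PVa"
  by (auto simp: PV_def)

lemma wf_tm_mono: "wf_tm F a t \<Longrightarrow> F \<subseteq> G \<Longrightarrow> wf_tm G a t"
  by (induction t) (auto simp: list_all_iff)

lemma tval_PV: "wf_tm PV fst t \<Longrightarrow> tval (std A) e t = tval (std B) e t"
proof (induction t)
  case (Fn f ts)
  then have "map (tval (std A) e) ts = map (tval (std B) e) ts" by (auto simp: list_all_iff)
  moreover have "pv_val A f = pv_val B f" using Fn.prems pv_val_PV by simp
  ultimately show ?case by (simp only: tval.simps fn_std)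
qed simp

lemma len_syms_PV: "g \<in> len_syms \<Longrightarrow> g \<in> PV \<and> fst g = 1"
  by (simp add: len_syms_def)

lemma wf_subst_alpha:
  assumes "quantifier_free p" "wf_pfm PV p" "f \<in> PVa" "fst f = Suc m"
  shows "quantifier_free (subst_alpha f m d p) \<and> wf_pfm PVa (subst_alpha f m d p)"
  using assms
proof (induction p)
  case (FRel r ts)
  show ?case
  proof (cases r)
    case Alpha
    then obtain s where "ts = [s]" using FRel.prems(2) by (auto simp: length_Suc_conv)
    then show ?thesis using FRel.prems zero_sym_PV PV_subset wf_tm_mono
      by (auto simp: Alpha list_all_iff zero_sym_def)
  qed (use FRel.prems wf_tm_mono [OF _ PV_subset] in \<open>auto simp: list_all_iff\<close>)
qed (auto intro: wf_tm_mono [OF _ PV_subset])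

lemma subst_alpha_less:
  "subst_alpha f m d (ex_less t p) = ex_less t (subst_alpha f m (Suc d) p)"
  "subst_alpha f m d (all_less t p) = all_less t (subst_alpha f m (Suc d) p)"
  by (simp_all add: ex_less_def all_less_def)

lemma sharply_bounded_subst_alpha:
  assumes "p \<in> sharply_bounded PV" "f \<in> PVa" "fst f = Suc m"
  shows "subst_alpha f m d p \<in> sharply_bounded PVa"
  using assms(1)
proof (induction arbitrary: d rule: sharply_bounded.induct)
  case (qf p)
  then show ?case using wf_subst_alpha assms(2,3) by (blast intro: sharply_bounded.qf)
qed (auto simp: subst_alpha_less intro: sharply_bounded.intros wf_tm_mono [OF _ PV_subset])

definition alpha_subst :: "psym \<Rightarrow> nat list \<Rightarrow> nat set \<Rightarrow> nat set" where
  "alpha_subst f zs A = {x. pv_val A f (x # zs) = 0}"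

lemma sat_subst_alpha_qf:
  assumes "quantifier_free p" "wf_pfm PV p"
  shows "sat (std A) e (subst_alpha f m d p) =
    sat (std (alpha_subst f (map (\<lambda>i. e (d + 2 + i)) [0..<m]) A)) e p"
  using assms
proof (induction p)
  case (FEq s t)
  then show ?case using tval_PV by (metis sat.simps(2) subst_alpha.simps(8) wf_fm.simps(2))
next
  case (FRel r ts)
  let ?B = "alpha_subst f (map (\<lambda>i. e (d + 2 + i)) [0..<m]) A"
  have eq: "map (tval (std A) e) ts = map (tval (std ?B) e) ts"
    using FRel.prems tval_PV by (auto simp: list_all_iff)
  show ?case
  proof (cases r)
    case Less
    then show ?thesis using eq by (simp del: list.map_disc_iff map_eq_conv)
  next
    case Alpha
    then obtain s where "ts = [s]" using FRel.prems(2) by (auto simp: length_Suc_conv)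
    then show ?thesis using eq zero_sym_val [of A]
      by (simp add: Alpha comp_def alpha_subst_def)
  qed
qed auto

text \<open>Terms over \<open>PV\<close> do not consult the oracle, so both sides can differ only at
  the atoms for \<alpha>, where \<open>alpha_subst\<close> is made to agree.\<close>

lemma sat_subst_alpha:
  assumes "p \<in> sharply_bounded PV"
  shows "sat (std A) e (subst_alpha f m d p) =
    sat (std (alpha_subst f (map (\<lambda>i. e (d + 2 + i)) [0..<m]) A)) e p"
  using assms
proof (induction arbitrary: d e rule: sharply_bounded.induct)
  case (qf p)
  then show ?case by (rule sat_subst_alpha_qf)
next
  case (Ex p t g)
  have wf: "wf_tm PV fst (Fn g [t])" using Ex len_syms_PV by simp
  have "case_nat a e (Suc d + 2 + i) = e (d + 2 + i)" for a i by simp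
  note * = this tval_PV [OF wf, of A e "alpha_subst f (map (\<lambda>i. e (d + 2 + i)) [0..<m]) A"]
  show ?case by (simp only: subst_alpha_less sat_ex_less Ex.IH *)
next
  case (All p t g)
  have wf: "wf_tm PV fst (Fn g [t])" using All len_syms_PV by simp
  have "case_nat a e (Suc d + 2 + i) = e (d + 2 + i)" for a i by simp
  note * = this tval_PV [OF wf, of A e "alpha_subst f (map (\<lambda>i. e (d + 2 + i)) [0..<m]) A"]
  show ?case by (simp only: subst_alpha_less sat_all_less All.IH *)
qed auto


section \<open>Finite approximations of a binary code\<close>

definition agree :: "(nat \<times> bool) set \<Rightarrow> nat set \<Rightarrow> bool" where
  "agree C A \<longleftrightarrow> (\<forall>(x, b)\<in>C. x \<in> A \<longleftrightarrow> b)"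

lemma agree_mono: "agree C A \<Longrightarrow> D \<subseteq> C \<Longrightarrow> agree D A"
  by (auto simp: agree_def)

lemma agree_insert: "agree (insert (x, b) C) A \<longleftrightarrow> (x \<in> A \<longleftrightarrow> b) \<and> agree C A"
  by (auto simp: agree_def)

lemma tuples_mono: "as \<in> tuples K k \<Longrightarrow> K \<subseteq> K' \<Longrightarrow> as \<in> tuples K' k"
  by (auto simp: tuples_def)

type_synonym 'a naming = "nat set \<times> (nat \<Rightarrow> 'a)"
type_synonym 'a condition = "nat set \<times> (nat \<Rightarrow> 'a naming)"

locale infinite_structure =
  fixes L :: lang and B :: "'a lstr"
  assumes finite_lang: "finite_lang L" and is_struct: "is_structure L B" and infinite_univ: "infinite (univ B)"
begin

definition rel_code :: "nat set \<Rightarrow> nat \<Rightarrow> nat \<Rightarrow> nat list \<Rightarrow> bool" where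
  "rel_code K x S as \<longleftrightarrow> S \<in> rels L \<and> as \<in> tuples K (ar L S) \<and> x = tup (S # as)"

definition fun_code :: "nat \<Rightarrow> nat set \<Rightarrow> nat \<Rightarrow> nat \<Rightarrow> nat list \<Rightarrow> nat \<Rightarrow> bool" where
  "fun_code n K x S as i \<longleftrightarrow>
     S \<in> funs L \<and> as \<in> tuples K (ar L S) \<and> i < blen n \<and> x = tup (S # as @ [i])"

text \<open>A condition \<open>(K, h)\<close> names the elements \<open>h ` K\<close> of \<open>B\<close> by numbers \<open>K \<subseteq> [n]\<close>. It decides the bits of the value
  of a function on \<open>K\<close> only if that value has a name.\<close>

definition lits :: "nat \<Rightarrow> 'a naming \<Rightarrow> (nat \<times> bool) set" where
  "lits n q = (case q of (K, h) \<Rightarrow>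
     {(x, rl B (LR S) (map h as)) | x S as. rel_code K x S as} \<union>
     {(x, bit v i) | x S as i v. fun_code n K x S as i \<and> v \<in> K \<and> h v = fn B (LF S) (map h as)} \<union>
     {(x, False) | x. (\<nexists>S as. rel_code {..<n} x S as) \<and> (\<nexists>S as i. fun_code n {..<n} x S as i)})"

definition cond :: "nat \<Rightarrow> 'a naming \<Rightarrow> bool" where
  "cond n q \<longleftrightarrow> fst q \<subseteq> {..<n} \<and> inj_on (snd q) (fst q) \<and> snd q ` fst q \<subseteq> univ B"

text \<open>The elements may be exchanged as long as no decided literal is lost;
  \<open>large_embedding\<close> exploits this. Comparing the literals of every subset of the old
  names, not only of all of them, makes the relation transitive.\<close>

definition ext :: "nat \<Rightarrow> 'a naming \<Rightarrow> 'a naming \<Rightarrow> bool" where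
  "ext n q' q \<longleftrightarrow> fst q \<subseteq> fst q' \<and> (\<forall>D\<subseteq>fst q. lits n (D, snd q) \<subseteq> lits n (D, snd q'))"

lemma code_unique:
  "rel_code K x S as \<Longrightarrow> rel_code K' x S' as' \<Longrightarrow> S = S' \<and> as = as'"
  "fun_code n K x S as i \<Longrightarrow> fun_code n K' x S' as' i' \<Longrightarrow> S = S' \<and> as = as' \<and> i = i'"
  "rel_code K x S as \<Longrightarrow> fun_code n K' x S' as' i' \<Longrightarrow> False"
  using finite_lang by (auto simp: rel_code_def fun_code_def tup_def finite_lang_def list_encode_eq)

lemma code_mono:
  "rel_code K x S as \<Longrightarrow> K \<subseteq> K' \<Longrightarrow> rel_code K' x S as"
  "fun_code n K x S as i \<Longrightarrow> K \<subseteq> K' \<Longrightarrow> fun_code n K' x S as i"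
  by (auto simp: rel_code_def fun_code_def intro: tuples_mono)

lemma lits_rel: "rel_code K x S as \<Longrightarrow> (x, rl B (LR S) (map h as)) \<in> lits n (K, h)"
  by (auto simp: lits_def)

lemma lits_fun:
  "fun_code n K x S as i \<Longrightarrow> v \<in> K \<Longrightarrow> h v = fn B (LF S) (map h as) \<Longrightarrow> (x, bit v i) \<in> lits n (K, h)"
  unfolding lits_def by blast

lemma litsE:
  assumes "(x, b) \<in> lits n (K, h)"
  obtains (rel) S as where "rel_code K x S as" "b = rl B (LR S) (map h as)"
    | ("fun") S as i v where "fun_code n K x S as i" "v \<in> K" "h v = fn B (LF S) (map h as)" "b = bit v i"
    | (none) "\<not> b" "\<nexists>S as. rel_code {..<n} x S as" "\<nexists>S as i. fun_code n {..<n} x S as i"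
  using assms unfolding lits_def by auto

text \<open>Numbers that code no atom are answered negatively by every condition, so queries about
  them cost no names.\<close>

lemma lits_none:
  "(\<nexists>S as. rel_code {..<n} x S as) \<Longrightarrow> (\<nexists>S as i. fun_code n {..<n} x S as i) \<Longrightarrow> (x, False) \<in> lits n q"
  unfolding lits_def by (cases q) auto

lemma lits_mono: "K \<subseteq> K' \<Longrightarrow> lits n (K, h) \<subseteq> lits n (K', h)"
proof
  fix l assume a: "K \<subseteq> K'" "l \<in> lits n (K, h)"
  obtain x b where l: "l = (x, b)" by fastforce
  have "(x, b) \<in> lits n (K, h)" using a(2) l by simp
  then show "l \<in> lits n (K', h)"
  proof (cases rule: litsE)
    case (rel S as)
    then show ?thesis using lits_rel [OF code_mono(1) [OF rel(1) a(1)]] l by simp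
  next
    case ("fun" S as i v)
    then show ?thesis using lits_fun [OF code_mono(2) [OF "fun"(1) a(1)], of v h] a(1) l by auto
  next
    case none
    then show ?thesis using lits_none [of n x] l by simp
  qed
qed

lemma lits_cong_subset: "(\<And>k. k \<in> K \<Longrightarrow> h k = h' k) \<Longrightarrow> lits n (K, h) \<subseteq> lits n (K, h')"
proof
  fix l assume a: "\<And>k. k \<in> K \<Longrightarrow> h k = h' k" "l \<in> lits n (K, h)"
  obtain x b where l: "l = (x, b)" by fastforce
  have map_eq: "map h as = map h' as" if "as \<in> tuples K m" for as m
    using a(1) that by (auto simp: tuples_def)
  have "(x, b) \<in> lits n (K, h)" using a(2) l by simp
  then show "l \<in> lits n (K, h')"
  proof (cases rule: litsE)
    case (rel S as)
    then have "map h as = map h' as" using map_eq by (auto simp: rel_code_def)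
    then show ?thesis using lits_rel [OF rel(1), of h' n] rel(2) l by (simp del: map_eq_conv)
  next
    case ("fun" S as i v)
    then have "map h as = map h' as" using map_eq by (auto simp: fun_code_def)
    then show ?thesis using lits_fun [OF "fun"(1,2), of h'] "fun"(2-4) a(1) [of v] l
      by (simp del: map_eq_conv)
  next
    case none
    then show ?thesis using lits_none [of n x] l by simp
  qed
qed

lemma ext_refl: "ext n q q"
  by (auto simp: ext_def)

lemma ext_trans: "ext n q'' q' \<Longrightarrow> ext n q' q \<Longrightarrow> ext n q'' q"
  unfolding ext_def by (meson order_trans)

lemma ext_lits: "ext n q' q \<Longrightarrow> lits n q \<subseteq> lits n q'"
proof -
  assume "ext n q' q"
  then have "lits n (fst q, snd q) \<subseteq> lits n (fst q, snd q')" "fst q \<subseteq> fst q'"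
    unfolding ext_def by blast+
  then show ?thesis using lits_mono [of "fst q" "fst q'" n "snd q'"] by simp
qed

lemma ext_same: "K \<subseteq> K' \<Longrightarrow> (\<And>k. k \<in> K \<Longrightarrow> h k = h' k) \<Longrightarrow> ext n (K', h') (K, h)"
  unfolding ext_def using lits_cong_subset by (metis fst_conv snd_conv subsetD)

lemma ext_restrict: "ext n (K', h') (K, h) \<Longrightarrow> K \<subseteq> D \<Longrightarrow> ext n (D, h') (K, h)"
  by (auto simp: ext_def)

lemma cond_restrict: "cond n (K, h) \<Longrightarrow> D \<subseteq> K \<Longrightarrow> cond n (D, h)"
  by (auto simp: cond_def inj_on_subset)

text \<open>A number codes at most one atom, and since namings are injective, the value of a
  function has at most one name.\<close>

lemma lits_functional:
  assumes "cond n (K, h)" "(x, b) \<in> lits n (K, h)" "(x, b') \<in> lits n (K, h)"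
  shows "b = b'"
proof -
  have K: "K \<subseteq> {..<n}" "inj_on h K" using assms(1) by (auto simp: cond_def)
  from assms(2) show ?thesis
  proof (cases rule: litsE)
    case 1: (rel S as)
    from assms(3) show ?thesis
    proof (cases rule: litsE)
      case 2: (rel S' as')
      show ?thesis using code_unique(1) [OF 1(1) 2(1)] 1(2) 2(2) by simp
    next
      case 2: ("fun" S' as' i' v')
      show ?thesis using code_unique(3) [OF 1(1) 2(1)] by simp
    next
      case none
      then show ?thesis using code_mono(1) [OF 1(1) K(1)] by blast
    qed
  next
    case 1: ("fun" S as i v)
    from assms(3) show ?thesis
    proof (cases rule: litsE)
      case 2: (rel S' as')
      show ?thesis using code_unique(3) [OF 2(1) 1(1)] by simp
    next
      case 2: ("fun" S' as' i' v')
      have "v = v'" using code_unique(2) [OF 1(1) 2(1)] inj_onD [OF K(2) _ 1(2) 2(2)] 1(3) 2(3) by simp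
      then show ?thesis using code_unique(2) [OF 1(1) 2(1)] 1(4) 2(4) by simp
    next
      case none
      then show ?thesis using code_mono(2) [OF 1(1) K(1)] by blast
    qed
  next
    case 1: none
    from assms(3) show ?thesis
    proof (cases rule: litsE)
      case (rel S as)
      then show ?thesis using code_mono(1) [OF rel(1) K(1)] 1(2) by blast
    next
      case ("fun" S as i v)
      then show ?thesis using code_mono(2) [OF "fun"(1) K(1)] 1(3) by blast
    next
      case none
      then show ?thesis using 1(1) by simp
    qed
  qed
qed

lemma agree_exists: "cond n q \<Longrightarrow> \<exists>A. agree (lits n q) A"
proof -
  assume q: "cond n q"
  have "b = b'" if "(x, b) \<in> lits n q" "(x, b') \<in> lits n q" for x b b'
    using lits_functional [of n "fst q" "snd q"] q that by simp
  then have "(x, True) \<in> lits n q \<longleftrightarrow> b" if "(x, b) \<in> lits n q" for x b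
    using that by (cases b) auto
  then have "agree (lits n q) {x. (x, True) \<in> lits n q}" by (clarsimp simp: agree_def)
  then show ?thesis by blast
qed

text \<open>The successor accounts for the name of the value of a function.\<close>

definition width :: nat where
  "width = Suc (\<Sum>S\<in>funs L \<union> rels L. ar L S)"

lemma ar_width: "S \<in> funs L \<union> rels L \<Longrightarrow> Suc (ar L S) \<le> width"
  using finite_lang unfolding width_def finite_lang_def
  by (simp add: member_le_sum)

lemma card_tuple: "as \<in> tuples K k \<Longrightarrow> card (set as) \<le> k"
  by (auto simp: tuples_def card_length)

text \<open>The supporting names are the arguments of the atom and, for a bit of a function value,
  the name of this value.\<close>

lemma lit_local:
  assumes "(x, b) \<in> lits n (K, h)"
  shows "\<exists>D\<subseteq>K. finite D \<and> card D \<le> width \<and> (x, b) \<in> lits n (D, h)"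
  using assms
proof (cases rule: litsE)
  case (rel S as)
  then have S: "S \<in> rels L" "as \<in> tuples K (ar L S)" by (auto simp: rel_code_def)
  then have "card (set as) \<le> width" "set as \<subseteq> K"
    using ar_width [of S] card_tuple [OF S(2)] by (auto simp: tuples_def)
  moreover have "rel_code (set as) x S as" using rel(1) by (auto simp: rel_code_def tuples_def)
  ultimately show ?thesis using lits_rel [of "set as" x S as h n] rel(2) by (intro exI [of _ "set as"]) simp
next
  case ("fun" S as i v)
  then have S: "S \<in> funs L" "as \<in> tuples K (ar L S)" by (auto simp: fun_code_def)
  then have "card (set as) < width" "set as \<subseteq> K"
    using ar_width [of S] card_tuple [OF S(2)] by (auto simp: tuples_def)
  then have "card (insert v (set as)) \<le> width" "insert v (set as) \<subseteq> K"
    using "fun"(2) by (auto simp: card_insert_if)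
  moreover have "fun_code n (insert v (set as)) x S as i"
    using "fun"(1) by (auto simp: fun_code_def tuples_def)
  ultimately show ?thesis using lits_fun [of n "insert v (set as)" x S as i v h] "fun"(3,4)
    by (intro exI [of _ "insert v (set as)"]) simp
next
  case none
  then show ?thesis using lits_none [of n x "({}, h)"] by (intro exI [of _ "{}"]) simp
qed

lemma lits_local:
  assumes "finite C" "C \<subseteq> lits n (K, h)"
  shows "\<exists>D\<subseteq>K. finite D \<and> card D \<le> card C * width \<and> C \<subseteq> lits n (D, h)"
  using assms
proof (induction C)
  case (insert l C)
  then obtain D where D: "D \<subseteq> K" "finite D" "card D \<le> card C * width" "C \<subseteq> lits n (D, h)" by auto
  obtain D' where D': "D' \<subseteq> K" "finite D'" "card D' \<le> width" "l \<in> lits n (D', h)"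
    using lit_local insert.prems by (metis insert_subset surj_pair)
  have "card (D \<union> D') \<le> card (insert l C) * width"
    using card_Un_le [of D D'] D(3) D'(3) insert.hyps by simp
  moreover have "insert l C \<subseteq> lits n (D \<union> D', h)"
    using D(4) D'(4) lits_mono [of D "D \<union> D'" n h] lits_mono [of D' "D \<union> D'" n h] by blast
  ultimately show ?case using D D' by (intro exI [of _ "D \<union> D'"]) simp
qed (auto intro!: exI [of _ "{}"])

text \<open>Finitely many elements are in use and B is infinite, so new names can receive fresh
  distinct elements.\<close>

lemma cond_add:
  assumes "cond n (K, h)" "D \<subseteq> {..<n}"
  shows "\<exists>h'. cond n (K \<union> D, h') \<and> (\<forall>k\<in>K. h' k = h k)"
proof -
  have K: "K \<subseteq> {..<n}" "inj_on h K" "h ` K \<subseteq> univ B" using assms(1) by (auto simp: cond_def)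
  have fin: "finite K" "finite D" using K(1) assms(2) finite_subset by blast+
  have "infinite (univ B - h ` K)" using infinite_univ fin by simp
  from infinite_arbitrarily_large [OF this, of "card (D - K)"]
  obtain V where V: "finite V" "card V = card (D - K)" "V \<subseteq> univ B - h ` K" by blast
  then obtain f where f: "bij_betw f (D - K) V"
    using finite_same_card_bij [of "D - K" V] fin by auto
  define h' where "h' = (\<lambda>k. if k \<in> K then h k else f k)"
  have "inj_on h' K" using K(2) by (subst inj_on_cong [of K h' h]) (simp_all add: h'_def)
  moreover have "inj_on h' (D - K)"
    using f by (subst inj_on_cong [of "D - K" h' f]) (simp_all add: h'_def bij_betw_def)
  moreover have "h' ` K = h ` K" by (rule image_cong) (simp_all add: h'_def)
  moreover have "h' ` (D - K) = f ` (D - K)" by (rule image_cong) (simp_all add: h'_def)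
  moreover have "f ` (D - K) = V" using f by (simp add: bij_betw_def)
  moreover have "K - (D - K) = K" "D - K - K = D - K" "h ` K \<inter> V = {}" "h ` K \<union> V \<subseteq> univ B"
    using V(3) K(3) by auto
  ultimately have inj: "inj_on h' (K \<union> (D - K))" and im: "h' ` (K \<union> (D - K)) \<subseteq> univ B"
    unfolding inj_on_Un image_Un by simp_all
  have "K \<union> (D - K) = K \<union> D" by blast
  then have "cond n (K \<union> D, h')" using inj im K(1) assms(2) by (simp add: cond_def)
  moreover have "\<forall>k\<in>K. h' k = h k" by (simp add: h'_def)
  ultimately show ?thesis by blast
qed

lemma cond_close:
  assumes "cond n (K, h)" "S \<in> funs L" "as \<in> tuples {..<n} (ar L S)" "card K + Suc (ar L S) \<le> n"
  shows "\<exists>K' h'. cond n (K', h') \<and> K \<subseteq> K' \<and> set as \<subseteq> K' \<and> (\<forall>k\<in>K. h' k = h k) \<and>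
    card K' \<le> card K + Suc (ar L S) \<and> (\<exists>v\<in>K'. h' v = fn B (LF S) (map h' as))"
proof -
  have as: "set as \<subseteq> {..<n}" using assms(3) by (auto simp: tuples_def)
  obtain h1 where h1: "cond n (K \<union> set as, h1)" "\<forall>k\<in>K. h1 k = h k"
    using cond_add [OF assms(1) as] by blast
  have card1: "card (K \<union> set as) \<le> card K + ar L S"
    using card_Un_le [of K "set as"] card_tuple [OF assms(3)] by linarith
  have "map h1 as \<in> tuples (univ B) (ar L S)"
    using h1(1) assms(3) by (auto simp: cond_def tuples_def)
  then have v: "fn B (LF S) (map h1 as) \<in> univ B"
    using is_struct assms(2) by (auto simp: is_structure_def)
  show ?thesis
  proof (cases "fn B (LF S) (map h1 as) \<in> h1 ` (K \<union> set as)")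
    case True
    then have "\<exists>v\<in>K \<union> set as. h1 v = fn B (LF S) (map h1 as)" by (metis imageE)
    then show ?thesis using h1 card1 by (intro exI [of _ "K \<union> set as"] exI [of _ h1]) simp
  next
    case False
    have sub: "K \<union> set as \<subseteq> {..<n}" using h1(1) by (auto simp: cond_def)
    have "card (K \<union> set as) < card {..<n}" using card1 assms(4) by simp
    \<comment> \<open>The cardinality premise leaves a number below n without an element; it becomes
      the name of the function value.\<close>
    then obtain w where w: "w < n" "w \<notin> K \<union> set as"
      using sub by (metis lessThan_iff psubsetI psubset_imp_ex_mem nat_neq_iff Diff_iff)
    define h' where "h' = h1(w := fn B (LF S) (map h1 as))"
    have same: "\<forall>k\<in>K \<union> set as. h' k = h1 k" using w by (auto simp: h'_def)
    then have same_args: "map h' as = map h1 as" by simp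
    moreover have "h' w = fn B (LF S) (map h1 as)" by (simp add: h'_def)
    moreover have "cond n (insert w (K \<union> set as), h')"
    proof -
      have "inj_on h1 (K \<union> set as)" "h1 ` (K \<union> set as) \<subseteq> univ B"
        using h1(1) unfolding cond_def fst_conv snd_conv by blast+
      moreover have "inj_on h' (K \<union> set as) = inj_on h1 (K \<union> set as)"
        by (rule inj_on_cong) (use same in blast)
      moreover have "h' ` (K \<union> set as) = h1 ` (K \<union> set as)"
        by (rule image_cong [OF refl]) (use same in blast)
      ultimately show ?thesis
        using False v w sub \<open>h' w = _\<close> unfolding cond_def fst_conv snd_conv by simp
    qed
    moreover have "card (insert w (K \<union> set as)) \<le> card K + Suc (ar L S)"
      using card1 card_insert_le_m1 [of "Suc (card (K \<union> set as))" "K \<union> set as" w] by simp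
    ultimately show ?thesis using h1(2) same
      by (intro exI [of _ "insert w (K \<union> set as)"] exI [of _ h']) (auto simp del: map_eq_conv simp: same_args)
  qed
qed

lemma decide_query:
  assumes "cond n q" "card (fst q) + width \<le> n"
  shows "\<exists>q' b. cond n q' \<and> ext n q' q \<and> card (fst q') \<le> card (fst q) + width \<and> (x, b) \<in> lits n q'"
proof -
  obtain K h where q: "q = (K, h)" by fastforce
  consider (rel) S as where "rel_code {..<n} x S as" | ("fun") S as i where "fun_code n {..<n} x S as i"
    | (none) "\<nexists>S as. rel_code {..<n} x S as" "\<nexists>S as i. fun_code n {..<n} x S as i" by blast
  then show ?thesis
  proof cases
    case (rel S as)
    then have "set as \<subseteq> {..<n}" "card (set as) < width" "rel_code (K \<union> set as) x S as"
      using ar_width [of S] card_tuple [of as] by (force simp: rel_code_def tuples_def)+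
    moreover obtain h' where "cond n (K \<union> set as, h')" "\<forall>k\<in>K. h' k = h k"
      using cond_add [of n K h "set as"] assms(1) q \<open>set as \<subseteq> {..<n}\<close> by blast
    moreover have "card (K \<union> set as) \<le> card K + card (set as)" by (rule card_Un_le)
    ultimately show ?thesis using lits_rel [of "K \<union> set as" x S as h' n] q
      by (intro exI [of _ "(K \<union> set as, h')"] exI [of _ "rl B (LR S) (map h' as)"])
        (auto intro: ext_same)
  next
    case ("fun" S as i)
    then have S: "S \<in> funs L" "as \<in> tuples {..<n} (ar L S)" "Suc (ar L S) \<le> width"
      using ar_width [of S] by (auto simp: fun_code_def)
    obtain K' h' v where K': "cond n (K', h')" "K \<subseteq> K'" "set as \<subseteq> K'" "\<forall>k\<in>K. h' k = h k"
      "card K' \<le> card K + Suc (ar L S)" "v \<in> K'" "h' v = fn B (LF S) (map h' as)"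
      using cond_close [of n K h S as] S assms q by auto
    have "fun_code n K' x S as i" using "fun" K'(3) by (auto simp: fun_code_def tuples_def)
    then show ?thesis using lits_fun [of n K' x S as i v h'] K' S(3) q
      by (intro exI [of _ "(K', h')"] exI [of _ "bit v i"]) (auto intro: ext_same)
  next
    case none
    then show ?thesis using lits_none assms(1) ext_refl by (metis le_add1)
  qed
qed

text \<open>Only the branch determined by the growing condition is followed, at a cost of
  \<open>width\<close> names per query. The answers C on this branch are returned as well, because
  certificates are made of them.\<close>

lemma decide_tree:
  assumes "F \<in> dtree t" "cond n q" "card (fst q) + t * width \<le> n"
  shows "\<exists>q' C v. cond n q' \<and> ext n q' q \<and> card (fst q') \<le> card (fst q) + t * width \<and>
    C \<subseteq> lits n q' \<and> finite C \<and> card C \<le> t \<and> (\<forall>A. agree C A \<longrightarrow> F A = v)"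
  using assms
proof (induction t arbitrary: F q)
  case 0
  then show ?case using ext_refl by (intro exI [of _ q] exI [of _ "{}"]) auto
next
  case (Suc t)
  obtain x F1 F0 where F: "F1 \<in> dtree t" "F0 \<in> dtree t" "F = (\<lambda>A. if x \<in> A then F1 A else F0 A)"
    using Suc.prems(1) by auto
  obtain q1 b where q1: "cond n q1" "ext n q1 q" "card (fst q1) \<le> card (fst q) + width"
    "(x, b) \<in> lits n q1"
    using decide_query [of n q x] Suc.prems by auto
  have "(if b then F1 else F0) \<in> dtree t" using F by simp
  have "card (fst q1) + t * width \<le> n" using q1(3) Suc.prems(3) by simp
  from Suc.IH [OF \<open>(if b then F1 else F0) \<in> dtree t\<close> q1(1) this] obtain q' C v where q': "cond n q'" "ext n q' q1" "card (fst q') \<le> card (fst q1) + t * width"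
    "C \<subseteq> lits n q'" "finite C" "card C \<le> t" "\<forall>A. agree C A \<longrightarrow> (if b then F1 else F0) A = v"
    by blast
  have "card (insert (x, b) C) \<le> Suc t" using q'(5,6) by (simp add: card_insert_if)
  moreover have "insert (x, b) C \<subseteq> lits n q'" using q' q1(4) ext_lits by blast
  moreover have "\<forall>A. agree (insert (x, b) C) A \<longrightarrow> F A = v" using q'(7) F(3) by (auto simp: agree_insert)
  moreover have "card (fst q') \<le> card (fst q) + Suc t * width" using q'(3) q1(3) by simp
  ultimately show ?case using q'(1,5) ext_trans [OF q'(2) q1(2)] by blast
qed

end


section \<open>Growth rates\<close>

abbreviation size_of :: "nat \<Rightarrow> nat" where
  "size_of n \<equiv> blen n + 2"

text \<open>The factor 8 compensates for \<open>2 ^ size_of n = 8 * 2 ^ (blen n - 1)\<close>, where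
  the last power is at most n if n is positive.\<close>

lemma eventually_power_le_exp: "\<forall>\<^sub>F m in sequentially. 8 * m ^ c \<le> (2::nat) ^ m"
proof -
  \<comment> \<open>With this base the \<open>Suc c\<close>-th power of \<open>x ^ m\<close> is
    \<open>2 ^ m\<close>, so the linear estimate \<open>8 * m \<le> x ^ m\<close> can be raised to
    the exponent \<open>Suc c\<close>.\<close>
  define x :: real where "x = root (Suc c) 2"
  have x: "x > 1" "x ^ Suc c = 2" by (auto simp: x_def real_root_pow_pos2 simp del: power_Suc)
  then have "(\<lambda>m. real m / x ^ m) \<longlonglongrightarrow> 0" by (intro lim_n_over_pown) simp
  then have "\<forall>\<^sub>F m in sequentially. real m / x ^ m < 1 / 8" by (rule order_tendstoD) simp
  then show ?thesis
  proof (rule eventually_elim2 [OF _ eventually_ge_at_top [of 1]])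
    fix m assume m: "real m / x ^ m < 1 / 8" "1 \<le> m"
    have "8 * real m \<le> x ^ m" using m(1) x(1) by (simp add: divide_simps)
    then have "(8 * real m) ^ Suc c \<le> (x ^ m) ^ Suc c" by (intro power_mono) auto
    also have "\<dots> = 2 ^ m" by (metis power_mult mult.commute x(2))
    finally have "(8 * real m) ^ Suc c \<le> 2 ^ m" .
    moreover have "real (8 * m ^ c) \<le> (8 * real m) ^ Suc c"
    proof -
      have "8 * real m ^ c \<le> 8 ^ Suc c * real m ^ Suc c"
        using m(2) by (intro mult_mono power_increasing) (auto simp del: power_Suc intro: self_le_power)
      then show ?thesis by (simp add: power_mult_distrib del: power_Suc)
    qed
    ultimately have "real (8 * m ^ c) \<le> real (2 ^ m)" by simp
    then show "8 * m ^ c \<le> 2 ^ m" using of_nat_le_iff by blast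
  qed
qed

lemma filterlim_size_of: "filterlim size_of sequentially sequentially"
  unfolding filterlim_at_top
proof
  fix M
  have "M \<le> size_of n" if "n \<ge> 2 ^ M" for n
    using blen_iff [of n M] that by linarith
  then show "\<forall>\<^sub>F n in sequentially. M \<le> size_of n" by (rule eventually_sequentiallyI)
qed

lemma eventually_poly_bounded_le:
  assumes "poly_bounded h"
  shows "\<forall>\<^sub>F n in sequentially. h (size_of n) \<le> n"
proof -
  obtain c where c: "\<forall>N\<ge>2. h N \<le> N ^ c" using assms by (auto simp: poly_bounded_def)
  have "\<forall>\<^sub>F n in sequentially. 8 * size_of n ^ c \<le> 2 ^ size_of n"
    using eventually_power_le_exp filterlim_size_of by (rule eventually_compose_filterlim)
  then show ?thesis
  proof (rule eventually_elim2 [OF _ eventually_ge_at_top [of 1]])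
    fix n assume n: "8 * size_of n ^ c \<le> (2::nat) ^ size_of n" "1 \<le> n"
    have "blen n > 0" using n(2) blen_iff [of n 0] by (cases "blen n") auto
    then have "2 ^ (blen n - 1) \<le> n" using blen_iff [of n "blen n - 1"] by linarith
    moreover have "(2::nat) ^ size_of n = 8 * 2 ^ (blen n - 1)"
      using \<open>blen n > 0\<close> by (cases "blen n") auto
    ultimately show "h (size_of n) \<le> n" using n(1) c [rule_format, of "size_of n"] by linarith
  qed
qed


section \<open>The forcing notion\<close>

text \<open>Derivations may contain symbols outside of \<open>PVa\<close> and symbols with a wrong number of arguments. They get the value
  \<open>0\<close>, so that the universe of the forced structure is closed under all functions.\<close>

definition stdm :: "nat set \<Rightarrow> (psym, prel, nat) struct" where
  "stdm A = (std A)\<lparr>fn := \<lambda>f as. if f \<in> PVa \<and> length as = fst f then pv_val A f as else 0\<rparr>"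

lemma fn_stdm: "fn (stdm A) f as = (if f \<in> PVa \<and> length as = fst f then pv_val A f as else 0)"
  by (simp add: stdm_def)

lemma rl_stdm: "rl (stdm A) = rl (std A)"
  by (simp add: stdm_def)

lemma tval_stdm: "wf_tm PVa fst t \<Longrightarrow> tval (stdm A) e t = tval (std A) e t"
proof (induction t)
  case (Fn f ts)
  then have "map (tval (stdm A) e) ts = map (tval (std A) e) ts" by (auto simp: list_all_iff)
  then show ?case using Fn.prems by (simp add: fn_stdm del: map_eq_conv)
qed simp

lemma wf_lift_tm: "wf_tm F a t \<Longrightarrow> wf_tm F a (lift_tm t)"
  by (induction t) (auto simp: list_all_iff)

lemma wf_len_tm: "wf_tm PVa fst t \<Longrightarrow> g \<in> len_syms \<Longrightarrow> wf_tm PVa fst (Fn g [t])"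
  using PV_subset by (auto simp: len_syms_def)

lemma finite_fv_tm: "finite (fv_tm t)"
  by (induction t) auto

lemma finite_fv: "finite (fv p)"
proof (induction p)
  case (FAll p)
  have "{n. Suc n \<in> fv p} = Suc -` fv p" by auto
  then show ?case using FAll by (simp add: finite_vimageI)
next
  case (FEx p)
  have "{n. Suc n \<in> fv p} = Suc -` fv p" by auto
  then show ?case using FEx by (simp add: finite_vimageI)
qed (auto simp: finite_fv_tm)

text \<open>The elements of the forced structure are numbers of length polynomial in the length of
  the nonstandard n, computed from the oracle by shallow trees. The exponent c has to be the same
  for all n.\<close>

definition Nm :: "(nat \<times> nat set \<Rightarrow> nat) set" where
  "Nm = {\<tau>. \<exists>c. \<forall>n. small c (size_of n) (\<lambda>A. \<tau> (n, A))}"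

definition St :: "nat \<times> nat set \<Rightarrow> (psym, prel, nat) struct" where
  "St w = stdm (snd w)"

lemma Nm_common:
  assumes "finite I" "\<And>i. i \<in> I \<Longrightarrow> e i \<in> Nm"
  shows "\<exists>c. \<forall>i\<in>I. \<forall>n. small c (size_of n) (\<lambda>A. e i (n, A))"
  using assms
proof (induction I)
  case (insert i I)
  then obtain c where c: "\<forall>i\<in>I. \<forall>n. small c (size_of n) (\<lambda>A. e i (n, A))" by auto
  have "e i \<in> Nm" using insert.prems by simp
  then obtain d where d: "\<forall>n. small d (size_of n) (\<lambda>A. e i (n, A))" by (auto simp: Nm_def)
  have "small (max c d) (size_of n) (\<lambda>A. e j (n, A))" if "j \<in> insert i I" for j n
    using that c d small_mono [of c _ _ "max c d"] small_mono [of d _ _ "max c d"] by auto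
  then show ?case by blast
qed simp

lemma Nm_const: "(\<And>n. blen (X n) \<le> size_of n ^ c) \<Longrightarrow> (\<lambda>(n, A). X n) \<in> Nm"
  by (auto simp: Nm_def intro!: exI [of _ c] small_const)

lemma Nm_fn:
  assumes "set ts \<subseteq> Nm"
  shows "(\<lambda>w. fn (St w) f (map (\<lambda>t. t w) ts)) \<in> Nm"
proof (cases "f \<in> PVa \<and> length ts = fst f")
  case True
  obtain c where c: "\<forall>t\<in>set ts. \<forall>n. small c (size_of n) (\<lambda>A. t (n, A))"
    using Nm_common [of "set ts" "\<lambda>t. t"] assms by auto
  obtain d where d: "\<And>N Fs. N \<ge> 2 \<Longrightarrow> length Fs = fst f \<Longrightarrow> (\<And>F. F \<in> set Fs \<Longrightarrow> small c N F) \<Longrightarrow>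
      small d N (\<lambda>A. pv_val A f (map (\<lambda>F. F A) Fs))"
    using small_pv_val [of f c] True by blast
  have "small d (size_of n) (\<lambda>A. fn (St (n, A)) f (map (\<lambda>t. t (n, A)) ts))" for n
    using d [of "size_of n" "map (\<lambda>t A. t (n, A)) ts"] c True
    by (auto simp: St_def fn_stdm comp_def)
  then show ?thesis by (auto simp: Nm_def)
next
  case False
  then have "(\<lambda>w. fn (St w) f (map (\<lambda>t. t w) ts)) = (\<lambda>(n, A). 0)"
    by (auto simp: St_def fn_stdm fun_eq_iff)
  then show ?thesis using Nm_const [of "\<lambda>_. 0" 0] by (simp add: floorlog_def)
qed

context infinite_structure
begin

text \<open>A forcing condition \<open>(X, p)\<close> is a sequence of conditions \<open>p n\<close> of size polynomial in the length of \<open>n\<close>. The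
  index \<open>n\<close> ranges over an infinite set \<open>X\<close>, which plays the role of a nonstandard number.\<close>

definition Pos :: "'a condition set" where
  "Pos = {P. infinite (fst P) \<and> (\<forall>n\<in>fst P. cond n (snd P n)) \<and>
             (\<exists>c. \<forall>n\<in>fst P. card (fst (snd P n)) \<le> size_of n ^ c)}"

definition below :: "'a condition \<Rightarrow> 'a condition set" where
  "below P = {Q \<in> Pos. fst Q \<subseteq> fst P \<and> (\<forall>n\<in>fst Q. ext n (snd Q n) (snd P n))}"

definition pts :: "'a condition \<Rightarrow> (nat \<times> nat set) set" where
  "pts P = {(n, A). n \<in> fst P \<and> agree (lits n (snd P n)) A}"

sublocale forcing Pos below pts St Nm
proof
  fix P Q R :: "'a condition"
  show "P \<in> Pos \<Longrightarrow> P \<in> below P" by (simp add: below_def ext_refl)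
  show "Q \<in> below P \<Longrightarrow> Q \<in> Pos" by (simp add: below_def)
  show "R \<in> below P" if RQ: "R \<in> below Q" "Q \<in> below P"
  proof -
    have "ext n (snd R n) (snd P n)" if "n \<in> fst R" for n
      using ext_trans [of n "snd R n" "snd Q n" "snd P n"] RQ that unfolding below_def by blast
    then show ?thesis using RQ unfolding below_def by blast
  qed
  show "pts Q \<subseteq> pts P" if "Q \<in> below P"
    using that agree_mono [OF _ ext_lits] unfolding below_def pts_def by fast
qed (rule Nm_fn)

lemma Pos_cond: "P \<in> Pos \<Longrightarrow> n \<in> fst P \<Longrightarrow> cond n (snd P n)"
  by (simp add: Pos_def)

lemma below_ext: "Q \<in> below P \<Longrightarrow> n \<in> fst Q \<Longrightarrow> ext n (snd Q n) (snd P n)"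
  by (simp add: below_def)

lemma below_lits: "Q \<in> below P \<Longrightarrow> n \<in> fst Q \<Longrightarrow> lits n (snd P n) \<subseteq> lits n (snd Q n)"
  by (rule ext_lits [OF below_ext])

lemma below_fst: "Q \<in> below P \<Longrightarrow> n \<in> fst Q \<Longrightarrow> n \<in> fst P"
  by (auto simp: below_def)

lemma Pos_point: "P \<in> Pos \<Longrightarrow> n \<in> fst P \<Longrightarrow> \<exists>A. (n, A) \<in> pts P"
  using agree_exists [OF Pos_cond] by (simp add: pts_def)

lemma Pos_nonempty: "P \<in> Pos \<Longrightarrow> fst P \<noteq> {}"
  by (auto simp: Pos_def)

lemma below_subset: "P \<in> Pos \<Longrightarrow> infinite X \<Longrightarrow> X \<subseteq> fst P \<Longrightarrow> (X, snd P) \<in> below P"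
  unfolding below_def Pos_def by (auto simp: ext_refl subset_iff)

text \<open>One of the two cases holds at infinitely many indices. Passing to these is an extension,
  which takes the place of an ultrafilter on the indices.\<close>

lemma below_split:
  assumes "P \<in> Pos" "\<And>n. n \<in> fst P \<Longrightarrow> \<Phi> n \<or> \<Psi> n"
  obtains (left) Q where "Q \<in> below P" "\<forall>n\<in>fst Q. \<Phi> n" "snd Q = snd P"
    | (right) Q where "Q \<in> below P" "\<forall>n\<in>fst Q. \<Psi> n" "snd Q = snd P"
proof -
  have "fst P = {n \<in> fst P. \<Phi> n} \<union> {n \<in> fst P. \<Psi> n}" using assms(2) by auto
  moreover have "infinite (fst P)" using assms(1) by (simp add: Pos_def)
  ultimately have "infinite {n \<in> fst P. \<Phi> n} \<or> infinite {n \<in> fst P. \<Psi> n}" by (metis finite_UnI)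
  then show ?thesis
  proof
    assume "infinite {n \<in> fst P. \<Phi> n}"
    from below_subset [OF assms(1) this] have "({n \<in> fst P. \<Phi> n}, snd P) \<in> below P" by blast
    then show ?thesis by (rule left) simp_all
  next
    assume "infinite {n \<in> fst P. \<Psi> n}"
    from below_subset [OF assms(1) this] have "({n \<in> fst P. \<Psi> n}, snd P) \<in> below P" by blast
    then show ?thesis by (rule right) simp_all
  qed
qed

text \<open>A polynomial in the length of n is eventually below n, so only finitely many indices
  have to be dropped.\<close>

lemma below_room:
  assumes "P \<in> Pos" "poly_bounded h"
  shows "\<exists>Q\<in>below P. \<forall>n\<in>fst Q. card (fst (snd Q n)) + h (size_of n) \<le> n"
proof -
  obtain c where c: "\<forall>n\<in>fst P. card (fst (snd P n)) \<le> size_of n ^ c"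
    using assms(1) by (auto simp: Pos_def)
  have "poly_bounded (\<lambda>N. N ^ c + h N)" by (intro poly_bounded_add poly_bounded_power assms(2))
  then have "\<forall>\<^sub>F n in sequentially. size_of n ^ c + h (size_of n) \<le> n"
    by (rule eventually_poly_bounded_le)
  then obtain n0 where n0: "\<And>n. n \<ge> n0 \<Longrightarrow> size_of n ^ c + h (size_of n) \<le> n"
    by (auto simp: eventually_sequentially)
  have "infinite (fst P)" using assms(1) by (simp add: Pos_def)
  then have "infinite (fst P - {..<n0})" by simp
  from below_subset [OF assms(1) this]
  have "(fst P - {..<n0}, snd P) \<in> below P" by blast
  moreover have "card (fst (snd P n)) + h (size_of n) \<le> n" if "n \<in> fst P - {..<n0}" for n
    using c n0 [of n] that by fastforce
  ultimately show ?thesis by (intro bexI [of _ "(fst P - {..<n0}, snd P)"]) simp_all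
qed

text \<open>The choices at different indices are independent; a common polynomial bound on the added
  names keeps the result a condition.\<close>

lemma below_refine:
  assumes "P \<in> Pos" "poly_bounded h"
    and "\<And>n. n \<in> fst P \<Longrightarrow> \<exists>q. cond n q \<and> ext n q (snd P n) \<and>
      card (fst q) \<le> card (fst (snd P n)) + h (size_of n) \<and> \<Phi> n q"
  shows "\<exists>Q\<in>below P. fst Q = fst P \<and> (\<forall>n\<in>fst Q. \<Phi> n (snd Q n))"
proof -
  obtain p where p: "\<And>n. n \<in> fst P \<Longrightarrow> cond n (p n) \<and> ext n (p n) (snd P n) \<and>
      card (fst (p n)) \<le> card (fst (snd P n)) + h (size_of n) \<and> \<Phi> n (p n)"
    using assms(3) by metis
  obtain c where c: "\<forall>n\<in>fst P. card (fst (snd P n)) \<le> size_of n ^ c"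
    using assms(1) by (auto simp: Pos_def)
  have "poly_bounded (\<lambda>N. N ^ c + h N)" by (intro poly_bounded_add poly_bounded_power assms(2))
  then obtain d where d: "\<forall>N\<ge>2. N ^ c + h N \<le> N ^ d" unfolding poly_bounded_def by blast
  have "card (fst (p n)) \<le> size_of n ^ d" if "n \<in> fst P" for n
    using p [OF that] c d [rule_format, of "size_of n"] that by fastforce
  then have "(fst P, p) \<in> below P" using p assms(1) by (auto simp: below_def Pos_def)
  then show ?thesis using p by (intro bexI [of _ "(fst P, p)"]) simp_all
qed

lemma decide:
  assumes "P \<in> Pos" "\<And>n. n \<in> fst P \<Longrightarrow> F n \<in> dtree (size_of n ^ c)"
  shows "\<exists>Q\<in>below P. \<exists>v C. \<forall>n\<in>fst Q. C n \<subseteq> lits n (snd Q n) \<and> finite (C n) \<and>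
    card (C n) \<le> size_of n ^ c \<and> (\<forall>A. agree (C n) A \<longrightarrow> F n A = v n)"
proof -
  have h: "poly_bounded (\<lambda>N. N ^ c * width)"
    by (intro poly_bounded_mult poly_bounded_const poly_bounded_power)
  obtain P' where P': "P' \<in> below P" "\<forall>n\<in>fst P'. card (fst (snd P' n)) + size_of n ^ c * width \<le> n"
    using below_room [OF assms(1) h] by blast
  have "\<exists>Q\<in>below P'. fst Q = fst P' \<and> (\<forall>n\<in>fst Q. \<exists>C v. C \<subseteq> lits n (snd Q n) \<and> finite C \<and>
      card C \<le> size_of n ^ c \<and> (\<forall>A. agree C A \<longrightarrow> F n A = v))"
  proof (rule below_refine [OF below_Pos [OF P'(1)] h])
    fix n assume n: "n \<in> fst P'"
    show "\<exists>q. cond n q \<and> ext n q (snd P' n) \<and> card (fst q) \<le> card (fst (snd P' n)) + size_of n ^ c * width \<and>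
        (\<exists>C v. C \<subseteq> lits n q \<and> finite C \<and> card C \<le> size_of n ^ c \<and> (\<forall>A. agree C A \<longrightarrow> F n A = v))"
      using decide_tree [OF assms(2) Pos_cond [OF below_Pos [OF P'(1)] n] P'(2) [rule_format, OF n]]
        below_fst [OF P'(1) n] by blast
  qed
  then obtain Q where Q: "Q \<in> below P'" "\<And>n. n \<in> fst Q \<Longrightarrow> \<exists>C v. C \<subseteq> lits n (snd Q n) \<and> finite C \<and>
      card C \<le> size_of n ^ c \<and> (\<forall>A. agree C A \<longrightarrow> F n A = v)" by blast
  then obtain C v where "\<forall>n\<in>fst Q. C n \<subseteq> lits n (snd Q n) \<and> finite (C n) \<and>
      card (C n) \<le> size_of n ^ c \<and> (\<forall>A. agree (C n) A \<longrightarrow> F n A = v n)" by metis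
  then show ?thesis using below_trans [OF Q(1) P'(1)] by blast
qed

lemma decide_name:
  assumes "P \<in> Pos" "\<tau> \<in> Nm"
  shows "\<exists>Q\<in>below P. \<exists>X. \<forall>(n, A)\<in>pts Q. \<tau> (n, A) = X n"
proof -
  obtain c where c: "\<And>n. small c (size_of n) (\<lambda>A. \<tau> (n, A))" using assms(2) by (auto simp: Nm_def)
  obtain Q v C where Q: "Q \<in> below P" "\<forall>n\<in>fst Q. C n \<subseteq> lits n (snd Q n) \<and> finite (C n) \<and>
      card (C n) \<le> size_of n ^ c \<and> (\<forall>A. agree (C n) A \<longrightarrow> \<tau> (n, A) = v n)"
    using decide [OF assms(1), of "\<lambda>n A. \<tau> (n, A)" c] c unfolding small_def by blast
  have "\<tau> (n, A) = v n" if "(n, A) \<in> pts Q" for n A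
    using that Q(2) agree_mono unfolding pts_def by blast
  then show ?thesis using Q(1) by blast
qed

lemma decide_names:
  assumes "finite I" "P \<in> Pos" "\<And>i. i \<in> I \<Longrightarrow> e i \<in> Nm"
  shows "\<exists>Q\<in>below P. \<exists>E. \<forall>i\<in>I. \<forall>(n, A)\<in>pts Q. e i (n, A) = E n i"
  using assms
proof (induction I)
  case empty
  then show ?case using below_refl by blast
next
  case (insert i I)
  then obtain Q E where Q: "Q \<in> below P" "\<forall>i\<in>I. \<forall>(n, A)\<in>pts Q. e i (n, A) = E n i" by auto
  obtain R X where R: "R \<in> below Q" "\<forall>(n, A)\<in>pts R. e i (n, A) = X n"
    using decide_name [OF below_Pos [OF Q(1)], of "e i"] insert.prems by blast
  have "\<forall>j\<in>insert i I. \<forall>(n, A)\<in>pts R. e j (n, A) = ((E n)(i := X n)) j"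
    using Q(2) R(2) pts_mono [OF R(1)] insert.hyps by fastforce
  then show ?case using below_trans [OF R(1) Q(1)] by (intro bexI [of _ R] exI [of _ "\<lambda>n. (E n)(i := X n)"])
qed


section \<open>Forcing of sharply bounded formulas\<close>

text \<open>Strong forcing: truth in the actual structures at all points. For sharply bounded
  formulas every condition has an extension deciding it, which links it to
  \<open>forces\<close>.\<close>

definition SF :: "'a condition \<Rightarrow> (nat \<Rightarrow> nat \<times> nat set \<Rightarrow> nat) \<Rightarrow> pfm \<Rightarrow> bool" where
  "SF P e p \<longleftrightarrow> (\<forall>(n, A)\<in>pts P. sat (std A) (\<lambda>i. e i (n, A)) p)"

lemma SF_mono: "SF P e p \<Longrightarrow> Q \<in> below P \<Longrightarrow> SF Q e p"
  using pts_mono unfolding SF_def by blast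

lemma SF_contradiction: "P \<in> Pos \<Longrightarrow> SF P e p \<Longrightarrow> \<not> SF P e (FNeg p)"
proof
  assume P: "P \<in> Pos" "SF P e p" "SF P e (FNeg p)"
  obtain n where "n \<in> fst P" using Pos_nonempty [OF P(1)] by blast
  then obtain A where "(n, A) \<in> pts P" using Pos_point [OF P(1)] by blast
  then show False using P(2,3) unfolding SF_def by auto
qed

lemma dtree_sat_names:
  assumes "p \<in> sharply_bounded PVa" "range e \<subseteq> Nm"
  shows "\<exists>d. \<forall>n. (\<lambda>A. sat (std A) (\<lambda>i. e i (n, A)) p) \<in> dtree (size_of n ^ d)"
proof -
  obtain c where c: "\<forall>i\<in>fv p. \<forall>n. small c (size_of n) (\<lambda>A. e i (n, A))"
    using Nm_common [OF finite_fv, of p e] assms(2) by auto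
  obtain d where d: "\<And>N E. N \<ge> 2 \<Longrightarrow> fv_small c p N E \<Longrightarrow>
      (\<lambda>A. sat (std A) (\<lambda>i. E i A) p) \<in> dtree (N ^ d)"
    using dtree_sat [OF assms(1), of c] by blast
  have "(\<lambda>A. sat (std A) (\<lambda>i. e i (n, A)) p) \<in> dtree (size_of n ^ d)" for n
    by (rule d [of _ "\<lambda>i A. e i (n, A)"]) (use c in \<open>auto simp: fv_small_def\<close>)
  then show ?thesis by blast
qed

lemma decide_sharp:
  assumes "p \<in> sharply_bounded PVa" "range e \<subseteq> Nm" "P \<in> Pos"
  shows "\<exists>Q\<in>below P. SF Q e p \<or> SF Q e (FNeg p)"
proof -
  obtain d where d: "\<And>n. (\<lambda>A. sat (std A) (\<lambda>i. e i (n, A)) p) \<in> dtree (size_of n ^ d)"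
    using dtree_sat_names [OF assms(1,2)] by blast
  obtain Q v C where Q: "Q \<in> below P" "\<forall>n\<in>fst Q. C n \<subseteq> lits n (snd Q n) \<and> finite (C n) \<and>
      card (C n) \<le> size_of n ^ d \<and> (\<forall>A. agree (C n) A \<longrightarrow> sat (std A) (\<lambda>i. e i (n, A)) p = v n)"
    using decide [OF assms(3) d] by blast
  have v: "sat (std A) (\<lambda>i. e i (n, A)) p = v n" if "(n, A) \<in> pts Q" for n A
    using that Q(2) agree_mono unfolding pts_def by blast
  consider (left) R where "R \<in> below Q" "\<forall>n\<in>fst R. v n" | (right) R where "R \<in> below Q" "\<forall>n\<in>fst R. \<not> v n"
    using below_split [OF below_Pos [OF Q(1)], of v "\<lambda>n. \<not> v n"] by metis
  then show ?thesis
  proof cases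
    case left
    then have "SF R e p" using v pts_mono [OF left(1)] unfolding SF_def pts_def by fast
    then show ?thesis using below_trans [OF left(1) Q(1)] by blast
  next
    case right
    then have "SF R e (FNeg p)" using v pts_mono [OF right(1)] unfolding SF_def pts_def by fastforce
    then show ?thesis using below_trans [OF right(1) Q(1)] by blast
  qed
qed

text \<open>Truth at all points and falsity at all points are different requirements, neither being
  the failure of the other. Both are carried through the induction so that it passes
  negations.\<close>

definition adequate :: "pfm \<Rightarrow> bool" where
  "adequate p \<longleftrightarrow> p \<in> sharply_bounded PVa \<and> (\<forall>P\<in>Pos. \<forall>e. range e \<subseteq> Nm \<longrightarrow>
     (SF P e p \<longrightarrow> forces P e p) \<and> (SF P e (FNeg p) \<longrightarrow> forces P e (FNeg p)))"

lemma adequate_pos: "adequate p \<Longrightarrow> P \<in> Pos \<Longrightarrow> range e \<subseteq> Nm \<Longrightarrow> SF P e p \<Longrightarrow> forces P e p"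
  by (simp add: adequate_def)

lemma adequate_neg:
  "adequate p \<Longrightarrow> range e \<subseteq> Nm \<Longrightarrow> SF P e (FNeg p) \<Longrightarrow> Q \<in> below P \<Longrightarrow> \<not> forces Q e p"
  using SF_mono below_Pos below_self unfolding adequate_def by (metis forces.simps(4))

lemma adequate_forces:
  assumes "adequate p" "P \<in> Pos" "range e \<subseteq> Nm" "forces P e p"
  shows "\<exists>Q\<in>below P. SF Q e p"
proof -
  obtain Q where Q: "Q \<in> below P" "SF Q e p \<or> SF Q e (FNeg p)"
    using decide_sharp assms(1-3) unfolding adequate_def by blast
  have "forces Q e p" using assms(4) Q(1) by (rule forces_mono)
  then show ?thesis using Q adequate_neg [OF assms(1,3) _ below_self [OF Q(1)]] by blast
qed

lemma adequate_atom:
  assumes "p \<in> sharply_bounded PVa"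
    and "\<And>P e. forces P e p = dense_below P (\<lambda>Q. \<forall>w\<in>pts Q. sat (St w) (\<lambda>i. e i w) p)"
    and "\<And>A E. sat (stdm A) E p = sat (std A) E p"
  shows "adequate p"
proof -
  have SF: "SF P e p \<longleftrightarrow> (\<forall>w\<in>pts P. sat (St w) (\<lambda>i. e i w) p)" for P e
    by (auto simp: SF_def St_def assms(3))
  have "forces P e p" if "SF P e p" for P e
    unfolding assms(2) SF [symmetric] by (rule dense_below_always) (rule SF_mono [OF that])
  moreover have "\<not> forces Q e p" if P: "SF P e (FNeg p)" "Q \<in> below P" for P Q e
  proof
    assume "forces Q e p"
    then obtain R where R: "R \<in> below Q" "SF R e p"
      unfolding assms(2) SF [symmetric] using dense_belowD below_self [OF P(2)] by blast
    then show False
      using SF_contradiction [OF below_Pos [OF R(1)] R(2)] SF_mono [OF P(1)] below_trans [OF R(1) P(2)]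
      by blast
  qed
  ultimately show ?thesis using assms(1) by (simp add: adequate_def)
qed

lemma adequate_Neg:
  assumes "adequate p"
  shows "adequate (FNeg p)"
proof -
  have "forces P e (FNeg (FNeg p))" if "P \<in> Pos" "range e \<subseteq> Nm" "SF P e (FNeg (FNeg p))" for P e
  proof -
    have "forces P e p" using that by (intro adequate_pos [OF assms]) (auto simp: SF_def)
    then have "forces R e p" if "R \<in> below P" for R using forces_mono that by blast
    then show ?thesis using below_self unfolding forces.simps(4) by blast
  qed
  then show ?thesis using assms by (auto simp: adequate_def intro: sharply_bounded.Neg simp del: forces.simps)
qed

lemma adequate_And:
  assumes "adequate p" "adequate q"
  shows "adequate (FAnd p q)"
proof -
  have "\<not> (forces Q e p \<and> forces Q e q)"
    if e: "range e \<subseteq> Nm" and P: "SF P e (FNeg (FAnd p q))" "Q \<in> below P" for P Q e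
  proof
    assume a: "forces Q e p \<and> forces Q e q"
    then obtain R where R: "R \<in> below Q" "SF R e p"
      using adequate_forces [OF assms(1) below_Pos [OF P(2)] e] by blast
    have "forces R e q" using a forces_mono R(1) by blast
    then obtain R' where R': "R' \<in> below R" "SF R' e q"
      using adequate_forces [OF assms(2) below_Pos [OF R(1)] e] by blast
    have "SF R' e (FAnd p q)" using R'(2) SF_mono [OF R(2) R'(1)] by (auto simp: SF_def)
    moreover have "SF R' e (FNeg (FAnd p q))"
      using SF_mono [OF P(1)] below_trans [OF R'(1) below_trans [OF R(1) P(2)]] by blast
    ultimately show False using SF_contradiction below_Pos [OF R'(1)] by blast
  qed
  moreover have "forces P e (FAnd p q)" if "P \<in> Pos" "range e \<subseteq> Nm" "SF P e (FAnd p q)" for P e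
    using that adequate_pos [OF assms(1), of P e] adequate_pos [OF assms(2), of P e] by (auto simp: SF_def)
  ultimately show ?thesis using assms by (auto simp: adequate_def intro: sharply_bounded.And)
qed

lemma adequate_Or:
  assumes "adequate p" "adequate q"
  shows "adequate (FOr p q)"
proof -
  have "\<exists>R\<in>below Q. forces R e p \<or> forces R e q"
    if e: "range e \<subseteq> Nm" and P: "SF P e (FOr p q)" "Q \<in> below P" for P Q e
  proof -
    \<comment> \<open>At different points different disjuncts may hold; deciding p first makes the
      choice uniform.\<close>
    obtain R where R: "R \<in> below Q" "SF R e p \<or> SF R e (FNeg p)"
      using decide_sharp e below_Pos [OF P(2)] assms(1) unfolding adequate_def by blast
    have "SF R e (FOr p q)" using SF_mono [OF P(1)] below_trans [OF R(1) P(2)] by blast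
    then have "SF R e p \<or> SF R e q" using R(2) by (fastforce simp: SF_def)
    then show ?thesis
      using R(1) adequate_pos [OF assms(1) below_Pos [OF R(1)] e] adequate_pos [OF assms(2) below_Pos [OF R(1)] e]
      by blast
  qed
  then have "forces P e (FOr p q)" if "range e \<subseteq> Nm" "SF P e (FOr p q)" for P e
    using that by (simp add: dense_belowI)
  moreover have "\<not> forces Q e (FOr p q)"
    if e: "range e \<subseteq> Nm" and P: "SF P e (FNeg (FOr p q))" "Q \<in> below P" for P Q e
  proof
    assume "forces Q e (FOr p q)"
    then obtain R where R: "R \<in> below Q" "forces R e p \<or> forces R e q"
      unfolding forces.simps using dense_belowD below_self [OF P(2)] by blast
    have "SF P e (FNeg p)" "SF P e (FNeg q)" using P(1) by (auto simp: SF_def)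
    then show False
      using R(2) adequate_neg [OF assms(1) e] adequate_neg [OF assms(2) e] below_trans [OF R(1) P(2)] by blast
  qed
  ultimately show ?thesis using assms by (simp add: adequate_def sharply_bounded.Or)
qed

lemma adequate_qf:
  assumes "quantifier_free p" "wf_pfm PVa p"
  shows "adequate p"
  using assms
proof (induction p)
  case FBot
  have "FBot \<in> sharply_bounded PVa" by (rule sharply_bounded.qf) simp_all
  moreover have "\<not> SF P e FBot" if "P \<in> Pos" for P e
    using Pos_nonempty [OF that] Pos_point [OF that] by (force simp: SF_def)
  ultimately show ?case by (simp add: adequate_def)
next
  case (FEq s t)
  show ?case
    by (rule adequate_atom) (use FEq.prems in \<open>simp_all add: sharply_bounded.qf tval_stdm\<close>)
next
  case (FRel r ts)
  have "map (tval (stdm A) E) ts = map (tval (std A) E) ts" for A E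
    using FRel.prems by (auto simp: list_all_iff tval_stdm)
  then show ?case
    by (intro adequate_atom) (use FRel.prems in \<open>simp_all add: sharply_bounded.qf rl_stdm del: map_eq_conv\<close>)
qed (simp_all add: adequate_Neg adequate_And adequate_Or)

lemma adequate_Less: "wf_tm PVa fst t \<Longrightarrow> adequate (FLess (Var 0) (lift_tm t))"
  by (rule adequate_qf) (simp_all add: wf_lift_tm)

text \<open>The least witness below a length is found by one tree that evaluates all instances.
  Witnesses that exist separately at each point are thereby assembled into a single name.\<close>

lemma witness_name:
  assumes p: "p \<in> sharply_bounded PVa" and t: "wf_tm PVa fst t" and e: "range e \<subseteq> Nm"
  shows "\<exists>x\<in>Nm. \<forall>n A. (\<exists>a < blen (tval (std A) (\<lambda>i. e i (n, A)) t). sat (std A) (case_nat a (\<lambda>i. e i (n, A))) p) \<longrightarrow>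
    x (n, A) < blen (tval (std A) (\<lambda>i. e i (n, A)) t) \<and> sat (std A) (case_nat (x (n, A)) (\<lambda>i. e i (n, A))) p"
proof -
  let ?I = "fv_tm t \<union> {n. Suc n \<in> fv p}"
  have "{n. Suc n \<in> fv p} = Suc -` fv p" by auto
  then have "finite ?I" by (simp add: finite_fv_tm finite_fv finite_vimageI)
  then obtain c where c: "\<forall>i\<in>?I. \<forall>n. small c (size_of n) (\<lambda>A. e i (n, A))"
    using Nm_common [of ?I e] e by blast
  define l where "l = (\<lambda>E A. map (\<lambda>x. sat (std A) (case_nat x (\<lambda>i. E i A)) p) [0..<blen (tval (std A) (\<lambda>i. E i A) t)])"
  \<comment> \<open>The default 0 keeps the result bounded by the length of the list where there is
    no witness.\<close>
  define least where "least = (\<lambda>bs. if \<exists>a<length bs. bs ! a then LEAST a. a < length bs \<and> bs ! a else 0)"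
  obtain d where d: "\<forall>N\<ge>2. \<forall>E. (\<forall>i\<in>?I. small c N (E i)) \<longrightarrow> (\<lambda>A. least (l E A)) \<in> dtree (N ^ d)"
    unfolding l_def using dtree_sat_quantifier [OF dtree_sat [OF p] t, of c least] by blast
  obtain d' where d': "\<forall>N\<ge>2. \<forall>E. (\<forall>i\<in>fv_tm t. small c N (E i)) \<longrightarrow> small d' N (\<lambda>A. tval (std A) (\<lambda>i. E i A) t)"
    using small_tval [OF t, of c] by blast
  let ?E = "\<lambda>n i A. e i (n, A)"
  have least: "least bs < length bs \<and> bs ! least bs" if "\<exists>a<length bs. bs ! a" for bs
    using LeastI_ex [OF that] that by (simp add: least_def)
  have le: "least bs \<le> length bs" for bs
    using least [of bs] by (cases "\<exists>a<length bs. bs ! a") (auto simp: least_def)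
  have "blen (least (l (?E n) A)) \<le> size_of n ^ max d d'" for n A
  proof -
    have "small d' (size_of n) (\<lambda>A. tval (std A) (\<lambda>i. e i (n, A)) t)" using d' c by simp
    then have "length (l (?E n) A) \<le> size_of n ^ d'" by (simp add: small_def l_def)
    also have "\<dots> \<le> size_of n ^ max d d'" by (intro power_increasing) auto
    finally show ?thesis using le [of "l (?E n) A"] le_blen [of "least (l (?E n) A)"] by linarith
  qed
  moreover have "(\<lambda>A. least (l (?E n) A)) \<in> dtree (size_of n ^ max d d')" for n
  proof (rule dtree_mono)
    show "(\<lambda>A. least (l (?E n) A)) \<in> dtree (size_of n ^ d)" using d c by simp
    show "size_of n ^ d \<le> size_of n ^ max d d'" by (intro power_increasing) auto
  qed
  ultimately have "(\<lambda>(n, A). least (l (?E n) A)) \<in> Nm" by (auto simp: Nm_def small_def)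
  moreover have "least (l (?E n) A) < blen (tval (std A) (\<lambda>i. e i (n, A)) t) \<and>
      sat (std A) (case_nat (least (l (?E n) A)) (\<lambda>i. e i (n, A))) p"
    if "\<exists>a < blen (tval (std A) (\<lambda>i. e i (n, A)) t). sat (std A) (case_nat a (\<lambda>i. e i (n, A))) p" for n A
  proof -
    have len: "length (l (?E n) A) = blen (tval (std A) (\<lambda>i. e i (n, A)) t)" by (simp add: l_def)
    have nth: "l (?E n) A ! a = sat (std A) (case_nat a (\<lambda>i. e i (n, A))) p"
      if "a < blen (tval (std A) (\<lambda>i. e i (n, A)) t)" for a
      using that by (simp add: l_def)
    have "\<exists>a<length (l (?E n) A). l (?E n) A ! a" using that nth len by auto
    from least [OF this] show ?thesis using nth [of "least (l (?E n) A)"] len by simp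
  qed
  ultimately show ?thesis by (intro bexI [of _ "\<lambda>(n, A). least (l (?E n) A)"]) auto
qed

lemma range_case_nat: "x \<in> Nm \<Longrightarrow> range e \<subseteq> Nm \<Longrightarrow> range (case_nat x e) \<subseteq> Nm"
  by (auto simp: range_subsetD split: nat.splits)

lemma adequate_sharp: "p \<in> sharply_bounded PVa \<Longrightarrow> adequate p"
proof (induction rule: sharply_bounded.induct)
  case (Ex p t g)
  let ?t = "Fn g [t]"
  have wf: "wf_tm PVa fst ?t" by (rule wf_len_tm [OF Ex.hyps(2,3)])
  let ?r = "FAnd (FLess (Var 0) (lift_tm ?t)) p"
  have r: "adequate ?r" using adequate_And [OF adequate_Less [OF wf] Ex.IH] .
  have ex: "ex_less ?t p = FEx ?r" by (simp add: ex_less_def)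
  have "forces P e (FEx ?r)" if P: "P \<in> Pos" "range e \<subseteq> Nm" "SF P e (FEx ?r)" for P e
  proof -
    obtain x where x: "x \<in> Nm" "\<And>n A. \<exists>a < blen (tval (std A) (\<lambda>i. e i (n, A)) t). sat (std A) (case_nat a (\<lambda>i. e i (n, A))) p \<Longrightarrow>
        x (n, A) < blen (tval (std A) (\<lambda>i. e i (n, A)) t) \<and> sat (std A) (case_nat (x (n, A)) (\<lambda>i. e i (n, A))) p"
      using witness_name [OF Ex.hyps(1,2) P(2)] by blast
    have "sat (std A) (\<lambda>i. case_nat x e i (n, A)) ?r" if "(n, A) \<in> pts P" for n A
    proof -
      have "sat (std A) (\<lambda>i. e i (n, A)) (ex_less ?t p)" using P(3) that unfolding ex SF_def by blast
      then show ?thesis unfolding sat_ex_less tval_len [OF Ex.hyps(3)] case_nat_at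
        using x(2) [of A n] tval_len [OF Ex.hyps(3)] by (simp del: tval.simps(2))
    qed
    then have "SF P (case_nat x e) ?r" by (auto simp: SF_def)
    then have "forces P (case_nat x e) ?r"
      by (rule adequate_pos [OF r P(1) range_case_nat [OF x(1) P(2)]])
    then show ?thesis unfolding forces.simps(8) using x(1) forces_mono by (blast intro: dense_below_always)
  qed
  moreover have "\<not> forces Q e (FEx ?r)"
    if e: "range e \<subseteq> Nm" and P: "SF P e (FNeg (FEx ?r))" "Q \<in> below P" for P Q e
  proof
    assume "forces Q e (FEx ?r)"
    then obtain R x where R: "R \<in> below Q" "x \<in> Nm" "forces R (case_nat x e) ?r"
      unfolding forces.simps(8) using dense_belowD below_self [OF P(2)] by blast
    have "SF P (case_nat x e) (FNeg ?r)" using P(1) unfolding SF_def case_nat_at by auto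
    then show False
      using adequate_neg [OF r range_case_nat [OF R(2) e]] below_trans [OF R(1) P(2)] R(3) by blast
  qed
  ultimately show ?case unfolding ex adequate_def
    using sharply_bounded.Ex [OF Ex.hyps] unfolding ex forces.simps(4) by blast
next
  case (All p t g)
  let ?t = "Fn g [t]"
  have wf: "wf_tm PVa fst ?t" by (rule wf_len_tm [OF All.hyps(2,3)])
  let ?r = "FImp (FLess (Var 0) (lift_tm ?t)) p"
  have r: "adequate ?r" using adequate_Or [OF adequate_Neg [OF adequate_Less [OF wf]] All.IH] .
  have all: "all_less ?t p = FAll ?r" by (simp add: all_less_def)
  have "forces P e (FAll ?r)" if P: "P \<in> Pos" "range e \<subseteq> Nm" "SF P e (FAll ?r)" for P e
  proof -
    have "SF P (case_nat x e) ?r" for x using P(3) unfolding SF_def case_nat_at by auto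
    then show ?thesis unfolding forces.simps(7)
      using adequate_pos [OF r P(1) range_case_nat [OF _ P(2)]] by blast
  qed
  moreover have "\<not> forces Q e (FAll ?r)"
    if e: "range e \<subseteq> Nm" and P: "SF P e (FNeg (FAll ?r))" "Q \<in> below P" for P Q e
  proof
    assume Q: "forces Q e (FAll ?r)"
    \<comment> \<open>A name for counterexamples, obtained from the negation of p, instantiates the
      universal formula assumed to be forced.\<close>
    obtain x where x: "x \<in> Nm" "\<And>n A. \<exists>a < blen (tval (std A) (\<lambda>i. e i (n, A)) t). sat (std A) (case_nat a (\<lambda>i. e i (n, A))) (FNeg p) \<Longrightarrow>
        x (n, A) < blen (tval (std A) (\<lambda>i. e i (n, A)) t) \<and> sat (std A) (case_nat (x (n, A)) (\<lambda>i. e i (n, A))) (FNeg p)"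
      using witness_name [OF sharply_bounded.Neg [OF All.hyps(1)] All.hyps(2) e] by blast
    have "sat (std A) (\<lambda>i. case_nat x e i (n, A)) (FNeg ?r)" if "(n, A) \<in> pts P" for n A
    proof -
      have "\<not> sat (std A) (\<lambda>i. e i (n, A)) (all_less ?t p)" using P(1) that unfolding all SF_def by auto
      then show ?thesis unfolding sat_all_less tval_len [OF All.hyps(3)] case_nat_at
        using x(2) [of A n] tval_len [OF All.hyps(3)] by (auto simp del: tval.simps(2))
    qed
    then have "SF P (case_nat x e) (FNeg ?r)" by (auto simp: SF_def)
    moreover have "forces Q (case_nat x e) ?r" using Q x(1) by simp
    ultimately show False using adequate_neg [OF r range_case_nat [OF x(1) e]] P(2) by blast
  qed
  ultimately show ?case unfolding all adequate_def
    using sharply_bounded.All [OF All.hyps] unfolding all forces.simps(4) by blast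
qed (auto intro: adequate_qf adequate_Neg adequate_And adequate_Or)

lemma SF_forces:
  "p \<in> sharply_bounded PVa \<Longrightarrow> P \<in> Pos \<Longrightarrow> range e \<subseteq> Nm \<Longrightarrow> SF P e p \<Longrightarrow> forces P e p"
  by (rule adequate_pos [OF adequate_sharp])

lemma forces_SF:
  "p \<in> sharply_bounded PVa \<Longrightarrow> P \<in> Pos \<Longrightarrow> range e \<subseteq> Nm \<Longrightarrow> forces P e p \<Longrightarrow> \<exists>Q\<in>below P. SF Q e p"
  by (rule adequate_forces [OF adequate_sharp])

lemma models_FAll: "models (std A) ((FAll ^^ n) p) \<Longrightarrow> sat (std A) e p"
proof (induction n arbitrary: p e)
  case 0
  then show ?case by (simp add: models_def)
next
  case (Suc n)
  have "models (std A) ((FAll ^^ n) (FAll p))" using Suc.prems by (simp add: funpow_swap1)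
  from Suc.IH [OF this, of "\<lambda>i. e (Suc i)"] have "sat (std A) (\<lambda>i. e (Suc i)) (FAll p)" .
  then have "sat (std A) (case_nat (e 0) (\<lambda>i. e (Suc i))) p" by simp
  moreover have "case_nat (e 0) (\<lambda>i. e (Suc i)) = e" by (auto simp: fun_eq_iff split: nat.splits)
  ultimately show ?case by simp
qed

text \<open>The matrix is true with every oracle, in particular at every point, and quantifier-free
  formulas are adequate.\<close>

lemma forces_all_PVa:
  assumes "p \<in> all_PVa" "P \<in> Pos" "range e \<subseteq> Nm"
  shows "forces P e p"
proof -
  obtain n q where q: "p = (FAll ^^ n) q" "quantifier_free q" "wf_pfm PVa q" "\<And>A. models (std A) p"
    using assms(1) by (auto simp: all_PVa_def)
  have "forces P e q" if "range e \<subseteq> Nm" for e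
    by (rule SF_forces [OF sharply_bounded.qf [OF q(2,3)] assms(2) that])
      (use models_FAll [OF q(4) [unfolded q(1)]] in \<open>auto simp: SF_def\<close>)
  then show ?thesis unfolding q(1) using forces_FAll_funpow assms(3) by blast
qed

end


section \<open>Certificates of bounded existential formulas\<close>

lemma sharply_bounded_AndD: "FAnd p q \<in> sharply_bounded F \<Longrightarrow> p \<in> sharply_bounded F \<and> q \<in> sharply_bounded F"
  by (erule sharply_bounded.cases)
    (auto simp: ex_less_def all_less_def intro: sharply_bounded.qf)

lemma sharply_bounded_OrD: "FOr p q \<in> sharply_bounded F \<Longrightarrow> p \<in> sharply_bounded F \<and> q \<in> sharply_bounded F"
  by (erule sharply_bounded.cases)
    (auto simp: ex_less_def all_less_def intro: sharply_bounded.qf)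

text \<open>\<open>cert p E C\<close>: for the values \<open>E\<close> of the variables, the literals \<open>C\<close> decide all queries needed to verify \<open>p\<close>,
  with fixed choices for the quantifiers and disjunctions outside of sharply bounded subformulas. That all oracles
  agreeing with \<open>C\<close> satisfy \<open>p\<close> would be too weak: it does not provide witnesses.\<close>

inductive cert :: "pfm \<Rightarrow> (nat \<Rightarrow> nat) \<Rightarrow> (nat \<times> bool) set \<Rightarrow> bool" where
  sharp: "p \<in> sharply_bounded PVa \<Longrightarrow> (\<And>A. agree C A \<Longrightarrow> sat (std A) E p) \<Longrightarrow> cert p E C"
| And: "cert p E C \<Longrightarrow> cert q E C \<Longrightarrow> cert (FAnd p q) E C"
| Or1: "cert p E C \<Longrightarrow> cert (FOr p q) E C"
| Or2: "cert q E C \<Longrightarrow> cert (FOr p q) E C"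
| Ex: "cert p (case_nat a E) C \<Longrightarrow> cert (FEx p) E C"
| All: "(\<And>a. cert p (case_nat a E) C) \<Longrightarrow> cert (FAll p) E C"

lemma cert_mono: "cert p E C \<Longrightarrow> C \<subseteq> D \<Longrightarrow> cert p E D"
  by (induction rule: cert.induct) (auto intro: cert.intros agree_mono)

lemma cert_sat: "cert p E C \<Longrightarrow> agree C A \<Longrightarrow> sat (std A) E p"
  by (induction rule: cert.induct) auto

text \<open>If a conjunction is sharply bounded, both conjuncts hold with all agreeing oracles. For
  a disjunction or an existential formula, truth with all these oracles does not single out one
  choice, hence the side condition in the following inversions.\<close>

lemma cert_AndD: "cert (FAnd p q) E C \<Longrightarrow> cert p E C \<and> cert q E C"
  by (erule cert.cases) (auto dest: sharply_bounded_AndD intro: cert.sharp)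

lemma cert_OrD: "cert (FOr p q) E C \<Longrightarrow> FOr p q \<notin> sharply_bounded PVa \<Longrightarrow> cert p E C \<or> cert q E C"
  by (erule cert.cases) auto

lemma cert_ExD: "cert (FEx p) E C \<Longrightarrow> FEx p \<notin> sharply_bounded PVa \<Longrightarrow> \<exists>a. cert p (case_nat a E) C"
  by (erule cert.cases) auto

lemma cert_AllD: "cert (FAll p) E C \<Longrightarrow> FAll p \<notin> sharply_bounded PVa \<Longrightarrow> cert p (case_nat a E) C"
  by (erule cert.cases) auto

lemma sharply_bounded_Less:
  assumes "wf_tm PVa fst t"
  shows "FLess (Var 0) (lift_tm t) \<in> sharply_bounded PVa"
  by (rule sharply_bounded.qf) (use assms in \<open>simp_all add: wf_lift_tm\<close>)

context infinite_structure
begin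

section \<open>Certificates contained in a condition imply forcing\<close>

definition decided :: "'a condition \<Rightarrow> (nat \<Rightarrow> nat \<times> nat set \<Rightarrow> nat) \<Rightarrow>
    nat set \<Rightarrow> (nat \<Rightarrow> nat \<Rightarrow> nat) \<Rightarrow> bool" where
  "decided P e I E \<longleftrightarrow> (\<forall>i\<in>I. \<forall>(n, A)\<in>pts P. e i (n, A) = E n i)"

lemma decided_mono: "decided P e I E \<Longrightarrow> Q \<in> below P \<Longrightarrow> J \<subseteq> I \<Longrightarrow> decided Q e J E"
  using pts_mono unfolding decided_def by blast

lemma decided_subset: "decided P e I E \<Longrightarrow> J \<subseteq> I \<Longrightarrow> decided P e J E"
  unfolding decided_def by blast

lemma decidedD: "decided P e I E \<Longrightarrow> i \<in> I \<Longrightarrow> (n, A) \<in> pts P \<Longrightarrow> e i (n, A) = E n i"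
  unfolding decided_def by blast

lemma decided_case_nat:
  assumes "decided P e I E" "\<forall>(n, A)\<in>pts P. x (n, A) = X n" "\<And>i. Suc i \<in> J \<Longrightarrow> i \<in> I"
  shows "decided P (case_nat x e) J (\<lambda>n. case_nat (X n) (E n))"
  using assms unfolding decided_def by (auto split: nat.splits)

lemma decided_sat:
  assumes "decided P e (fv p) E" "(n, A) \<in> pts P"
  shows "sat (std A) (\<lambda>i. e i (n, A)) p = sat (std A) (E n) p"
  by (rule sat_cong) (use assms in \<open>auto dest: decidedD\<close>)

lemma decided_tval:
  assumes "decided P e (fv_tm t) E" "(n, A) \<in> pts P"
  shows "tval (std A) (\<lambda>i. e i (n, A)) t = tval (std A) (E n) t"
  by (rule tval_cong) (use assms in \<open>auto dest: decidedD\<close>)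

lemma cert_SF:
  assumes "decided P e (fv p) E" "\<And>n. n \<in> fst P \<Longrightarrow> cert p (E n) (lits n (snd P n))"
  shows "SF P e p"
  unfolding SF_def
proof (clarify)
  fix n A assume "(n, A) \<in> pts P"
  then show "sat (std A) (\<lambda>i. e i (n, A)) p"
    using decided_sat [OF assms(1)] cert_sat [OF assms(2)] by (simp add: pts_def)
qed

text \<open>Each index has a point, where the dominating name bounds the length of
  \<open>a n\<close>. The default 0 is there because a name has to be short at all n, also at those
  outside of the condition.\<close>

lemma const_name:
  assumes x: "\<tau> \<in> Nm" and P: "P \<in> Pos" and a: "\<And>n A. (n, A) \<in> pts P \<Longrightarrow> a n \<le> \<tau> (n, A)"
  shows "(\<lambda>(n, A). if n \<in> fst P then a n else 0) \<in> Nm"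
proof -
  obtain c where c: "\<And>n. small c (size_of n) (\<lambda>A. \<tau> (n, A))" using x by (auto simp: Nm_def)
  show ?thesis
  proof (rule Nm_const)
    show "blen (if n \<in> fst P then a n else 0) \<le> size_of n ^ c" for n
    proof (cases "n \<in> fst P")
      case True
      then obtain A where "(n, A) \<in> pts P" using Pos_point [OF P] by blast
      then have "blen (a n) \<le> blen (\<tau> (n, A))" by (intro floorlog_mono a)
      also have "\<dots> \<le> size_of n ^ c" using c by (simp add: small_def)
      finally show ?thesis using True by simp
    qed (simp add: floorlog_def)
  qed
qed

lemma tname_stdm: "wf_tm PVa fst t \<Longrightarrow> tname e t (n, A) = tval (std A) (\<lambda>i. e i (n, A)) t"
  by (simp add: tname_def St_def tval_stdm)

lemma cert_forces_Ex:
  assumes IH: "\<And>P e E. P \<in> Pos \<Longrightarrow> range e \<subseteq> Nm \<Longrightarrow> decided P e (fv p) E \<Longrightarrow>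
      (\<And>n. n \<in> fst P \<Longrightarrow> cert p (E n) (lits n (snd P n))) \<Longrightarrow> forces P e p"
    and t: "wf_tm PVa fst t" and P: "P \<in> Pos" and e: "range e \<subseteq> Nm"
    and E: "decided P e (fv (ex_less t p)) E"
    and cert: "\<And>n. n \<in> fst P \<Longrightarrow> cert (ex_less t p) (E n) (lits n (snd P n))"
  shows "forces P e (ex_less t p)"
proof (cases "ex_less t p \<in> sharply_bounded PVa")
  case True
  from SF_forces [OF True P e cert_SF [OF E cert]] show ?thesis .
next
  case False
  let ?L = "FLess (Var 0) (lift_tm t)"
  have "\<exists>a. cert ?L (case_nat a (E n)) (lits n (snd P n)) \<and> cert p (case_nat a (E n)) (lits n (snd P n))"
    if "n \<in> fst P" for n
    using cert_ExD cert_AndD cert [OF that] False unfolding ex_less_def by blast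
  then obtain a where a: "\<And>n. n \<in> fst P \<Longrightarrow> cert ?L (case_nat (a n) (E n)) (lits n (snd P n))"
    "\<And>n. n \<in> fst P \<Longrightarrow> cert p (case_nat (a n) (E n)) (lits n (snd P n))" by metis
  let ?x = "\<lambda>(n, A). if n \<in> fst P then a n else (0::nat)"
  have dec: "decided P (case_nat ?x e) J (\<lambda>n. case_nat (a n) (E n))"
    if "\<And>i. Suc i \<in> J \<Longrightarrow> i \<in> fv (ex_less t p)" for J
    by (rule decided_case_nat [OF E _ that]) (auto simp: pts_def)
  have lt: "SF P (case_nat ?x e) ?L"
    by (rule cert_SF [OF dec a(1)]) (auto simp: fv_lift_tm fv_ex_less)
  have x: "?x \<in> Nm"
  proof (rule const_name [OF tname_Nm [OF e, of t] P])
    fix n A assume "(n, A) \<in> pts P"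
    then have "sat (std A) (\<lambda>i. case_nat ?x e i (n, A)) ?L" "n \<in> fst P"
      using lt unfolding SF_def pts_def by blast+
    then have "a n < tval (std A) (\<lambda>i. e i (n, A)) t" unfolding case_nat_at by simp
    then show "a n \<le> tname e t (n, A)" by (simp add: tname_stdm [OF t])
  qed
  have "forces P (case_nat ?x e) (FAnd ?L p)"
    using IH [OF P range_case_nat [OF x e] dec a(2)] SF_forces [OF sharply_bounded_Less [OF t] P range_case_nat [OF x e] lt]
    by (simp add: fv_ex_less)
  then show ?thesis unfolding ex_less_def forces.simps(8) using x forces_mono by (blast intro: dense_below_always)
qed

text \<open>The choices made by the certificates vary with n. For a disjunction the index set is
  split accordingly; for an existential quantifier the witnesses form a name since they are bounded
  by the value of a term.\<close>

lemma cert_forces: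
  assumes "p \<in> Sigma_b_1"
  shows "P \<in> Pos \<Longrightarrow> range e \<subseteq> Nm \<Longrightarrow> decided P e (fv p) E \<Longrightarrow>
    (\<And>n. n \<in> fst P \<Longrightarrow> cert p (E n) (lits n (snd P n))) \<Longrightarrow> forces P e p"
  using assms
proof (induction arbitrary: P e E rule: Sigma_b_1.induct)
  case (sharp p)
  show ?case by (rule SF_forces [OF sharp.hyps sharp.prems(1,2) cert_SF [OF sharp.prems(3,4)]])
next
  case (And p q)
  have "forces P e p"
    by (rule And.IH(1) [OF And.prems(1,2) decided_subset [OF And.prems(3)]])
      (use cert_AndD [OF And.prems(4)] in simp_all)
  moreover have "forces P e q"
    by (rule And.IH(2) [OF And.prems(1,2) decided_subset [OF And.prems(3)]])
      (use cert_AndD [OF And.prems(4)] in simp_all)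
  ultimately show ?case by simp
next
  case (Or p q)
  show ?case
  proof (cases "FOr p q \<in> sharply_bounded PVa")
    case True
    from SF_forces [OF True Or.prems(1,2) cert_SF [OF Or.prems(3,4)]] show ?thesis .
  next
    case False
    have "\<exists>R\<in>below Q. forces R e p \<or> forces R e q" if Q: "Q \<in> below P" for Q
    proof -
      have dec: "decided R e (fv p) E" "decided R e (fv q) E" if "R \<in> below Q" for R
        using decided_mono [OF Or.prems(3)] below_trans [OF that Q] by simp_all
      have cQ: "cert p (E n) (lits n (snd Q n)) \<or> cert q (E n) (lits n (snd Q n))" if "n \<in> fst Q" for n
        using cert_OrD [OF Or.prems(4) [OF below_fst [OF Q that]] False] cert_mono below_lits [OF Q that] by blast
      show ?thesis
      proof (rule below_split [OF below_Pos [OF Q] cQ])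
        fix R assume R: "R \<in> below Q" "\<forall>n\<in>fst R. cert p (E n) (lits n (snd Q n))"
        have "forces R e p"
          by (rule Or.IH(1) [OF below_Pos [OF R(1)] Or.prems(2) dec(1) [OF R(1)]])
            (use R cert_mono below_lits in blast)
        then show ?thesis using R by blast
      next
        fix R assume R: "R \<in> below Q" "\<forall>n\<in>fst R. cert q (E n) (lits n (snd Q n))"
        have "forces R e q"
          by (rule Or.IH(2) [OF below_Pos [OF R(1)] Or.prems(2) dec(2) [OF R(1)]])
            (use R cert_mono below_lits in blast)
        then show ?thesis using R by blast
      qed
    qed
    then show ?thesis by (simp add: dense_belowI)
  qed
next
  case (sharp_Ex p t g)
  have wf: "wf_tm PVa fst (Fn g [t])"
    by (rule wf_len_tm [OF sharp_Ex.hyps(2,3)])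
  show ?case by (rule cert_forces_Ex [OF sharp_Ex.IH wf sharp_Ex.prems])
next
  case (Ex p t)
  show ?case by (rule cert_forces_Ex [OF Ex.IH Ex.hyps(2) Ex.prems])
next
  case (sharp_All p t g)
  let ?t = "Fn g [t]"
  have wf: "wf_tm PVa fst ?t"
    by (rule wf_len_tm [OF sharp_All.hyps(2,3)])
  let ?L = "FLess (Var 0) (lift_tm ?t)"
  show ?case
  proof (cases "all_less ?t p \<in> sharply_bounded PVa")
    case True
    from SF_forces [OF True sharp_All.prems(1,2) cert_SF [OF sharp_All.prems(3,4)]] show ?thesis .
  next
    case False
    then have "p \<notin> sharply_bounded PVa" using sharply_bounded.All sharp_All.hyps(2,3) by blast
    then have ns: "FImp ?L p \<notin> sharply_bounded PVa" using sharply_bounded_OrD by blast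
    have c: "cert (FNeg ?L) (case_nat a (E n)) (lits n (snd P n)) \<or> cert p (case_nat a (E n)) (lits n (snd P n))"
      if "n \<in> fst P" for n a
      using cert_OrD [OF cert_AllD ns] sharp_All.prems(4) [OF that] False unfolding all_less_def by blast
    have "\<exists>R\<in>below Q. forces R (case_nat x e) (FNeg ?L) \<or> forces R (case_nat x e) p"
      if x: "x \<in> Nm" and Q: "Q \<in> below P" for x Q
    proof -
      have e': "range (case_nat x e) \<subseteq> Nm" by (rule range_case_nat [OF x sharp_All.prems(2)])
      \<comment> \<open>The certificates choose a disjunct for each number; once x has a definite
        value at each index, one choice per index remains and the index set can be split.\<close>
      obtain R X where R: "R \<in> below Q" "\<forall>(n, A)\<in>pts R. x (n, A) = X n"
        using decide_name [OF below_Pos [OF Q] x] by blast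
      have RP: "R \<in> below P" using below_trans [OF R(1) Q] .
      have dec: "decided R' (case_nat x e) J (\<lambda>n. case_nat (X n) (E n))"
        if "\<And>i. Suc i \<in> J \<Longrightarrow> i \<in> fv (all_less ?t p)" "R' \<in> below R" for J R'
        by (rule decided_case_nat [OF decided_mono [OF sharp_All.prems(3)] _ that(1)])
          (use that(2) RP R(2) below_trans pts_mono in blast)+
      have cR: "cert (FNeg ?L) (case_nat (X n) (E n)) (lits n (snd R n)) \<or> cert p (case_nat (X n) (E n)) (lits n (snd R n))"
        if "n \<in> fst R" for n
        using c [OF below_fst [OF RP that]] cert_mono below_lits [OF RP that] by blast
      show ?thesis
      proof (rule below_split [OF below_Pos [OF R(1)] cR])
        fix R' assume R': "R' \<in> below R" "\<forall>n\<in>fst R'. cert (FNeg ?L) (case_nat (X n) (E n)) (lits n (snd R n))"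
        have "cert (FNeg ?L) (case_nat (X n) (E n)) (lits n (snd R' n))" if "n \<in> fst R'" for n
          using R'(2) cert_mono below_lits [OF R'(1) that] that by blast
        then have "SF R' (case_nat x e) (FNeg ?L)"
          by (intro cert_SF [OF dec [OF _ R'(1)]]) (auto simp: fv_lift_tm fv_all_less)
        then have "forces R' (case_nat x e) (FNeg ?L)"
          by (rule SF_forces [OF sharply_bounded.Neg [OF sharply_bounded_Less [OF wf]] below_Pos [OF R'(1)] e'])
        then show ?thesis using below_trans [OF R'(1) R(1)] by blast
      next
        fix R' assume R': "R' \<in> below R" "\<forall>n\<in>fst R'. cert p (case_nat (X n) (E n)) (lits n (snd R n))"
        have "cert p (case_nat (X n) (E n)) (lits n (snd R' n))" if "n \<in> fst R'" for n
          using R'(2) cert_mono below_lits [OF R'(1) that] that by blast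
        then have "forces R' (case_nat x e) p"
          by (intro sharp_All.IH [OF below_Pos [OF R'(1)] e' dec [OF _ R'(1)]]) (auto simp: fv_all_less)
        then show ?thesis using below_trans [OF R'(1) R(1)] by blast
      qed
    qed
    then show ?thesis unfolding all_less_def forces.simps(6,7) by (intro ballI dense_belowI) blast
  qed
qed

section \<open>Forced formulas have certificates of uniformly polynomial size\<close>

definition bounded_on :: "nat \<Rightarrow> nat set \<Rightarrow> nat set \<Rightarrow> (nat \<Rightarrow> nat \<Rightarrow> nat) \<Rightarrow> bool" where
  "bounded_on c X I E \<longleftrightarrow> (\<forall>n\<in>X. \<forall>i\<in>I. blen (E n i) \<le> size_of n ^ c)"

lemma bounded_on_mono: "bounded_on c X I E \<Longrightarrow> X' \<subseteq> X \<Longrightarrow> I' \<subseteq> I \<Longrightarrow> bounded_on c X' I' E"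
  by (auto simp: bounded_on_def)

lemma bounded_on_case_nat:
  assumes "bounded_on c X I E" "\<And>n. n \<in> X \<Longrightarrow> blen (a n) \<le> size_of n ^ c'" "\<And>i. Suc i \<in> J \<Longrightarrow> i \<in> I"
  shows "bounded_on (max c c') X J (\<lambda>n. case_nat (a n) (E n))"
proof -
  have "blen (case_nat (a n) (E n) i) \<le> size_of n ^ max c c'" if "n \<in> X" "i \<in> J" for n i
  proof -
    have "size_of n ^ c \<le> size_of n ^ max c c'" "size_of n ^ c' \<le> size_of n ^ max c c'"
      by (intro power_increasing; simp)+
    moreover have "blen (case_nat (a n) (E n) i) \<le> size_of n ^ c \<or> blen (case_nat (a n) (E n) i) \<le> size_of n ^ c'"
      using assms that by (cases i) (auto simp: bounded_on_def)
    ultimately show ?thesis by linarith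
  qed
  then show ?thesis by (simp add: bounded_on_def)
qed

definition certified :: "nat \<Rightarrow> nat \<Rightarrow> 'a naming \<Rightarrow> pfm \<Rightarrow> (nat \<Rightarrow> nat) \<Rightarrow> bool" where
  "certified d n q p E \<longleftrightarrow> (\<exists>C\<subseteq>lits n q. finite C \<and> card C \<le> size_of n ^ d \<and> cert p E C)"

text \<open>However large the given extension is, the old names together with those supporting C are
  enough. The cost in names thus depends only on the number of literals.\<close>

lemma ext_small:
  assumes "cond n q'" "ext n q' q" "C \<subseteq> lits n q'" "finite C" "card C \<le> k"
  shows "\<exists>s. cond n s \<and> ext n s q \<and> card (fst s) \<le> card (fst q) + k * width \<and> C \<subseteq> lits n s"
proof -
  obtain K h K' h' where q: "q = (K, h)" "q' = (K', h')" by fastforce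
  obtain D where D: "D \<subseteq> K'" "finite D" "card D \<le> card C * width" "C \<subseteq> lits n (D, h')"
    using lits_local [OF assms(4) assms(3) [unfolded q]] by blast
  have K: "K \<subseteq> K'" using assms(2) by (simp add: ext_def q)
  have "card (K \<union> D) \<le> card K + card D" by (rule card_Un_le)
  also have "\<dots> \<le> card K + k * width" using D(3) mult_right_mono [OF assms(5), of width] by linarith
  finally have "card (K \<union> D) \<le> card K + k * width" .
  moreover have "cond n (K \<union> D, h')" using cond_restrict assms(1) K D(1) unfolding q by blast
  moreover have "ext n (K \<union> D, h') (K, h)" using ext_restrict assms(2) K D(1) unfolding q by blast
  moreover have "C \<subseteq> lits n (K \<union> D, h')" using D(4) lits_mono [of D "K \<union> D"] by blast
  ultimately show ?thesis unfolding q by (intro exI [of _ "(K \<union> D, h')"]) simp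
qed

text \<open>Certificates speak about the decided values \<open>E n\<close>, so terms are evaluated
  at these constants and not at the names.\<close>

lemma decide_const_tval:
  assumes "wf_tm PVa fst t"
  shows "\<exists>d. \<forall>P\<in>Pos. \<forall>E. bounded_on c (fst P) (fv_tm t) E \<longrightarrow> (\<exists>Q\<in>below P. \<exists>v C. \<forall>n\<in>fst Q.
    C n \<subseteq> lits n (snd Q n) \<and> finite (C n) \<and> card (C n) \<le> size_of n ^ d \<and> blen (v n) \<le> size_of n ^ d \<and>
    (\<forall>A. agree (C n) A \<longrightarrow> tval (std A) (E n) t = v n))"
proof -
  obtain d1 where d1: "\<forall>N\<ge>2. \<forall>E. (\<forall>i\<in>fv_tm t. small c N (E i)) \<longrightarrow> small d1 N (\<lambda>A. tval (std A) (\<lambda>i. E i A) t)"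
    using small_tval [OF assms, of c] by blast
  have "\<exists>Q\<in>below P. \<exists>v C. \<forall>n\<in>fst Q. C n \<subseteq> lits n (snd Q n) \<and> finite (C n) \<and> card (C n) \<le> size_of n ^ d1 \<and>
      blen (v n) \<le> size_of n ^ d1 \<and> (\<forall>A. agree (C n) A \<longrightarrow> tval (std A) (E n) t = v n)"
    if P: "P \<in> Pos" "bounded_on c (fst P) (fv_tm t) E" for P E
  proof -
    have small: "small d1 (size_of n) (\<lambda>A. tval (std A) (E n) t)" if "n \<in> fst P" for n
      using d1 [rule_format, of "size_of n" "\<lambda>i A. E n i"] that P(2)
      by (simp add: bounded_on_def small_def)
    obtain Q v C where Q: "Q \<in> below P" "\<forall>n\<in>fst Q. C n \<subseteq> lits n (snd Q n) \<and> finite (C n) \<and>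
        card (C n) \<le> size_of n ^ d1 \<and> (\<forall>A. agree (C n) A \<longrightarrow> tval (std A) (E n) t = v n)"
      using decide [OF P(1), of "\<lambda>n A. tval (std A) (E n) t" d1] small unfolding small_def by blast
    have "blen (v n) \<le> size_of n ^ d1" if n: "n \<in> fst Q" for n
    proof -
      obtain A where "agree (lits n (snd Q n)) A" using agree_exists Pos_cond below_Pos Q(1) n by blast
      then have "tval (std A) (E n) t = v n" using Q(2) n agree_mono by blast
      then show ?thesis using small [OF below_fst [OF Q(1) n]] unfolding small_def by metis
    qed
    then show ?thesis using Q by blast
  qed
  then show ?thesis by blast
qed

lemma decide_const_sat:
  assumes "p \<in> sharply_bounded PVa"
  shows "\<exists>d. \<forall>P\<in>Pos. \<forall>E. bounded_on c (fst P) (fv p) E \<longrightarrow> (\<exists>Q\<in>below P. \<exists>v C. \<forall>n\<in>fst Q.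
    C n \<subseteq> lits n (snd Q n) \<and> finite (C n) \<and> card (C n) \<le> size_of n ^ d \<and>
    (\<forall>A. agree (C n) A \<longrightarrow> sat (std A) (E n) p = v n))"
proof -
  obtain d where d: "\<forall>N\<ge>2. \<forall>E. fv_small c p N E \<longrightarrow> (\<lambda>A. sat (std A) (\<lambda>i. E i A) p) \<in> dtree (N ^ d)"
    using dtree_sat [OF assms, of c] by blast
  have "\<exists>Q\<in>below P. \<exists>v C. \<forall>n\<in>fst Q. C n \<subseteq> lits n (snd Q n) \<and> finite (C n) \<and> card (C n) \<le> size_of n ^ d \<and>
      (\<forall>A. agree (C n) A \<longrightarrow> sat (std A) (E n) p = v n)"
    if P: "P \<in> Pos" "bounded_on c (fst P) (fv p) E" for P E
  proof (rule decide [OF P(1)])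
    show "(\<lambda>A. sat (std A) (E n) p) \<in> dtree (size_of n ^ d)" if "n \<in> fst P" for n
      using d [rule_format, of "size_of n" "\<lambda>i A. E n i"] that P(2)
      by (simp add: bounded_on_def small_def fv_small_def)
  qed
  then show ?thesis by blast
qed

text \<open>The exponent d is fixed before the condition and the parameters, and c bounds only the
  lengths of the parameters. The same d therefore serves all smaller values of the minimized
  variable and all conditions.\<close>

definition forces_certified :: "pfm \<Rightarrow> nat \<Rightarrow> nat \<Rightarrow> bool" where
  "forces_certified p c d \<longleftrightarrow> (\<forall>P e E. P \<in> Pos \<longrightarrow> range e \<subseteq> Nm \<longrightarrow> decided P e (fv p) E \<longrightarrow>
     bounded_on c (fst P) (fv p) E \<longrightarrow> forces P e p \<longrightarrow>
     (\<exists>Q\<in>below P. \<forall>n\<in>fst Q. certified d n (snd Q n) p (E n)))"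

lemma forces_certifiedD:
  assumes "forces_certified p c d" "P \<in> Pos" "range e \<subseteq> Nm" "decided P e (fv p) E"
    "bounded_on c (fst P) (fv p) E" "forces P e p"
  obtains Q where "Q \<in> below P" "\<And>n. n \<in> fst Q \<Longrightarrow> certified d n (snd Q n) p (E n)"
proof -
  have "\<exists>Q\<in>below P. \<forall>n\<in>fst Q. certified d n (snd Q n) p (E n)"
    by (rule assms(1) [unfolded forces_certified_def, rule_format, OF assms(2-6)])
  then show thesis using that by blast
qed

lemma certified_weaken:
  assumes "certified d n q p E" "d \<le> d'"
  shows "certified d' n q p E"
proof -
  have "size_of n ^ d \<le> size_of n ^ d'" using assms(2) by (intro power_increasing) auto
  then show ?thesis using assms(1) unfolding certified_def by (meson order_trans)
qed

lemma below_fst_subset: "Q \<in> below P \<Longrightarrow> fst Q \<subseteq> fst P"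
  by (simp add: below_def)

lemma forces_certified_sharp:
  assumes "p \<in> sharply_bounded PVa"
  shows "\<exists>d. forces_certified p c d"
proof -
  from decide_const_sat [OF assms, of c]
  obtain d where d: "\<forall>P\<in>Pos. \<forall>E. bounded_on c (fst P) (fv p) E \<longrightarrow> (\<exists>Q\<in>below P. \<exists>v C. \<forall>n\<in>fst Q.
    C n \<subseteq> lits n (snd Q n) \<and> finite (C n) \<and> card (C n) \<le> size_of n ^ d \<and>
    (\<forall>A. agree (C n) A \<longrightarrow> sat (std A) (E n) p = v n))" ..
  have "\<exists>Q\<in>below P. \<forall>n\<in>fst Q. certified d n (snd Q n) p (E n)"
    if P: "P \<in> Pos" "range e \<subseteq> Nm" "decided P e (fv p) E" "bounded_on c (fst P) (fv p) E" "forces P e p" for P e E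
  proof -
    obtain R where R: "R \<in> below P" "SF R e p" using forces_SF [OF assms P(1,2,5)] by blast
    obtain Q v C where Q: "Q \<in> below R" "\<forall>n\<in>fst Q. C n \<subseteq> lits n (snd Q n) \<and> finite (C n) \<and>
        card (C n) \<le> size_of n ^ d \<and> (\<forall>A. agree (C n) A \<longrightarrow> sat (std A) (E n) p = v n)"
      using d [rule_format, OF below_Pos [OF R(1)] bounded_on_mono [OF P(4) below_fst_subset [OF R(1)] order_refl]] by blast
    have QP: "Q \<in> below P" using below_trans [OF Q(1) R(1)] .
    have "certified d n (snd Q n) p (E n)" if n: "n \<in> fst Q" for n
    proof -
      obtain A where A: "(n, A) \<in> pts Q" using Pos_point [OF below_Pos [OF QP] n] by blast
      have "sat (std A) (\<lambda>i. e i (n, A)) p" using SF_mono [OF R(2) Q(1)] A unfolding SF_def by blast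
      then have "sat (std A) (E n) p" using decided_sat [OF decided_mono [OF P(3) QP order_refl] A] by simp
      moreover have "agree (C n) A" using A Q(2) n agree_mono unfolding pts_def by blast
      ultimately have "v n" using Q(2) n by blast
      then have "cert p (E n) (C n)" using Q(2) n by (intro cert.sharp [OF assms]) blast
      then show ?thesis using Q(2) n unfolding certified_def by blast
    qed
    then show ?thesis using QP by blast
  qed
  then show ?thesis unfolding forces_certified_def by blast
qed

lemma forces_certified_And:
  assumes "forces_certified p c d1" "forces_certified q c d2"
  shows "\<exists>d. forces_certified (FAnd p q) c d"
proof -
  have "poly_bounded (\<lambda>N. N ^ d1 + N ^ d2)" by (intro poly_bounded_add poly_bounded_power)
  then obtain d where d: "\<forall>N::nat\<ge>2. N ^ d1 + N ^ d2 \<le> N ^ d" unfolding poly_bounded_def by blast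
  have "\<exists>Q\<in>below P. \<forall>n\<in>fst Q. certified d n (snd Q n) (FAnd p q) (E n)"
    if P: "P \<in> Pos" "range e \<subseteq> Nm" "decided P e (fv (FAnd p q)) E" "bounded_on c (fst P) (fv (FAnd p q)) E"
      "forces P e (FAnd p q)" for P e E
  proof -
    have f: "forces P e p" "forces P e q" using P(5) by simp_all
    obtain R where R: "R \<in> below P" "\<And>n. n \<in> fst R \<Longrightarrow> certified d1 n (snd R n) p (E n)"
      by (rule forces_certifiedD [OF assms(1) P(1,2) _ _ f(1), of E])
        (use P(3,4) in \<open>auto simp: decided_def bounded_on_def\<close>)
    obtain Q where Q: "Q \<in> below R" "\<And>n. n \<in> fst Q \<Longrightarrow> certified d2 n (snd Q n) q (E n)"
      by (rule forces_certifiedD [OF assms(2) below_Pos [OF R(1)] P(2) decided_mono [OF P(3) R(1)]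
            bounded_on_mono [OF P(4) below_fst_subset [OF R(1)]] forces_mono [OF f(2) R(1)]]) auto
    have "certified d n (snd Q n) (FAnd p q) (E n)" if n: "n \<in> fst Q" for n
    proof -
      obtain C where C: "C \<subseteq> lits n (snd Q n)" "finite C" "card C \<le> size_of n ^ d1" "cert p (E n) C"
        using R(2) [OF below_fst [OF Q(1) n]] below_lits [OF Q(1) n] unfolding certified_def by blast
      obtain D where D: "D \<subseteq> lits n (snd Q n)" "finite D" "card D \<le> size_of n ^ d2" "cert q (E n) D"
        using Q(2) [OF n] unfolding certified_def by blast
      have "card (C \<union> D) \<le> size_of n ^ d"
        using card_Un_le [of C D] C(3) D(3) d [rule_format, of "size_of n"] by simp
      moreover have "cert (FAnd p q) (E n) (C \<union> D)" using C(4) D(4) cert_mono by (blast intro: cert.And)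
      ultimately show ?thesis unfolding certified_def using C(1,2) D(1,2)
        by (intro exI [of _ "C \<union> D"]) simp
    qed
    then show ?thesis using below_trans [OF Q(1) R(1)] by blast
  qed
  then show ?thesis unfolding forces_certified_def by blast
qed

lemma forces_certified_Or:
  assumes "forces_certified p c d1" "forces_certified q c d2"
  shows "\<exists>d. forces_certified (FOr p q) c d"
proof -
  have "\<exists>Q\<in>below P. \<forall>n\<in>fst Q. certified (max d1 d2) n (snd Q n) (FOr p q) (E n)"
    if P: "P \<in> Pos" "range e \<subseteq> Nm" "decided P e (fv (FOr p q)) E" "bounded_on c (fst P) (fv (FOr p q)) E"
      "forces P e (FOr p q)" for P e E
  proof -
    obtain R where R: "R \<in> below P" "forces R e p \<or> forces R e q"
      using P(5) dense_belowD below_refl [OF P(1)] unfolding forces.simps by blast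
    have dec: "decided R e (fv p) E" "decided R e (fv q) E" "bounded_on c (fst R) (fv p) E" "bounded_on c (fst R) (fv q) E"
      using decided_mono [OF P(3) R(1)] bounded_on_mono [OF P(4) below_fst_subset [OF R(1)]] by auto
    from R(2) show ?thesis
    proof
      assume f: "forces R e p"
      obtain Q where Q: "Q \<in> below R" "\<And>n. n \<in> fst Q \<Longrightarrow> certified d1 n (snd Q n) p (E n)"
        by (rule forces_certifiedD [OF assms(1) below_Pos [OF R(1)] P(2) dec(1,3) f]) blast
      have "certified d1 n (snd Q n) (FOr p q) (E n)" if "n \<in> fst Q" for n
        using Q(2) [OF that] unfolding certified_def by (blast intro: cert.Or1)
      then have "\<forall>n\<in>fst Q. certified (max d1 d2) n (snd Q n) (FOr p q) (E n)"
        using certified_weaken [of d1] by (meson max.cobounded1)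
      then show ?thesis using below_trans [OF Q(1) R(1)] by blast
    next
      assume f: "forces R e q"
      obtain Q where Q: "Q \<in> below R" "\<And>n. n \<in> fst Q \<Longrightarrow> certified d2 n (snd Q n) q (E n)"
        by (rule forces_certifiedD [OF assms(2) below_Pos [OF R(1)] P(2) dec(2,4) f]) blast
      have "certified d2 n (snd Q n) (FOr p q) (E n)" if "n \<in> fst Q" for n
        using Q(2) [OF that] unfolding certified_def by (blast intro: cert.Or2)
      then have "\<forall>n\<in>fst Q. certified (max d1 d2) n (snd Q n) (FOr p q) (E n)"
        using certified_weaken [of d2] by (meson max.cobounded2)
      then show ?thesis using below_trans [OF Q(1) R(1)] by blast
    qed
  qed
  then show ?thesis unfolding forces_certified_def by blast
qed

lemma forces_certified_Ex:
  assumes IH: "\<And>c. \<exists>d. forces_certified p c d" and t: "wf_tm PVa fst t"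
  shows "\<exists>d. forces_certified (ex_less t p) c d"
proof -
  let ?L = "FLess (Var 0) (lift_tm t)"
  from decide_const_tval [OF t, of c]
  obtain c1 where c1: "\<forall>P\<in>Pos. \<forall>E. bounded_on c (fst P) (fv_tm t) E \<longrightarrow> (\<exists>Q\<in>below P. \<exists>v C. \<forall>n\<in>fst Q.
    C n \<subseteq> lits n (snd Q n) \<and> finite (C n) \<and> card (C n) \<le> size_of n ^ c1 \<and> blen (v n) \<le> size_of n ^ c1 \<and>
    (\<forall>A. agree (C n) A \<longrightarrow> tval (std A) (E n) t = v n))" ..
  \<comment> \<open>A witness is below the value of t, so its length is bounded with exponent c1;
    the hypothesis is taken for the larger of the two bounds.\<close>
  obtain d1 where d1: "forces_certified p (max c c1) d1" using IH by blast
  have "poly_bounded (\<lambda>N. N ^ d1 + N ^ c1)" by (intro poly_bounded_add poly_bounded_power)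
  then obtain d where d: "\<forall>N::nat\<ge>2. N ^ d1 + N ^ c1 \<le> N ^ d" unfolding poly_bounded_def by blast
  have "\<exists>Q\<in>below P. \<forall>n\<in>fst Q. certified d n (snd Q n) (ex_less t p) (E n)"
    if P: "P \<in> Pos" "range e \<subseteq> Nm" "decided P e (fv (ex_less t p)) E"
      "bounded_on c (fst P) (fv (ex_less t p)) E" "forces P e (ex_less t p)" for P e E
  proof -
    obtain P1 x where P1: "P1 \<in> below P" "x \<in> Nm" "forces P1 (case_nat x e) (FAnd ?L p)"
      using P(5) dense_belowD below_refl [OF P(1)] unfolding ex_less_def forces.simps(8) by blast
    have e': "range (case_nat x e) \<subseteq> Nm" by (rule range_case_nat [OF P1(2) P(2)])
    have "forces P1 (case_nat x e) ?L" using P1(3) by (simp only: forces.simps(5))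
    from forces_SF [OF sharply_bounded_Less [OF t] below_Pos [OF P1(1)] e' this]
    obtain P2 where P2: "P2 \<in> below P1" "SF P2 (case_nat x e) ?L" by blast
    obtain P3 X where P3: "P3 \<in> below P2" "\<forall>(n, A)\<in>pts P3. x (n, A) = X n"
      using decide_name [OF below_Pos [OF P2(1)] P1(2)] by blast
    have P3P: "P3 \<in> below P" using below_trans P3(1) P2(1) P1(1) by meson
    have "bounded_on c (fst P3) (fv_tm t) E"
      by (rule bounded_on_mono [OF P(4) below_fst_subset [OF P3P]]) (simp add: fv_ex_less)
    from c1 [rule_format, OF below_Pos [OF P3(1)] this]
    obtain P4 v Ct where P4: "P4 \<in> below P3" and Ct: "\<forall>n\<in>fst P4. Ct n \<subseteq> lits n (snd P4 n) \<and> finite (Ct n) \<and>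
        card (Ct n) \<le> size_of n ^ c1 \<and> blen (v n) \<le> size_of n ^ c1 \<and>
        (\<forall>A. agree (Ct n) A \<longrightarrow> tval (std A) (E n) t = v n)" by blast
    have P4P: "P4 \<in> below P" using below_trans [OF P4 P3P] .
    have less: "X n < v n" if n: "n \<in> fst P4" for n
    proof -
      obtain A where A: "(n, A) \<in> pts P4" using Pos_point [OF below_Pos [OF P4] n] by blast
      then have A3: "(n, A) \<in> pts P3" "(n, A) \<in> pts P2" using pts_mono P4 P3(1) by blast+
      have "sat (std A) (\<lambda>i. case_nat x e i (n, A)) ?L" using P2(2) A3(2) unfolding SF_def by blast
      then have "x (n, A) < tval (std A) (\<lambda>i. e i (n, A)) t" unfolding case_nat_at by simp
      also have "\<dots> = tval (std A) (E n) t"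
        by (rule decided_tval [OF decided_mono [OF P(3) P4P] A]) (simp add: fv_ex_less)
      also have "\<dots> = v n" using A Ct n agree_mono unfolding pts_def by blast
      finally show ?thesis using P3(2) A3(1) by auto
    qed
    have dec: "decided P4 (case_nat x e) (fv p) (\<lambda>n. case_nat (X n) (E n))"
      by (rule decided_case_nat [OF decided_mono [OF P(3) P4P order_refl]])
        (use P3(2) pts_mono [OF P4] in \<open>auto simp: fv_ex_less\<close>)
    have bnd: "bounded_on (max c c1) (fst P4) (fv p) (\<lambda>n. case_nat (X n) (E n))"
    proof (rule bounded_on_case_nat [OF bounded_on_mono [OF P(4) below_fst_subset [OF P4P] order_refl]])
      show "blen (X n) \<le> size_of n ^ c1" if "n \<in> fst P4" for n
        using floorlog_mono [of "X n" "v n" 2] less [OF that] Ct that by fastforce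
    qed (simp add: fv_ex_less)
    have "P4 \<in> below P1" using below_trans P4 P3(1) P2(1) by meson
    then have "forces P4 (case_nat x e) p"
      using P1(3) forces_mono [of P1 "case_nat x e" p P4] by (simp only: forces.simps(5))
    then obtain Q where Q: "Q \<in> below P4" "\<And>n. n \<in> fst Q \<Longrightarrow> certified d1 n (snd Q n) p (case_nat (X n) (E n))"
      by (rule forces_certifiedD [OF d1 below_Pos [OF P4] e' dec bnd]) blast
    have "certified d n (snd Q n) (ex_less t p) (E n)" if n: "n \<in> fst Q" for n
    proof -
      have n4: "n \<in> fst P4" by (rule below_fst [OF Q(1) n])
      obtain C where C: "C \<subseteq> lits n (snd Q n)" "finite C" "card C \<le> size_of n ^ d1" "cert p (case_nat (X n) (E n)) C"
        using Q(2) [OF n] unfolding certified_def by blast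
      have "cert ?L (case_nat (X n) (E n)) (C \<union> Ct n)"
      proof (rule cert.sharp [OF sharply_bounded_Less [OF t]])
        fix A assume "agree (C \<union> Ct n) A"
        then have "tval (std A) (E n) t = v n" using Ct n4 agree_mono by blast
        then show "sat (std A) (case_nat (X n) (E n)) ?L" using less [OF n4] by simp
      qed
      moreover have "cert p (case_nat (X n) (E n)) (C \<union> Ct n)" using C(4) cert_mono by blast
      ultimately have "cert (ex_less t p) (E n) (C \<union> Ct n)"
        unfolding ex_less_def by (intro cert.Ex cert.And)
      moreover have "card (C \<union> Ct n) \<le> size_of n ^ d"
        using card_Un_le [of C "Ct n"] C(3) Ct n4 d [rule_format, of "size_of n"] by fastforce
      moreover have "C \<union> Ct n \<subseteq> lits n (snd Q n)" using C(1) Ct n4 below_lits [OF Q(1) n] by blast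
      moreover have "finite (C \<union> Ct n)" using C(2) Ct n4 by blast
      ultimately show ?thesis unfolding certified_def by blast
    qed
    then show ?thesis using below_trans [OF Q(1) P4P] by blast
  qed
  then show ?thesis unfolding forces_certified_def by blast
qed

text \<open>A chain that cannot be prolonged reaches the bound \<open>j\<close> of the quantifier: otherwise \<open>p\<close> is forced for the value \<open>j\<close>
  below its last condition, hence certified by some extension, and a part of this extension of the fixed size
  \<open>k * width\<close> suffices.\<close>

definition chain :: "nat \<Rightarrow> nat \<Rightarrow> 'a naming \<Rightarrow> pfm \<Rightarrow> (nat \<Rightarrow> nat) \<Rightarrow> nat \<Rightarrow> 'a naming \<Rightarrow> bool" where
  "chain n k q p E j s \<longleftrightarrow> cond n s \<and> ext n s q \<and> card (fst s) \<le> card (fst q) + j * k * width \<and>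
     (\<exists>C\<subseteq>lits n s. finite C \<and> card C \<le> j * k \<and> (\<forall>v<j. cert p (case_nat v E) C))"

lemma chain_bounds:
  "chain n k q p E j s \<Longrightarrow> cond n s \<and> ext n s q \<and> card (fst s) \<le> card (fst q) + j * k * width"
  by (simp add: chain_def)

lemma chain_0: "cond n q \<Longrightarrow> chain n k q p E 0 q"
  by (auto simp: chain_def ext_refl intro!: exI [of _ "{}"])

lemma chain_Suc:
  assumes s: "chain n k q p E j s" and q': "cond n q'" "ext n q' s"
    and C: "C \<subseteq> lits n q'" "finite C" "card C \<le> k" "cert p (case_nat j E) C"
  shows "\<exists>s'. chain n k q p E (Suc j) s'"
proof -
  obtain D where D: "D \<subseteq> lits n s" "finite D" "card D \<le> j * k" "\<forall>v<j. cert p (case_nat v E) D"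
    using s unfolding chain_def by blast
  obtain s' where s': "cond n s'" "ext n s' s" "card (fst s') \<le> card (fst s) + k * width" "C \<subseteq> lits n s'"
    using ext_small [OF q' C(1-3)] by blast
  have "card (C \<union> D) \<le> Suc j * k" using card_Un_le [of C D] C(3) D(3) by simp
  moreover have "C \<union> D \<subseteq> lits n s'" using s'(4) D(1) ext_lits [OF s'(2)] by blast
  moreover have "cert p (case_nat v E) (C \<union> D)" if "v < Suc j" for v
    using C(4) D(4) that cert_mono [of p _ C "C \<union> D"] cert_mono [of p _ D "C \<union> D"] by (auto simp: less_Suc_eq)
  moreover have "ext n s' q" using ext_trans [OF s'(2)] s unfolding chain_def by blast
  moreover have "card (fst s') \<le> card (fst q) + Suc j * k * width"
    using s'(3) s unfolding chain_def by (simp add: algebra_simps)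
  ultimately show ?thesis unfolding chain_def using s'(1) C(2) D(2) by (meson finite_UnI)
qed

lemma forces_certified_All:
  assumes IH: "\<And>c. \<exists>d. forces_certified p c d" and t: "wf_tm PVa fst t" and g: "g \<in> len_syms"
  shows "\<exists>d. forces_certified (all_less (Fn g [t]) p) c d"
proof -
  let ?L = "FLess (Var 0) (lift_tm (Fn g [t]))"
  have wf: "wf_tm PVa fst (Fn g [t])" by (rule wf_len_tm [OF t g])
  from decide_const_tval [OF t, of c]
  obtain c1 where c1: "\<forall>P\<in>Pos. \<forall>E. bounded_on c (fst P) (fv_tm t) E \<longrightarrow> (\<exists>Q\<in>below P. \<exists>v C. \<forall>n\<in>fst Q.
    C n \<subseteq> lits n (snd Q n) \<and> finite (C n) \<and> card (C n) \<le> size_of n ^ c1 \<and> blen (v n) \<le> size_of n ^ c1 \<and>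
    (\<forall>A. agree (C n) A \<longrightarrow> tval (std A) (E n) t = v n))" ..
  \<comment> \<open>The instances are numbers below a length, hence even smaller than their bound
    \<open>size_of n ^ c1\<close> on lengths.\<close>
  obtain d1 where d1: "forces_certified p (max c c1) d1" using IH by blast
  have "poly_bounded (\<lambda>N. N ^ c1 * N ^ d1 + N ^ c1)"
    by (intro poly_bounded_add poly_bounded_mult poly_bounded_power)
  then obtain d where d: "\<forall>N::nat\<ge>2. N ^ c1 * N ^ d1 + N ^ c1 \<le> N ^ d" unfolding poly_bounded_def by blast
  have h: "poly_bounded (\<lambda>N. N ^ c1 * N ^ d1 * width)"
    by (intro poly_bounded_mult poly_bounded_power poly_bounded_const)
  have "\<exists>Q\<in>below P. \<forall>n\<in>fst Q. certified d n (snd Q n) (all_less (Fn g [t]) p) (E n)"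
    if P: "P \<in> Pos" "range e \<subseteq> Nm" "decided P e (fv (all_less (Fn g [t]) p)) E"
      "bounded_on c (fst P) (fv (all_less (Fn g [t]) p)) E" "forces P e (all_less (Fn g [t]) p)" for P e E
  proof -
    have "bounded_on c (fst P) (fv_tm t) E"
      by (rule bounded_on_mono [OF P(4) order_refl]) (simp add: fv_all_less)
    from c1 [rule_format, OF P(1) this]
    obtain R v Ct where R: "R \<in> below P" and Ct: "\<forall>n\<in>fst R. Ct n \<subseteq> lits n (snd R n) \<and> finite (Ct n) \<and>
        card (Ct n) \<le> size_of n ^ c1 \<and> blen (v n) \<le> size_of n ^ c1 \<and>
        (\<forall>A. agree (Ct n) A \<longrightarrow> tval (std A) (E n) t = v n)" by blast
    define m where "m n = blen (v n)" for n
    have m: "m n \<le> size_of n ^ c1" if "n \<in> fst R" for n using Ct that by (simp add: m_def)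
    have val: "tval (std A) (E n) (Fn g [t]) = m n" if "n \<in> fst R" "agree (Ct n) A" for n A
      using Ct that unfolding tval_len [OF g] m_def by simp
    \<comment> \<open>The allowance for the certificate of one instance; a chain of length j may
      spend j times as much.\<close>
    define k where "k n = size_of n ^ d1" for n
    have size: "j * k n * width \<le> size_of n ^ c1 * size_of n ^ d1 * width" if "n \<in> fst R" "j \<le> m n" for n j
      using m [OF that(1)] that(2) unfolding k_def by (intro mult_le_mono) auto
    let ?G = "\<lambda>n j. \<exists>s. chain n (k n) (snd R n) p (E n) j s"
    show ?thesis
    proof (rule below_split [OF below_Pos [OF R], of "\<lambda>n. ?G n (m n)" "\<lambda>n. \<not> ?G n (m n)"])
      show "?G n (m n) \<or> \<not> ?G n (m n)" for n by blast
    next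
      fix Q assume Q: "Q \<in> below R" "\<forall>n\<in>fst Q. ?G n (m n)" "snd Q = snd R"
      have "\<exists>S\<in>below Q. fst S = fst Q \<and> (\<forall>n\<in>fst S. chain n (k n) (snd R n) p (E n) (m n) (snd S n))"
      proof (rule below_refine [OF below_Pos [OF Q(1)] h])
        fix n assume n: "n \<in> fst Q"
        then obtain s where s: "chain n (k n) (snd R n) p (E n) (m n) s" using Q(2) by blast
        then show "\<exists>s. cond n s \<and> ext n s (snd Q n) \<and> card (fst s) \<le> card (fst (snd Q n)) +
            size_of n ^ c1 * size_of n ^ d1 * width \<and> chain n (k n) (snd R n) p (E n) (m n) s"
          using chain_bounds [OF s] add_left_mono [OF size [OF below_fst [OF Q(1) n], of "m n"]] order_trans
          unfolding Q(3) by blast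
      qed
      then obtain S where S: "S \<in> below Q" "\<forall>n\<in>fst S. chain n (k n) (snd R n) p (E n) (m n) (snd S n)" by blast
      have SR: "S \<in> below R" using below_trans [OF S(1) Q(1)] .
      have "certified d n (snd S n) (all_less (Fn g [t]) p) (E n)" if n: "n \<in> fst S" for n
      proof -
        have nR: "n \<in> fst R" by (rule below_fst [OF SR n])
        obtain C where C: "C \<subseteq> lits n (snd S n)" "finite C" "card C \<le> m n * k n"
          "\<forall>v<m n. cert p (case_nat v (E n)) C"
          using S(2) n unfolding chain_def by blast
        have "cert (FImp ?L p) (case_nat a (E n)) (C \<union> Ct n)" for a
        proof (cases "a < m n")
          case True
          then show ?thesis using C(4) cert_mono by (blast intro: cert.Or2)
        next
          case False
          \<comment> \<open>Beyond the bound the literals \<open>Ct n\<close> refute the guard,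
            since they decide the value of t.\<close>
          have "cert (FNeg ?L) (case_nat a (E n)) (C \<union> Ct n)"
          proof (rule cert.sharp [OF sharply_bounded.Neg [OF sharply_bounded_Less [OF wf]]])
            fix A assume "agree (C \<union> Ct n) A"
            then have "tval (std A) (E n) (Fn g [t]) = m n" using val [OF nR] agree_mono by blast
            then show "sat (std A) (case_nat a (E n)) (FNeg ?L)"
              using False by (simp del: tval.simps(2) subst_tm.simps)
          qed
          then show ?thesis by (rule cert.Or1)
        qed
        then have "cert (all_less (Fn g [t]) p) (E n) (C \<union> Ct n)"
          unfolding all_less_def by (rule cert.All)
        moreover have "card (C \<union> Ct n) \<le> size_of n ^ d"
        proof -
          have "m n * k n \<le> size_of n ^ c1 * size_of n ^ d1" using m [OF nR] by (simp add: k_def)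
          moreover have "card (Ct n) \<le> size_of n ^ c1" using Ct nR by blast
          ultimately show ?thesis
            using card_Un_le [of C "Ct n"] C(3) d [rule_format, of "size_of n"] by linarith
        qed
        moreover have "C \<union> Ct n \<subseteq> lits n (snd S n)" using C(1) Ct nR below_lits [OF SR n] by blast
        moreover have "finite (C \<union> Ct n)" using C(2) Ct nR by blast
        ultimately show ?thesis unfolding certified_def by blast
      qed
      then show ?thesis using below_trans [OF SR R] by blast
    next
      fix Q assume Q: "Q \<in> below R" "\<forall>n\<in>fst Q. \<not> ?G n (m n)" "snd Q = snd R"
      \<comment> \<open>At such a j chains stop short of the bound. Used as the value of a name,
        these numbers satisfy the guard of the quantifier, so p is forced for them.\<close>
      have "\<exists>j<m n. ?G n j \<and> \<not> ?G n (Suc j)" if n: "n \<in> fst Q" for n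
      proof (rule ccontr)
        assume no: "\<not> ?thesis"
        have "?G n j" if "j \<le> m n" for j
          using that
        proof (induction j)
          case 0
          show ?case using chain_0 Pos_cond [OF below_Pos [OF R] below_fst [OF Q(1) n]] by blast
        next
          case (Suc j)
          then show ?case using no by (meson Suc_leD Suc_le_lessD)
        qed
        then show False using Q(2) n by blast
      qed
      then obtain j where j: "\<And>n. n \<in> fst Q \<Longrightarrow> j n < m n \<and> ?G n (j n) \<and> \<not> ?G n (Suc (j n))" by metis
      have "\<exists>S\<in>below Q. fst S = fst Q \<and> (\<forall>n\<in>fst S. chain n (k n) (snd R n) p (E n) (j n) (snd S n))"
      proof (rule below_refine [OF below_Pos [OF Q(1)] h])
        fix n assume n: "n \<in> fst Q"
        then obtain s where s: "chain n (k n) (snd R n) p (E n) (j n) s" using j by blast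
        have "j n \<le> m n" using j [OF n] by simp
        with s show "\<exists>s. cond n s \<and> ext n s (snd Q n) \<and> card (fst s) \<le> card (fst (snd Q n)) +
            size_of n ^ c1 * size_of n ^ d1 * width \<and> chain n (k n) (snd R n) p (E n) (j n) s"
          using chain_bounds [OF s] add_left_mono [OF size [OF below_fst [OF Q(1) n], of "j n"]] order_trans
          unfolding Q(3) by blast
      qed
      then obtain S where S: "S \<in> below Q" "fst S = fst Q"
        "\<forall>n\<in>fst S. chain n (k n) (snd R n) p (E n) (j n) (snd S n)" by blast
      have SR: "S \<in> below R" using below_trans [OF S(1) Q(1)] .
      have SP: "S \<in> below P" using below_trans [OF SR R] .
      define X where "X n = (if n \<in> fst S then j n else 0)" for n
      let ?x = "\<lambda>(n, A). X n"
      have jb: "X n \<le> size_of n ^ c1" for n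
      proof (cases "n \<in> fst S")
        case True
        then show ?thesis using j [of n] m [OF below_fst [OF SR True]] S(2) by (simp add: X_def)
      qed (simp add: X_def)
      then have Xb: "blen (X n) \<le> size_of n ^ c1" for n using le_blen [of "X n"] order_trans by blast
      then have x: "?x \<in> Nm" by (rule Nm_const)
      have e': "range (case_nat ?x e) \<subseteq> Nm" by (rule range_case_nat [OF x P(2)])
      have "forces S (case_nat ?x e) (FImp ?L p)"
        using forces_mono [OF P(5) SP] x unfolding all_less_def forces.simps(7) by blast
      then obtain T where T: "T \<in> below S" "forces T (case_nat ?x e) (FNeg ?L) \<or> forces T (case_nat ?x e) p"
        using dense_belowD below_refl [OF below_Pos [OF SR]] unfolding forces.simps(6) by blast
      have TP: "T \<in> below P" using below_trans [OF T(1) SP] .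
      have "SF S (case_nat ?x e) ?L"
        unfolding SF_def
      proof (clarify)
        fix n A assume A: "(n, A) \<in> pts S"
        then have n: "n \<in> fst S" and "(n, A) \<in> pts R" using pts_mono [OF SR] by (auto simp: pts_def)
        then have nR: "n \<in> fst R" and "agree (Ct n) A" using Ct agree_mono by (auto simp: pts_def)
        have "tval (std A) (\<lambda>i. e i (n, A)) (Fn g [t]) = tval (std A) (E n) (Fn g [t])"
          by (rule decided_tval [OF decided_mono [OF P(3) SP] A]) (simp add: fv_all_less)
        also have "\<dots> = m n" using val [OF nR \<open>agree (Ct n) A\<close>] .
        finally show "sat (std A) (\<lambda>i. case_nat ?x e i (n, A)) ?L"
          unfolding case_nat_at using j n S(2) by (simp add: X_def del: tval.simps(2) subst_tm.simps)
      qed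
      then have "forces T (case_nat ?x e) ?L"
        using SF_forces [OF sharply_bounded_Less [OF wf] below_Pos [OF T(1)] e'] SF_mono T(1) by blast
      then have f: "forces T (case_nat ?x e) p" using T(2) below_self [OF T(1)] by (metis forces.simps(4))
      have dec: "decided T (case_nat ?x e) (fv p) (\<lambda>n. case_nat (X n) (E n))"
        by (rule decided_case_nat [OF decided_mono [OF P(3) TP order_refl]]) (auto simp: fv_all_less)
      have bnd: "bounded_on (max c c1) (fst T) (fv p) (\<lambda>n. case_nat (X n) (E n))"
        by (rule bounded_on_case_nat [OF bounded_on_mono [OF P(4) below_fst_subset [OF TP] order_refl] Xb])
          (simp add: fv_all_less)
      obtain U where U: "U \<in> below T" "\<And>n. n \<in> fst U \<Longrightarrow> certified d1 n (snd U n) p (case_nat (X n) (E n))"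
        by (rule forces_certifiedD [OF d1 below_Pos [OF T(1)] e' dec bnd f]) blast
      \<comment> \<open>A chain of length \<open>Suc (j n)\<close> at a single index already
        contradicts the choice of j.\<close>
      obtain n where n: "n \<in> fst U" using Pos_nonempty [OF below_Pos [OF U(1)]] by blast
      have US: "U \<in> below S" using below_trans [OF U(1) T(1)] .
      have nS: "n \<in> fst S" by (rule below_fst [OF US n])
      obtain C where C: "C \<subseteq> lits n (snd U n)" "finite C" "card C \<le> k n" "cert p (case_nat (j n) (E n)) C"
        using U(2) [OF n] nS unfolding certified_def k_def X_def by auto
      have "?G n (Suc (j n))"
        by (rule chain_Suc [OF S(3) [rule_format, OF nS] Pos_cond [OF below_Pos [OF U(1)] n] below_ext [OF US n] C])
      then show ?thesis using j nS S(2) by blast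
    qed
  qed
  then show ?thesis unfolding forces_certified_def by blast
qed

lemma forces_certified: "p \<in> Sigma_b_1 \<Longrightarrow> \<exists>d. forces_certified p c d"
proof (induction arbitrary: c rule: Sigma_b_1.induct)
  case (sharp p)
  then show ?case by (rule forces_certified_sharp)
next
  case (And p q)
  then show ?case using forces_certified_And by metis
next
  case (Or p q)
  then show ?case using forces_certified_Or by metis
next
  case (sharp_Ex p t g)
  have wf: "wf_tm PVa fst (Fn g [t])"
    by (rule wf_len_tm [OF sharp_Ex.hyps(2,3)])
  show ?case by (rule forces_certified_Ex [OF sharp_Ex.IH wf])
next
  case (sharp_All p t g)
  show ?case by (rule forces_certified_All [OF sharp_All.IH sharp_All.hyps(2,3)])
next
  case (Ex p t)
  show ?case by (rule forces_certified_Ex [OF Ex.IH Ex.hyps(2)])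
qed


section \<open>Forcing of minimization\<close>

lemma forces_update0:
  "forces P (case_nat x e) (subst (case_nat (Var 0) (\<lambda>i. Var (i + 2))) p) = forces P (e(0 := x)) p"
  "forces P (case_nat z (case_nat x e)) (subst (case_nat (Var 0) (\<lambda>i. Var (i + 3))) p) = forces P (e(0 := z)) p"
proof -
  have "(\<lambda>i. tname (case_nat x e) (case_nat (Var 0) (\<lambda>i. Var (i + 2)) i)) = e(0 := x)"
    by (auto simp: fun_eq_iff tname_Var split: nat.splits)
  then show "forces P (case_nat x e) (subst (case_nat (Var 0) (\<lambda>i. Var (i + 2))) p) = forces P (e(0 := x)) p"
    by (simp only: forces_subst)
  have "(\<lambda>i. tname (case_nat z (case_nat x e)) (case_nat (Var 0) (\<lambda>i. Var (i + 3)) i)) = e(0 := z)"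
    by (auto simp: fun_eq_iff tname_Var numeral_3_eq_3 split: nat.splits)
  then show "forces P (case_nat z (case_nat x e)) (subst (case_nat (Var 0) (\<lambda>i. Var (i + 3))) p) = forces P (e(0 := z)) p"
    by (simp only: forces_subst)
qed

lemma decided_bounded:
  assumes "P \<in> Pos" "finite I" "\<And>i. i \<in> I \<Longrightarrow> e i \<in> Nm" "decided P e I E"
  shows "\<exists>c. bounded_on c (fst P) I E"
proof -
  obtain c where c: "\<forall>i\<in>I. \<forall>n. small c (size_of n) (\<lambda>A. e i (n, A))"
    using Nm_common [OF assms(2), of e] assms(3) by blast
  have "blen (E n i) \<le> size_of n ^ c" if ni: "n \<in> fst P" "i \<in> I" for n i
  proof -
    obtain A where "(n, A) \<in> pts P" using Pos_point [OF assms(1) ni(1)] by blast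
    then have "e i (n, A) = E n i" using decidedD assms(4) ni(2) by blast
    then show ?thesis using c ni(2) unfolding small_def by metis
  qed
  then show ?thesis unfolding bounded_on_def by blast
qed

text \<open>The value chosen is the least one certified in some extension by a fixed number of
  names. If a smaller value were forced further down, it would have a certificate of the same
  bounded size there, and the extension could be cut down to one that was already taken into
  account.\<close>

lemma forces_least:
  assumes p: "p \<in> Sigma_b_1" and P: "P \<in> Pos" and e: "range e \<subseteq> Nm" and f: "forces P e p"
  shows "\<exists>Q\<in>below P. \<exists>x\<in>Nm. forces Q (e(0 := x)) p \<and> (\<forall>(n, A)\<in>pts Q. x (n, A) \<le> e 0 (n, A)) \<and>
    (\<forall>U\<in>below Q. \<forall>z\<in>Nm. (\<forall>(n, A)\<in>pts U. z (n, A) < x (n, A)) \<longrightarrow> \<not> forces U (e(0 := z)) p)"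
proof -
  let ?I = "insert 0 (fv p)"
  have fin: "finite ?I" by (simp add: finite_fv)
  have eN: "e i \<in> Nm" for i using e by (simp add: range_subsetD)
  obtain R1 E where R1: "R1 \<in> below P" and dec': "\<forall>i\<in>?I. \<forall>(n, A)\<in>pts R1. e i (n, A) = E n i"
    using decide_names [OF fin P, of e] eN by blast
  have dec: "decided R1 e ?I E" using dec' by (simp add: decided_def)
  obtain c where c: "bounded_on c (fst R1) ?I E"
    using decided_bounded [OF below_Pos [OF R1] fin eN dec] by blast
  obtain d where d: "forces_certified p c d" using forces_certified [OF p] by blast
  obtain R2 where R2: "R2 \<in> below R1" "\<And>n. n \<in> fst R2 \<Longrightarrow> certified d n (snd R2 n) p (E n)"
    by (rule forces_certifiedD [OF d below_Pos [OF R1] e decided_subset [OF dec] bounded_on_mono [OF c]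
          forces_mono [OF f R1]]) auto
  let ?N = "\<lambda>n. size_of n ^ d * width"
  \<comment> \<open>The allowance \<open>?N n\<close> is what \<open>ext_small\<close> needs for a
    certificate of \<open>size_of n ^ d\<close> literals, so later conditions of any size contribute
    no new values.\<close>
  define Y where "Y n = {y. \<exists>q. cond n q \<and> ext n q (snd R2 n) \<and> card (fst q) \<le> card (fst (snd R2 n)) + ?N n \<and>
      certified d n q p ((E n)(0 := y))}" for n
  define y where "y n = (LEAST y. y \<in> Y n)" for n
  have E0: "E n 0 \<in> Y n" if "n \<in> fst R2" for n
    unfolding Y_def using R2(2) [OF that] ext_refl Pos_cond [OF below_Pos [OF R2(1)] that]
    by (intro CollectI exI [of _ "snd R2 n"]) simp
  have yY: "y n \<in> Y n" if "n \<in> fst R2" for n unfolding y_def by (rule LeastI [of "\<lambda>y. y \<in> Y n", OF E0 [OF that]])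
  have y_le: "y n \<le> z" if "z \<in> Y n" for n z unfolding y_def by (rule Least_le [of "\<lambda>y. y \<in> Y n", OF that])
  have h: "poly_bounded (\<lambda>N. N ^ d * width)"
    by (intro poly_bounded_mult poly_bounded_power poly_bounded_const)
  have "\<exists>Q\<in>below R2. fst Q = fst R2 \<and> (\<forall>n\<in>fst Q. certified d n (snd Q n) p ((E n)(0 := y n)))"
    by (rule below_refine [OF below_Pos [OF R2(1)] h]) (use yY [unfolded Y_def] in blast)
  then obtain R3 where R3: "R3 \<in> below R2" "\<And>n. n \<in> fst R3 \<Longrightarrow> certified d n (snd R3 n) p ((E n)(0 := y n))"
    by blast
  have R31: "R3 \<in> below R1" using below_trans [OF R3(1) R2(1)] .
  have R3P: "R3 \<in> below P" using below_trans [OF R31 R1] .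
  let ?x = "\<lambda>(n, A). if n \<in> fst R3 then y n else 0"
  have le: "y n \<le> e 0 (n, A)" if "(n, A) \<in> pts R3" for n A
  proof -
    have "n \<in> fst R2" "(n, A) \<in> pts R1"
      using that below_fst [OF R3(1)] pts_mono [OF R31] by (auto simp: pts_def)
    then show ?thesis using y_le [OF E0] decidedD [OF dec] by simp
  qed
  have x: "?x \<in> Nm" by (rule const_name [OF eN below_Pos [OF R3(1)] le])
  have ex: "range (e(0 := z)) \<subseteq> Nm" if "z \<in> Nm" for z using that e by auto
  have dec0: "decided U (e(0 := z)) (fv p) (\<lambda>n. (E n)(0 := Z n))"
    if "U \<in> below R3" "\<forall>(n, A)\<in>pts U. z (n, A) = Z n" for U z Z
    using decided_mono [OF dec below_trans [OF that(1) R31] order_refl] that(2) unfolding decided_def by auto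
  have "forces R3 (e(0 := ?x)) p"
  proof (rule cert_forces [OF p below_Pos [OF R3(1)] ex [OF x] dec0 [OF below_self [OF R3(1)]]])
    show "\<forall>(n, A)\<in>pts R3. ?x (n, A) = y n" by (auto simp: pts_def)
    show "cert p ((E n)(0 := y n)) (lits n (snd R3 n))" if "n \<in> fst R3" for n
      using R3(2) [OF that] cert_mono unfolding certified_def by blast
  qed
  moreover have "\<forall>(n, A)\<in>pts R3. ?x (n, A) \<le> e 0 (n, A)" using le by (auto simp: pts_def)
  moreover have "\<not> forces U (e(0 := z)) p"
    if U: "U \<in> below R3" and z: "z \<in> Nm" and less: "\<forall>(n, A)\<in>pts U. z (n, A) < ?x (n, A)" for U z
  proof
    assume fz: "forces U (e(0 := z)) p"
    obtain U1 Z where U1: "U1 \<in> below U" "\<forall>(n, A)\<in>pts U1. z (n, A) = Z n"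
      using decide_name [OF below_Pos [OF U] z] by blast
    have U13: "U1 \<in> below R3" using below_trans [OF U1(1) U] .
    have Zy: "Z n < y n" if n: "n \<in> fst U1" for n
    proof -
      obtain A where A: "(n, A) \<in> pts U1" using Pos_point [OF below_Pos [OF U1(1)] n] by blast
      have "z (n, A) < ?x (n, A)" using less A pts_mono [OF U1(1)] by blast
      then show ?thesis using U1(2) A below_fst [OF U13 n] by auto
    qed
    \<comment> \<open>Being below the original value, Z n respects the length bound c, and the
      exponent d remains valid for it.\<close>
    have ZE: "Z n < E n 0" if n: "n \<in> fst U1" for n
      using Zy [OF n] y_le [OF E0 [OF below_fst [OF R3(1) below_fst [OF U13 n]]]] by linarith
    have "bounded_on c (fst U1) (fv p) (\<lambda>n. (E n)(0 := Z n))"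
    proof -
      have "blen (((E n)(0 := Z n)) i) \<le> size_of n ^ c" if n: "n \<in> fst U1" and i: "i \<in> fv p" for n i
      proof -
        have b: "blen (E n j) \<le> size_of n ^ c" if "j \<in> ?I" for j
          using c below_fst [OF below_trans [OF U13 R31] n] that unfolding bounded_on_def by blast
        have "blen (Z n) \<le> blen (E n 0)" using ZE [OF n] by (intro floorlog_mono) simp
        also have "\<dots> \<le> size_of n ^ c" by (rule b) simp
        finally show ?thesis using b i by simp
      qed
      then show ?thesis by (simp add: bounded_on_def)
    qed
    then obtain U2 where U2: "U2 \<in> below U1" "\<And>n. n \<in> fst U2 \<Longrightarrow> certified d n (snd U2 n) p ((E n)(0 := Z n))"
      by (rule forces_certifiedD [OF d below_Pos [OF U1(1)] ex [OF z] dec0 [OF U13 U1(2)] _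
            forces_mono [OF fz U1(1)]]) blast
    obtain n where n: "n \<in> fst U2" using Pos_nonempty [OF below_Pos [OF U2(1)]] by blast
    have U22: "U2 \<in> below R2" using below_trans [OF U2(1) below_trans [OF U13 R3(1)]] .
    obtain C where C: "C \<subseteq> lits n (snd U2 n)" "finite C" "card C \<le> size_of n ^ d" "cert p ((E n)(0 := Z n)) C"
      using U2(2) [OF n] unfolding certified_def by blast
    \<comment> \<open>The cut is made relative to R2, the condition for which Y was defined, and not
      relative to the later conditions.\<close>
    obtain s where "cond n s" "ext n s (snd R2 n)" "card (fst s) \<le> card (fst (snd R2 n)) + ?N n" "C \<subseteq> lits n s"
      using ext_small [OF Pos_cond [OF below_Pos [OF U2(1)] n] below_ext [OF U22 n] C(1-3)] by blast
    then have "Z n \<in> Y n" unfolding Y_def certified_def using C by blast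
    then show False using y_le Zy [OF below_fst [OF U2(1) n]] by fastforce
  qed
  ultimately show ?thesis using R3P x by blast
qed

lemma forces_minimization:
  assumes p: "p \<in> Sigma_b_1" and P: "P \<in> Pos" and e: "range e \<subseteq> Nm"
  shows "forces P e (minimization p)"
proof -
  let ?le = "FOr (FLess (Var 0) (Var 1)) (FEq (Var 0) (Var 1))"
  let ?p2 = "subst (case_nat (Var 0) (\<lambda>i. Var (i + 2))) p"
  let ?p3 = "subst (case_nat (Var 0) (\<lambda>i. Var (i + 3))) p"
  let ?L = "FLess (Var 0) (Var 1)"
  have min: "minimization p = FImp p (FEx (FAnd ?le (FAnd ?p2 (FAll (FImp ?L (FNeg ?p3))))))"
    by (simp add: minimization_def all_less_def)
  have L: "?L \<in> sharply_bounded PVa" by (rule sharply_bounded.qf) simp_all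
  have le: "?le \<in> sharply_bounded PVa" by (rule sharply_bounded.qf) simp_all
  have "\<exists>R\<in>below Q. forces R e (FEx (FAnd ?le (FAnd ?p2 (FAll (FImp ?L (FNeg ?p3))))))"
    if Q: "Q \<in> below P" "forces Q e p" for Q
  proof -
    obtain R x where R: "R \<in> below Q" "x \<in> Nm" "forces R (e(0 := x)) p" "\<forall>(n, A)\<in>pts R. x (n, A) \<le> e 0 (n, A)"
      and least: "\<And>U z. U \<in> below R \<Longrightarrow> z \<in> Nm \<Longrightarrow> \<forall>(n, A)\<in>pts U. z (n, A) < x (n, A) \<Longrightarrow>
        \<not> forces U (e(0 := z)) p"
      using forces_least [OF p below_Pos [OF Q(1)] e Q(2)] by blast
    have e': "range (case_nat x e) \<subseteq> Nm" by (rule range_case_nat [OF R(2) e])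
    have "forces R (case_nat x e) ?le"
      by (rule SF_forces [OF le below_Pos [OF R(1)] e']) (use R(4) in \<open>auto simp: SF_def le_less\<close>)
    moreover have "forces R (case_nat x e) ?p2" unfolding forces_update0 by (rule R(3))
    moreover have "forces R (case_nat x e) (FAll (FImp ?L (FNeg ?p3)))"
      unfolding forces.simps(6,7)
    proof (intro ballI dense_belowI)
      fix z S assume z: "z \<in> Nm" and S: "S \<in> below R"
      have e'': "range (case_nat z (case_nat x e)) \<subseteq> Nm" by (rule range_case_nat [OF z e'])
      obtain T where T: "T \<in> below S" "SF T (case_nat z (case_nat x e)) ?L \<or> SF T (case_nat z (case_nat x e)) (FNeg ?L)"
        using decide_sharp [OF L e'' below_Pos [OF S]] by blast
      from T(2) show "\<exists>T\<in>below S. forces T (case_nat z (case_nat x e)) (FNeg ?L) \<or>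
          forces T (case_nat z (case_nat x e)) (FNeg ?p3)"
      proof
        assume SF: "SF T (case_nat z (case_nat x e)) ?L"
        have "\<not> forces U (case_nat z (case_nat x e)) ?p3" if U: "U \<in> below T" for U
          unfolding forces_update0
        proof (rule least [OF _ z])
          show "U \<in> below R" using below_trans [OF U below_trans [OF T(1) S]] .
          show "\<forall>(n, A)\<in>pts U. z (n, A) < x (n, A)"
            using SF_mono [OF SF U] by (auto simp: SF_def)
        qed
        then show ?thesis using T(1) unfolding forces.simps(4) by blast
      next
        assume "SF T (case_nat z (case_nat x e)) (FNeg ?L)"
        from SF_forces [OF sharply_bounded.Neg [OF L] below_Pos [OF T(1)] e'' this]
        show ?thesis using T(1) by blast
      qed
    qed
    ultimately have "forces R (case_nat x e) (FAnd ?le (FAnd ?p2 (FAll (FImp ?L (FNeg ?p3)))))"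
      by (simp only: forces.simps(5))
    then have "forces R e (FEx (FAnd ?le (FAnd ?p2 (FAll (FImp ?L (FNeg ?p3))))))"
      unfolding forces.simps(8) using R(2) forces_mono by (blast intro: dense_below_always)
    then show ?thesis using R(1) by blast
  qed
  \<comment> \<open>Either some extension of Q forces p, or Q itself forces the negation.\<close>
  then have "\<exists>R\<in>below Q. forces R e (FNeg p) \<or> forces R e (FEx (FAnd ?le (FAnd ?p2 (FAll (FImp ?L (FNeg ?p3))))))"
    if "Q \<in> below P" for Q
    unfolding forces.simps(4) using that below_self below_trans by meson
  then show ?thesis unfolding min forces.simps(6) by (intro dense_belowI)
qed

lemma forces_T12:
  assumes "q \<in> all_T12" "P \<in> Pos" "range e \<subseteq> Nm"
  shows "forces P e q"
  using assms(1) unfolding all_T12_def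
proof
  assume "q \<in> all_PVa"
  then show ?thesis using forces_all_PVa assms(2,3) by blast
next
  assume "q \<in> {q. \<exists>n. \<exists>p\<in>Sigma_b_1. q = (FAll ^^ n) (minimization p) \<and> fv q = {}}"
  then obtain n p where "p \<in> Sigma_b_1" "q = (FAll ^^ n) (minimization p)" by blast
  then show ?thesis using forces_FAll_funpow [OF forces_minimization assms(3)] assms(2) by blast
qed

end


section \<open>Deciding most of many decision trees\<close>

text \<open>Averaging: the mean number of sets containing a point is at most
  \<open>s * card J / card U\<close>. At least half of the points are below twice the mean, and the
  sets hit by m of them are counted by a union bound.\<close>

lemma avoid_small_sets:
  fixes S :: "'i \<Rightarrow> 'b set"
  assumes "finite U" "2 * m \<le> card U" "finite J" "\<And>i. i \<in> J \<Longrightarrow> card (S i \<inter> U) \<le> s"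
  shows "\<exists>W\<subseteq>U. card W = m \<and> card {i \<in> J. S i \<inter> W \<noteq> {}} * card U \<le> 2 * m * s * card J"
proof -
  define cnt where "cnt w = card {i \<in> J. w \<in> S i}" for w
  have "(\<Sum>w\<in>U. cnt w) = (\<Sum>w\<in>U. \<Sum>i\<in>J. of_bool (w \<in> S i))"
    using assms(3) by (simp add: cnt_def Int_def)
  also have "\<dots> = (\<Sum>i\<in>J. \<Sum>w\<in>U. of_bool (w \<in> S i))" by (rule sum.swap)
  also have "\<dots> = (\<Sum>i\<in>J. card (S i \<inter> U))"
    using assms(1) by (intro sum.cong) (simp_all add: Int_def conj_commute)
  also have "\<dots> \<le> (\<Sum>i\<in>J. s)" by (intro sum_mono assms(4))
  finally have total: "(\<Sum>w\<in>U. cnt w) \<le> s * card J" by (simp add: mult.commute)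
  \<comment> \<open>The points lying in at most twice the average number of sets.\<close>
  define Light where "Light = {w \<in> U. cnt w * card U \<le> 2 * s * card J}"
  have "m \<le> card Light"
  proof (rule ccontr)
    assume "\<not> m \<le> card Light"
    then have "card U < 2 * card (U - Light)"
      using assms(1,2) card_Diff_subset [of Light U] by (simp add: Light_def)
    moreover have "card (U - Light) * (2 * s * card J + 1) \<le> (\<Sum>w\<in>U - Light. cnt w * card U)"
      using sum_mono [of "U - Light" "\<lambda>_. 2 * s * card J + 1" "\<lambda>w. cnt w * card U"] by (force simp: Light_def)
    moreover have "(\<Sum>w\<in>U - Light. cnt w * card U) \<le> (\<Sum>w\<in>U. cnt w) * card U"
      unfolding sum_distrib_right using assms(1) by (intro sum_mono2) auto
    moreover have "(\<Sum>w\<in>U. cnt w) * card U \<le> s * card J * card U" using total by simp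
    ultimately have *: "card U < 2 * card (U - Light)"
      "card (U - Light) * (2 * s * card J + 1) \<le> s * card J * card U" by linarith+
    have "s * card J * card U \<le> s * card J * (2 * card (U - Light))" using *(1) by (intro mult_le_mono2) simp
    moreover have "card (U - Light) * (2 * s * card J + 1) = s * card J * (2 * card (U - Light)) + card (U - Light)"
      by (simp add: algebra_simps)
    ultimately have "card (U - Light) = 0" using *(2) by linarith
    then show False using *(1) by simp
  qed
  then obtain W where W: "W \<subseteq> Light" "card W = m" "finite W" by (rule obtain_subset_with_card_n)
  have "card {i \<in> J. S i \<inter> W \<noteq> {}} \<le> card (\<Union>w\<in>W. {i \<in> J. w \<in> S i})"
    using assms(3) W(3) by (intro card_mono) auto
  also have "\<dots> \<le> (\<Sum>w\<in>W. cnt w)" unfolding cnt_def by (rule card_UN_le [OF W(3)])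
  finally have "card {i \<in> J. S i \<inter> W \<noteq> {}} * card U \<le> (\<Sum>w\<in>W. cnt w * card U)"
    by (simp add: sum_distrib_right [symmetric])
  also have "\<dots> \<le> (\<Sum>w\<in>W. 2 * s * card J)" using W(1) by (intro sum_mono) (auto simp: Light_def)
  also have "\<dots> = 2 * m * s * card J" using W(2) by simp
  finally show ?thesis using W by (intro exI [of _ W]) (auto simp: Light_def)
qed

section \<open>Renaming elements inside a large structure\<close>

locale large_structure = infinite_structure L B for L :: lang and B :: "'a lstr" +
  fixes g :: "nat \<Rightarrow> nat"
  assumes large: "large L g B" and subpolynomial: "subpolynomial g"
begin

text \<open>The named elements with the induced operations form a finite partial structure. Its
  embedding preserves all defined entries, so composing it with the naming keeps the literals;
  largeness of the image then confines the function values without a name to the small set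
  V.\<close>

lemma large_embedding:
  assumes "cond n ({..<n}, h)" "0 < n"
  shows "\<exists>h' V. cond n ({..<n}, h') \<and> (\<forall>D\<subseteq>{..<n}. lits n (D, h) \<subseteq> lits n (D, h')) \<and>
    V \<subseteq> univ B - h' ` {..<n} \<and> finite V \<and> card V \<le> g n \<and>
    (\<forall>S\<in>funs L. \<forall>as\<in>tuples {..<n} (ar L S). fn B (LF S) (map h' as) \<in> h' ` {..<n} \<union> V)"
proof -
  let ?U = "h ` {..<n}"
  have h: "inj_on h {..<n}" "?U \<subseteq> univ B" using assms(1) by (auto simp: cond_def)
  have card_U: "card ?U = n" using card_image [OF h(1)] by simp
  define P :: "'a plstr" where "P = \<lparr>puniv = ?U, pfn = \<lambda>s as. if fn B s as \<in> ?U then Some (fn B s as) else None,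
    prl = \<lambda>s as. Some (rl B s as)\<rparr>"
  have "is_pstructure L P" using assms(2) by (auto simp: is_pstructure_def P_def split: if_splits)
  moreover have "is_pstructure L (as_partial B)"
    using is_struct by (auto simp: is_pstructure_def is_structure_def as_partial_def)
  ultimately have "psubstructure L P (as_partial B)"
    using h(2) by (auto simp: psubstructure_def P_def as_partial_def)
  moreover have "finite (puniv P)" by (simp add: P_def)
  ultimately obtain P' where P': "large_sub L g B P'" "card (puniv P') = card (puniv P)" "embeds L P P'"
    using large unfolding large_def by blast
  obtain k R where k: "piso L k P R" "psubstructure L R P'" using P'(3) by (auto simp: embeds_def)
  have fin: "finite (puniv P')" and ind: "psubstructure L P' (as_partial B)"
    using P'(1) by (auto simp: large_sub_def induced_psubstructure_def)
  obtain V where V: "V \<subseteq> univ B - puniv P'" "finite V" "card V \<le> g (card (puniv P'))"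
    "\<forall>S\<in>funs L. fn B (LF S) ` tuples (puniv P') (ar L S) \<subseteq> puniv P' \<union> V"
    using P'(1) by (auto simp: large_sub_def)
  have bij: "bij_betw k ?U (puniv R)" using k(1) by (simp add: piso_def P_def)
  have "puniv R \<subseteq> puniv P'" using k(2) by (simp add: psubstructure_def)
  moreover have "card (puniv R) = card (puniv P')"
    using bij_betw_same_card [OF bij] P'(2) by (simp add: P_def)
  \<comment> \<open>Equal finite cardinalities make the embedding onto, so all elements of the large
    substructure get names.\<close>
  ultimately have R: "puniv R = puniv P'" using fin by (simp add: card_subset_eq)
  define h' where "h' = k \<circ> h"
  have h': "bij_betw h' {..<n} (puniv P')"
    unfolding h'_def using bij_betw_trans [OF _ bij, of h "{..<n}"] h(1) R by (auto simp: bij_betw_def)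
  have im: "h' ` {..<n} = puniv P'" using h' by (simp add: bij_betw_def)
  have "puniv P' \<subseteq> univ B" using ind by (simp add: psubstructure_def as_partial_def)
  then have cond: "cond n ({..<n}, h')" using h' by (simp add: cond_def bij_betw_def)
  have tup: "map h as \<in> tuples ?U m" "map h' as \<in> tuples (puniv P') m" if "as \<in> tuples {..<n} m" for as m
    using that im by (auto simp: tuples_def)
  have kr: "prl R (LR S) (map k bs) = prl P (LR S) bs" if "S \<in> rels L" "bs \<in> tuples ?U (ar L S)" for S bs
    using k(1) that unfolding piso_def by (simp add: P_def)
  have kf: "pfn R (LF S) (map k bs) = map_option k (pfn P (LF S) bs)" if "S \<in> funs L" "bs \<in> tuples ?U (ar L S)" for S bs
    using k(1) that unfolding piso_def by (simp add: P_def)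
  have rel_preserved: "rl B (LR S) (map h' as) = rl B (LR S) (map h as)"
    if S: "S \<in> rels L" and as: "as \<in> tuples {..<n} (ar L S)" for S as
  proof -
    have "prl R (LR S) (map k (map h as)) = prl P (LR S) (map h as)"
      by (rule kr [OF S tup(1) [OF as]])
    then have "prl R (LR S) (map h' as) = Some (rl B (LR S) (map h as))" by (simp add: P_def h'_def)
    moreover have "prl R (LR S) (map h' as) \<in> {prl P' (LR S) (map h' as), None}"
      using k(2) S tup(2) [OF as] R unfolding psubstructure_def by simp
    moreover have "prl P' (LR S) (map h' as) \<in> {Some (rl B (LR S) (map h' as)), None}"
      using ind S tup(2) [OF as] unfolding psubstructure_def as_partial_def by simp
    ultimately show ?thesis by auto
  qed
  have fn_preserved: "fn B (LF S) (map h' as) = h' v"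
    if S: "S \<in> funs L" and as: "as \<in> tuples {..<n} (ar L S)" and v: "v < n" "h v = fn B (LF S) (map h as)" for S as v
  proof -
    have "pfn R (LF S) (map k (map h as)) = map_option k (pfn P (LF S) (map h as))"
      by (rule kf [OF S tup(1) [OF as]])
    moreover have "fn B (LF S) (map h as) \<in> ?U" using v by (metis imageI lessThan_iff)
    ultimately have "pfn R (LF S) (map h' as) = Some (h' v)" by (simp add: P_def h'_def v(2))
    moreover have "pfn R (LF S) (map h' as) \<in> {pfn P' (LF S) (map h' as), None}"
      using k(2) S tup(2) [OF as] R unfolding psubstructure_def by simp
    moreover have "pfn P' (LF S) (map h' as) \<in> {Some (fn B (LF S) (map h' as)), None}"
      using ind S tup(2) [OF as] unfolding psubstructure_def as_partial_def by simp
    ultimately show ?thesis by auto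
  qed
  have "lits n (D, h) \<subseteq> lits n (D, h')" if D: "D \<subseteq> {..<n}" for D
  proof
    fix l assume "l \<in> lits n (D, h)"
    moreover obtain x b where l: "l = (x, b)" by fastforce
    ultimately have "(x, b) \<in> lits n (D, h)" by simp
    then show "l \<in> lits n (D, h')"
    proof (cases rule: litsE)
      case (rel S as)
      then have "rl B (LR S) (map h' as) = b"
        using rel_preserved tuples_mono [OF _ D] unfolding rel_code_def by blast
      then show ?thesis using lits_rel [OF rel(1), of h' n] l by simp
    next
      case ("fun" S as i v)
      then have "h' v = fn B (LF S) (map h' as)"
        using fn_preserved [of S as v] tuples_mono [OF _ D] D unfolding fun_code_def by fastforce
      then show ?thesis using lits_fun [OF "fun"(1,2), of h'] "fun"(4) l by simp
    next
      case none
      then show ?thesis using lits_none [of n x] l by simp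
    qed
  qed
  moreover have "\<forall>S\<in>funs L. \<forall>as\<in>tuples {..<n} (ar L S). fn B (LF S) (map h' as) \<in> h' ` {..<n} \<union> V"
    using V(4) tup(2) unfolding im by blast
  moreover have "card V \<le> g n" using V(3) P'(2) card_U by (simp add: P_def)
  ultimately show ?thesis using cond V(1,2) unfolding im [symmetric] by blast
qed

text \<open>After the elements named by \<open>W\<close> are replaced by those of \<open>V\<close>, the query \<open>x\<close> is answered, provided that \<open>W\<close> avoids
  the names \<open>D\<close> involved in the query.\<close>

lemma query_names:
  assumes V: "\<forall>S\<in>funs L. \<forall>as\<in>tuples {..<n} (ar L S). fn B (LF S) (map h as) \<in> h ` {..<n} \<union> V"
  shows "\<exists>D\<subseteq>{..<n}. card D \<le> width \<and> (\<forall>W h'. W \<subseteq> {..<n} \<longrightarrow> W \<inter> D = {} \<longrightarrow> (\<forall>k. k \<notin> W \<longrightarrow> h' k = h k) \<longrightarrow>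
    h' ` W = V \<longrightarrow> (\<exists>D' b. D \<subseteq> D' \<and> D' \<subseteq> {..<n} \<and> card D' \<le> width \<and> (x, b) \<in> lits n (D', h')))"
proof -
  consider (rel) S as where "rel_code {..<n} x S as" | ("fun") S as i where "fun_code n {..<n} x S as i"
    | (none) "\<nexists>S as. rel_code {..<n} x S as" "\<nexists>S as i. fun_code n {..<n} x S as i" by blast
  then show ?thesis
  proof cases
    case (rel S as)
    then have S: "S \<in> rels L" "as \<in> tuples {..<n} (ar L S)" by (auto simp: rel_code_def)
    then have D: "set as \<subseteq> {..<n}" "card (set as) \<le> width"
      using ar_width [of S] card_tuple [OF S(2)] by (auto simp: tuples_def)
    have "rel_code (set as) x S as" using rel by (auto simp: rel_code_def tuples_def)
    then have "(x, rl B (LR S) (map h' as)) \<in> lits n (set as, h')" for h' by (rule lits_rel)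
    then have "\<exists>D' b. set as \<subseteq> D' \<and> D' \<subseteq> {..<n} \<and> card D' \<le> width \<and> (x, b) \<in> lits n (D', h')" for h'
      using D by (intro exI [of _ "set as"] exI [of _ "rl B (LR S) (map h' as)"]) simp
    then show ?thesis using D by (intro exI [of _ "set as"]) simp
  next
    case ("fun" S as i)
    then have S: "S \<in> funs L" "as \<in> tuples {..<n} (ar L S)" by (auto simp: fun_code_def)
    then have D: "set as \<subseteq> {..<n}" "card (set as) < width"
      using ar_width [of S] card_tuple [OF S(2)] by (auto simp: tuples_def)
    have D': "card (insert w (set as)) \<le> width" for w using D(2) by (simp add: card_insert_if)
    have code: "fun_code n (insert w (set as)) x S as i" for w
      using "fun" by (auto simp: fun_code_def tuples_def)
    have same: "map h' as = map h as" if "W \<inter> set as = {}" "\<forall>k. k \<notin> W \<longrightarrow> h' k = h k" for W h'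
      using that by auto
    show ?thesis
    proof (cases "fn B (LF S) (map h as) \<in> h ` {..<n}")
      case True
      then obtain w where w: "w < n" "h w = fn B (LF S) (map h as)" by auto
      show ?thesis
      proof (rule exI [of _ "insert w (set as)"], intro conjI allI impI)
        fix W h' assume *: "W \<inter> insert w (set as) = {}" "\<forall>k. k \<notin> W \<longrightarrow> h' k = h k"
        have "map h' as = map h as" by (rule same) (use * in auto)
        then have "h' w = fn B (LF S) (map h' as)" using w(2) * by (simp del: map_eq_conv)
        then have "(x, bit w i) \<in> lits n (insert w (set as), h')" by (intro lits_fun [OF code]) simp_all
        then show "\<exists>D' b. insert w (set as) \<subseteq> D' \<and> D' \<subseteq> {..<n} \<and> card D' \<le> width \<and> (x, b) \<in> lits n (D', h')"
          using D(1) D' w(1) by (intro exI [of _ "insert w (set as)"]) auto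
      qed (use D D' w(1) in auto)
    next
      case False
      then have v: "fn B (LF S) (map h as) \<in> V" using V S by blast
      show ?thesis
      proof (rule exI [of _ "set as"], intro conjI allI impI)
        fix W h' assume *: "W \<subseteq> {..<n}" "W \<inter> set as = {}" "\<forall>k. k \<notin> W \<longrightarrow> h' k = h k" "h' ` W = V"
        obtain w where w: "w \<in> W" "h' w = fn B (LF S) (map h as)" using v *(4) by (metis imageE)
        then have "h' w = fn B (LF S) (map h' as)" using same [OF *(2,3)] by (simp del: map_eq_conv)
        then have "(x, bit w i) \<in> lits n (insert w (set as), h')" by (intro lits_fun [OF code]) simp_all
        then show "\<exists>D' b. set as \<subseteq> D' \<and> D' \<subseteq> {..<n} \<and> card D' \<le> width \<and> (x, b) \<in> lits n (D', h')"
          using D(1) D' w(1) *(1) by (intro exI [of _ "insert w (set as)"]) auto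
      qed (use D in auto)
    qed
  next
    case none
    then have "\<exists>D' b. {} \<subseteq> D' \<and> D' \<subseteq> {..<n} \<and> card D' \<le> width \<and> (x, b) \<in> lits n (D', h')" for h'
      using lits_none [of n x "({}, h')"] by (intro exI [of _ "{}"] exI [of _ False]) simp
    then show ?thesis by (intro exI [of _ "{}"]) simp
  qed
qed

text \<open>One query of every tree is answered in each round: embed the current structure into a large one, then give
  names to the missing function values. The trees lost are those that have already used one of the few names that
  are reassigned.\<close>

lemma decide_most_trees:
  assumes K: "K \<subseteq> {..<n}" "2 * g n \<le> n - card K" "0 < n"
  shows "cond n ({..<n}, h) \<Longrightarrow> finite J \<Longrightarrow> (\<And>i. i \<in> J \<Longrightarrow> F i \<in> dtree t) \<Longrightarrow>
    (\<And>i. i \<in> J \<Longrightarrow> D i \<subseteq> {..<n} \<and> card (D i) \<le> d) \<Longrightarrow>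
    \<exists>h' J' D'. cond n ({..<n}, h') \<and> (\<forall>E\<subseteq>K. lits n (E, h) \<subseteq> lits n (E, h')) \<and> J' \<subseteq> J \<and>
      card (J - J') * (n - card K) \<le> t * card J * (2 * g n * (d + t * width)) \<and>
      (\<forall>i\<in>J'. D i \<subseteq> D' i \<and> D' i \<subseteq> {..<n} \<and> card (D' i) \<le> d + t * width \<and>
        (\<forall>E\<subseteq>D i. lits n (E, h) \<subseteq> lits n (E, h')) \<and> (\<exists>v. \<forall>A. agree (lits n (D' i, h')) A \<longrightarrow> F i A = v))"
proof (induction t arbitrary: h J F D d)
  case 0
  have "\<exists>v. \<forall>A. agree (lits n (D i, h)) A \<longrightarrow> F i A = v" if "i \<in> J" for i using 0(3) [OF that] by auto
  then show ?case using 0(1,4) by (intro exI [of _ h] exI [of _ J] exI [of _ D]) simp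
next
  case (Suc t)
  have "\<forall>i. \<exists>p. i \<in> J \<longrightarrow> fst (snd p) \<in> dtree t \<and> snd (snd p) \<in> dtree t \<and>
      F i = (\<lambda>A. if fst p \<in> A then fst (snd p) A else snd (snd p) A)"
  proof
    fix i
    show "\<exists>p. i \<in> J \<longrightarrow> fst (snd p) \<in> dtree t \<and> snd (snd p) \<in> dtree t \<and>
        F i = (\<lambda>A. if fst p \<in> A then fst (snd p) A else snd (snd p) A)"
    proof (cases "i \<in> J")
      case True
      then obtain x F1 F0 where "F1 \<in> dtree t" "F0 \<in> dtree t" "F i = (\<lambda>A. if x \<in> A then F1 A else F0 A)"
        using Suc.prems(3) [OF True] by auto
      then show ?thesis by (intro exI [of _ "(x, F1, F0)"]) (auto simp: fun_eq_iff)
    qed simp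
  qed
  from choice [OF this] obtain p where p: "\<forall>i. i \<in> J \<longrightarrow> fst (snd (p i)) \<in> dtree t \<and> snd (snd (p i)) \<in> dtree t \<and>
      F i = (\<lambda>A. if fst (p i) \<in> A then fst (snd (p i)) A else snd (snd (p i)) A)" ..
  define x F1 F0 where "x i = fst (p i)" and "F1 i = fst (snd (p i))" and "F0 i = snd (snd (p i))" for i
  have F: "F1 i \<in> dtree t \<and> F0 i \<in> dtree t \<and> F i = (\<lambda>A. if x i \<in> A then F1 i A else F0 i A)" if "i \<in> J" for i
    using p that unfolding x_def F1_def F0_def by blast
  obtain h1 V where h1: "cond n ({..<n}, h1)" "\<forall>D\<subseteq>{..<n}. lits n (D, h) \<subseteq> lits n (D, h1)"
    and V: "V \<subseteq> univ B - h1 ` {..<n}" "finite V" "card V \<le> g n"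
      "\<forall>S\<in>funs L. \<forall>as\<in>tuples {..<n} (ar L S). fn B (LF S) (map h1 as) \<in> h1 ` {..<n} \<union> V"
    using large_embedding [OF Suc.prems(1) K(3)] by blast
  have "\<forall>i. \<exists>D1. D1 \<subseteq> {..<n} \<and> card D1 \<le> width \<and> (\<forall>W h'. W \<subseteq> {..<n} \<longrightarrow> W \<inter> D1 = {} \<longrightarrow> (\<forall>k. k \<notin> W \<longrightarrow> h' k = h1 k) \<longrightarrow>
    h' ` W = V \<longrightarrow> (\<exists>D' b. D1 \<subseteq> D' \<and> D' \<subseteq> {..<n} \<and> card D' \<le> width \<and> (x i, b) \<in> lits n (D', h')))"
    using query_names [OF V(4)] by blast
  from choice [OF this] obtain D1 where D1': "\<forall>i. D1 i \<subseteq> {..<n} \<and> card (D1 i) \<le> width \<and>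
      (\<forall>W h'. W \<subseteq> {..<n} \<longrightarrow> W \<inter> D1 i = {} \<longrightarrow> (\<forall>k. k \<notin> W \<longrightarrow> h' k = h1 k) \<longrightarrow> h' ` W = V \<longrightarrow>
        (\<exists>D' b. D1 i \<subseteq> D' \<and> D' \<subseteq> {..<n} \<and> card D' \<le> width \<and> (x i, b) \<in> lits n (D', h')))" ..
  then have D1: "\<And>i. D1 i \<subseteq> {..<n}" "\<And>i. card (D1 i) \<le> width" by blast+
  have finK: "finite K" using K(1) finite_subset by blast
  have cardU: "card ({..<n} - K) = n - card K" using K(1) finK by (simp add: card_Diff_subset)
  have fin: "finite (D1 i)" for i using D1(1) finite_subset by blast
  \<comment> \<open>The names W will be reassigned to the elements of V. They avoid K, so that the
    initial condition survives, and they meet the names already used by a tree or involved in its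
    next query for few trees only.\<close>
  have "\<exists>W\<subseteq>{..<n} - K. card W = card V \<and>
      card {i \<in> J. (D i \<union> D1 i) \<inter> W \<noteq> {}} * card ({..<n} - K) \<le> 2 * card V * (d + width) * card J"
  proof (rule avoid_small_sets)
    show "2 * card V \<le> card ({..<n} - K)" using K(2) V(3) cardU by simp
    show "card ((D i \<union> D1 i) \<inter> ({..<n} - K)) \<le> d + width" if "i \<in> J" for i
    proof -
      have "finite (D i)" using Suc.prems(4) [OF that] finite_subset by blast
      then have "card ((D i \<union> D1 i) \<inter> ({..<n} - K)) \<le> card (D i \<union> D1 i)" using fin by (intro card_mono) auto
      also have "\<dots> \<le> card (D i) + card (D1 i)" by (rule card_Un_le)
      finally show ?thesis using Suc.prems(4) [OF that] D1(2) [of i] by linarith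
    qed
  qed (use Suc.prems(2) in auto)
  then obtain W where W: "W \<subseteq> {..<n} - K" "card W = card V"
    "card {i \<in> J. (D i \<union> D1 i) \<inter> W \<noteq> {}} * (n - card K) \<le> 2 * card V * (d + width) * card J"
    unfolding cardU by blast
  define J1 where "J1 = {i \<in> J. (D i \<union> D1 i) \<inter> W = {}}"
  have J1: "J1 \<subseteq> J" "finite J1" using Suc.prems(2) by (auto simp: J1_def)
  have finW: "finite W" using W(1) finite_subset by blast
  obtain f where f: "bij_betw f W V" using finite_same_card_bij [OF finW V(2) W(2)] by blast
  define h2 where "h2 k = (if k \<in> W then f k else h1 k)" for k
  have h2W: "h2 ` W = V" using f by (auto simp: h2_def bij_betw_def)
  have h2_off: "\<forall>k. k \<notin> W \<longrightarrow> h2 k = h1 k" by (simp add: h2_def)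
  have cond2: "cond n ({..<n}, h2)"
  proof -
    have i1: "inj_on h2 W" using f by (subst inj_on_cong [of W h2 f]) (simp_all add: h2_def bij_betw_def)
    have "inj_on h1 ({..<n} - W)" using h1(1) by (auto simp: cond_def inj_on_diff)
    then have i2: "inj_on h2 ({..<n} - W)"
      by (subst inj_on_cong [of "{..<n} - W" h2 h1]) (simp_all add: h2_def)
    have im: "h2 ` ({..<n} - W) \<subseteq> h1 ` {..<n}" using h2_off by auto
    have eq: "{..<n} = W \<union> ({..<n} - W)" "W - ({..<n} - W) = W" "{..<n} - W - W = {..<n} - W"
      using W(1) by auto
    have "h2 ` W \<inter> h2 ` ({..<n} - W) = {}" using im V(1) h2W by auto
    then have "inj_on h2 (W \<union> ({..<n} - W))" unfolding inj_on_Un eq(2,3) using i1 i2 by simp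
    then have inj: "inj_on h2 {..<n}" using eq(1) by simp
    have "h2 ` {..<n} = V \<union> h2 ` ({..<n} - W)" unfolding h2W [symmetric] image_Un [symmetric] using eq(1) by simp
    moreover have "h2 ` ({..<n} - W) \<subseteq> univ B" using h1(1) im by (auto simp: cond_def)
    moreover have "V \<subseteq> univ B" using V(1) by blast
    ultimately have "h2 ` {..<n} \<subseteq> univ B" by simp
    then show ?thesis using inj by (simp add: cond_def)
  qed
  have "\<exists>D' b. D1 i \<subseteq> D' \<and> D' \<subseteq> {..<n} \<and> card D' \<le> width \<and> (x i, b) \<in> lits n (D', h2)" if "i \<in> J1" for i
    by (rule D1' [THEN spec, THEN conjunct2, THEN conjunct2, rule_format, OF _ _ _ h2W])
      (use W(1) that h2_off in \<open>auto simp: J1_def\<close>)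
  then obtain D2 b where D2: "\<And>i. i \<in> J1 \<Longrightarrow> D1 i \<subseteq> D2 i \<and> D2 i \<subseteq> {..<n} \<and> card (D2 i) \<le> width \<and>
      (x i, b i) \<in> lits n (D2 i, h2)" by metis
  \<comment> \<open>The answer leaves a subtree of depth t to the remaining rounds.\<close>
  define G where "G i = (if b i then F1 i else F0 i)" for i
  have Gt: "G i \<in> dtree t" if "i \<in> J1" for i using F J1(1) that by (auto simp: G_def)
  have DD: "D i \<union> D2 i \<subseteq> {..<n} \<and> card (D i \<union> D2 i) \<le> d + width" if "i \<in> J1" for i
    using D2 [OF that] Suc.prems(4) [of i] J1(1) that card_Un_le [of "D i" "D2 i"] by fastforce
  have "\<exists>h' J' D'. cond n ({..<n}, h') \<and> (\<forall>E\<subseteq>K. lits n (E, h2) \<subseteq> lits n (E, h')) \<and> J' \<subseteq> J1 \<and>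
    card (J1 - J') * (n - card K) \<le> t * card J1 * (2 * g n * (d + width + t * width)) \<and>
    (\<forall>i\<in>J'. D i \<union> D2 i \<subseteq> D' i \<and> D' i \<subseteq> {..<n} \<and> card (D' i) \<le> d + width + t * width \<and>
        (\<forall>E\<subseteq>D i \<union> D2 i. lits n (E, h2) \<subseteq> lits n (E, h')) \<and> (\<exists>v. \<forall>A. agree (lits n (D' i, h')) A \<longrightarrow> G i A = v))"
    by (rule Suc.IH [OF cond2 J1(2) Gt DD])
  then obtain h' J' D' where IH: "cond n ({..<n}, h')" "\<forall>E\<subseteq>K. lits n (E, h2) \<subseteq> lits n (E, h')" "J' \<subseteq> J1"
    "card (J1 - J') * (n - card K) \<le> t * card J1 * (2 * g n * (d + width + t * width))"
    "\<forall>i\<in>J'. D i \<union> D2 i \<subseteq> D' i \<and> D' i \<subseteq> {..<n} \<and> card (D' i) \<le> d + width + t * width \<and>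
        (\<forall>E\<subseteq>D i \<union> D2 i. lits n (E, h2) \<subseteq> lits n (E, h')) \<and> (\<exists>v. \<forall>A. agree (lits n (D' i, h')) A \<longrightarrow> G i A = v)"
    by (elim exE conjE) (rule that)
  have lits12: "lits n (E, h) \<subseteq> lits n (E, h2)" if "E \<subseteq> {..<n}" "E \<inter> W = {}" for E
  proof -
    have "lits n (E, h1) \<subseteq> lits n (E, h2)" by (rule lits_cong_subset) (use h2_off that(2) in auto)
    then show ?thesis using h1(2) that(1) by blast
  qed
  have presK: "\<forall>E\<subseteq>K. lits n (E, h) \<subseteq> lits n (E, h')"
  proof (intro allI impI)
    fix E assume E: "E \<subseteq> K"
    have "lits n (E, h) \<subseteq> lits n (E, h2)" by (rule lits12) (use E K(1) W(1) in auto)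
    then show "lits n (E, h) \<subseteq> lits n (E, h')" using IH(2) E by blast
  qed
  have sub: "J' \<subseteq> J" using IH(3) J1(1) by blast
  \<comment> \<open>This round too is charged with the final bound \<open>d + Suc t * width\<close>
    on the names of a tree, so that every round loses at most the same proportion of J.\<close>
  have lost: "card (J - J') * (n - card K) \<le> Suc t * card J * (2 * g n * (d + Suc t * width))"
  proof -
    have "J - J' \<subseteq> (J - J1) \<union> (J1 - J')" by blast
    then have "card (J - J') \<le> card (J - J1) + card (J1 - J')"
      using card_mono [of "(J - J1) \<union> (J1 - J')" "J - J'"] card_Un_le [of "J - J1" "J1 - J'"] Suc.prems(2) J1(2) by fastforce
    then have "card (J - J') * (n - card K) \<le> card (J - J1) * (n - card K) + card (J1 - J') * (n - card K)"
      by (metis add_mult_distrib mult_le_mono1)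
    also have "card (J - J1) * (n - card K) \<le> 2 * g n * (d + Suc t * width) * card J"
    proof -
      have "J - J1 = {i \<in> J. (D i \<union> D1 i) \<inter> W \<noteq> {}}" by (auto simp: J1_def)
      then have "card (J - J1) * (n - card K) \<le> 2 * card V * (d + width) * card J" using W(3) by simp
      also have "\<dots> \<le> 2 * g n * (d + Suc t * width) * card J" using V(3) by (intro mult_le_mono) auto
      finally show ?thesis .
    qed
    also have "card (J1 - J') * (n - card K) \<le> t * card J * (2 * g n * (d + Suc t * width))"
    proof -
      have "t * card J1 * (2 * g n * (d + width + t * width)) \<le> t * card J * (2 * g n * (d + Suc t * width))"
        using card_mono [OF Suc.prems(2) J1(1)] by (intro mult_le_mono) auto
      then show ?thesis using IH(4) by linarith
    qed
    finally show ?thesis by (simp add: algebra_simps)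
  qed
  have trees: "\<forall>i\<in>J'. D i \<subseteq> D' i \<and> D' i \<subseteq> {..<n} \<and> card (D' i) \<le> d + Suc t * width \<and>
      (\<forall>E\<subseteq>D i. lits n (E, h) \<subseteq> lits n (E, h')) \<and> (\<exists>v. \<forall>A. agree (lits n (D' i, h')) A \<longrightarrow> F i A = v)"
  proof
    fix i assume i: "i \<in> J'"
    have i1: "i \<in> J1" and iJ: "i \<in> J" using i IH(3) J1(1) by auto
    have I: "D i \<union> D2 i \<subseteq> D' i" "D' i \<subseteq> {..<n}" "card (D' i) \<le> d + width + t * width"
      "\<forall>E\<subseteq>D i \<union> D2 i. lits n (E, h2) \<subseteq> lits n (E, h')" using IH(5) i by blast+
    have E: "lits n (E, h) \<subseteq> lits n (E, h')" if "E \<subseteq> D i" for E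
    proof -
      have "lits n (E, h) \<subseteq> lits n (E, h2)"
        by (rule lits12) (use that Suc.prems(4) [OF iJ] i1 in \<open>auto simp: J1_def\<close>)
      then show ?thesis using I(4) that by blast
    qed
    obtain v where v: "\<forall>A. agree (lits n (D' i, h')) A \<longrightarrow> G i A = v" using IH(5) i by blast
    have "lits n (D2 i, h2) \<subseteq> lits n (D2 i, h')" using I(4) by blast
    also have "\<dots> \<subseteq> lits n (D' i, h')" using I(1) by (intro lits_mono) blast
    finally have x: "(x i, b i) \<in> lits n (D' i, h')" using D2 [OF i1] by blast
    have "F i A = v" if A: "agree (lits n (D' i, h')) A" for A
    proof -
      have "x i \<in> A \<longleftrightarrow> b i" using A x unfolding agree_def by blast
      then show ?thesis using v A F [OF iJ] by (auto simp: G_def)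
    qed
    then show "D i \<subseteq> D' i \<and> D' i \<subseteq> {..<n} \<and> card (D' i) \<le> d + Suc t * width \<and>
        (\<forall>E\<subseteq>D i. lits n (E, h) \<subseteq> lits n (E, h')) \<and> (\<exists>v. \<forall>A. agree (lits n (D' i, h')) A \<longrightarrow> F i A = v)"
      using I E by auto
  qed
  show ?case
    by (rule exI [of _ h'], rule exI [of _ J'], rule exI [of _ D'])
      (rule conjI [OF IH(1) conjI [OF presK conjI [OF sub conjI [OF lost trees]]]])
qed

text \<open>Both factors are eventually at most the square root of n: g because its exponent drops
  below 1/2, and h because its square is still polynomial in the length.\<close>

lemma eventually_subpolynomial:
  assumes "poly_bounded h"
  shows "\<forall>\<^sub>F n in sequentially. h (size_of n) * g n \<le> n"
proof -
  obtain r where r: "r \<longlonglongrightarrow> 0" "\<forall>\<^sub>F n in sequentially. real (g n) = real n powr r n"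
    using subpolynomial by (auto simp: subpolynomial_def)
  have "\<forall>\<^sub>F n in sequentially. r n < 1 / 2" using r(1) by (rule order_tendstoD) simp
  moreover have "\<forall>\<^sub>F n in sequentially. h (size_of n) * h (size_of n) \<le> n"
    by (rule eventually_poly_bounded_le) (rule poly_bounded_mult [OF assms assms])
  ultimately show ?thesis using r(2) eventually_ge_at_top [of 1]
  proof eventually_elim
    fix n assume n: "r n < 1 / 2" "h (size_of n) * h (size_of n) \<le> n" "real (g n) = real n powr r n" "1 \<le> n"
    have "real (g n) \<le> real n powr (1 / 2)" unfolding n(3) using n(1,4) by (intro powr_mono) auto
    then have "real (g n) \<le> sqrt (real n)" using n(4) by (simp add: powr_half_sqrt)
    moreover have "real (h (size_of n)) \<le> sqrt (real n)"
      using n(2) by (intro real_le_rsqrt) (metis of_nat_le_iff of_nat_mult power2_eq_square)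
    ultimately have "real (h (size_of n)) * real (g n) \<le> sqrt (real n) * sqrt (real n)"
      by (intro mult_mono) auto
    then have "real (h (size_of n) * g n) \<le> real n" by simp
    then show "h (size_of n) * g n \<le> n" using of_nat_le_iff by blast
  qed
qed

end


section \<open>Basic sentences\<close>

lemma sat_funpow_FEx:
  "sat M e ((FEx ^^ k) p) \<longleftrightarrow> (\<exists>e'. (\<forall>i<k. e' i \<in> univ M) \<and> (\<forall>i. e' (i + k) = e i) \<and> sat M e' p)"
proof (induction k arbitrary: e)
  case 0
  have "(\<forall>i. e' i = e i) \<longleftrightarrow> e' = e" for e' by auto
  then show ?case by simp
next
  case (Suc k)
  have "(\<exists>a\<in>univ M. \<forall>i. e' (i + k) = case_nat a e i) \<longleftrightarrow> e' k \<in> univ M \<and> (\<forall>i. e' (i + Suc k) = e i)" for e'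
  proof
    assume "\<exists>a\<in>univ M. \<forall>i. e' (i + k) = case_nat a e i"
    then obtain a where a: "a \<in> univ M" "\<And>i. e' (i + k) = case_nat a e i" by blast
    show "e' k \<in> univ M \<and> (\<forall>i. e' (i + Suc k) = e i)" using a(1) a(2) [of 0] a(2) [of "Suc _"] by simp
  next
    assume a: "e' k \<in> univ M \<and> (\<forall>i. e' (i + Suc k) = e i)"
    then have "e' (i + k) = case_nat (e' k) e i" for i by (cases i) simp_all
    then show "\<exists>a\<in>univ M. \<forall>i. e' (i + k) = case_nat a e i" using a by blast
  qed
  then have "(\<exists>e'. (\<forall>i<Suc k. e' i \<in> univ M) \<and> (\<forall>i. e' (i + Suc k) = e i) \<and> sat M e' p) \<longleftrightarrow>
      (\<exists>e'. (\<forall>i<k. e' i \<in> univ M) \<and> (\<exists>a\<in>univ M. \<forall>i. e' (i + k) = case_nat a e i) \<and> sat M e' p)"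
    unfolding All_less_Suc by blast
  moreover have "sat M e ((FEx ^^ Suc k) p) \<longleftrightarrow>
      (\<exists>a\<in>univ M. \<exists>e'. (\<forall>i<k. e' i \<in> univ M) \<and> (\<forall>i. e' (i + k) = case_nat a e i) \<and> sat M e' p)"
    using Suc.IH by simp
  ultimately show ?case by blast
qed

text \<open>With only three possible values, \<open>Max\<close> is attained, which is how witnesses
  are extracted from a verified existential sentence.\<close>

lemma kval_range: "puniv P \<noteq> {} \<Longrightarrow> kval P e p \<in> {0, 1 / 2, 1}"
proof (induction p arbitrary: e)
  case (FAll p)
  have sub: "(\<lambda>a. kval P (case_nat a e) p) ` puniv P \<subseteq> {0, 1 / 2, 1}" using FAll by blast
  have "kval P e (FAll p) \<in> (\<lambda>a. kval P (case_nat a e) p) ` puniv P"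
    unfolding kval.simps by (rule Min_in) (use FAll.prems finite_subset [OF sub] in auto)
  then show ?case using sub by blast
next
  case (FEx p)
  have sub: "(\<lambda>a. kval P (case_nat a e) p) ` puniv P \<subseteq> {0, 1 / 2, 1}" using FEx by blast
  have "kval P e (FEx p) \<in> (\<lambda>a. kval P (case_nat a e) p) ` puniv P"
    unfolding kval.simps by (rule Max_in) (use FEx.prems finite_subset [OF sub] in auto)
  then show ?case using sub by blast
next
  case (FNeg p)
  then show ?case using FNeg.IH [of e] by auto
next
  case (FAnd p q)
  then show ?case using FAnd.IH [of e] by (auto simp: min_def)
next
  case (FOr p q)
  then show ?case using FOr.IH [of e] by (auto simp: max_def)
qed (auto simp: tv_def Let_def split: option.splits)

lemma kval_funpow_FEx:
  assumes "puniv P \<noteq> {}"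
  shows "kval P e ((FEx ^^ k) p) = 1 \<Longrightarrow> \<exists>e'. (\<forall>i<k. e' i \<in> puniv P) \<and> (\<forall>i. e' (i + k) = e i) \<and> kval P e' p = 1"
proof (induction k arbitrary: e)
  case 0
  then show ?case by auto
next
  case (Suc k)
  have sub: "(\<lambda>a. kval P (case_nat a e) ((FEx ^^ k) p)) ` puniv P \<subseteq> {0, 1 / 2, 1}"
    using kval_range [OF assms] by blast
  have "kval P e (FEx ((FEx ^^ k) p)) \<in> (\<lambda>a. kval P (case_nat a e) ((FEx ^^ k) p)) ` puniv P"
    unfolding kval.simps by (rule Max_in) (use assms finite_subset [OF sub] in auto)
  then obtain a where a: "a \<in> puniv P" "kval P (case_nat a e) ((FEx ^^ k) p) = 1" using Suc.prems by auto
  obtain e' where e': "\<forall>i<k. e' i \<in> puniv P" "\<forall>i. e' (i + k) = case_nat a e i" "kval P e' p = 1"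
    using Suc.IH [OF a(2)] by blast
  have "e' k = a" "e' (i + Suc k) = e i" for i
    using e'(2) [rule_format, of 0] e'(2) [rule_format, of "Suc i"] by simp_all
  then show ?case using e'(1,3) a(1) by (intro exI [of _ e']) (auto simp: less_Suc_eq)
qed

lemma sat_matrix: "sat M e (matrix \<phi>) \<longleftrightarrow> (\<exists>c\<in>set (dnf \<phi>). \<forall>l\<in>set c. sat M e (literal_fm l))"
proof -
  have "sat M e (foldr FOr ps FBot) \<longleftrightarrow> (\<exists>p\<in>set ps. sat M e p)" for ps by (induction ps) auto
  moreover have "sat M e (foldr FAnd ps (FNeg FBot)) \<longleftrightarrow> (\<forall>p\<in>set ps. sat M e p)" for ps by (induction ps) auto
  ultimately show ?thesis by (simp add: matrix_def)
qed

lemma kval_matrix: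
  assumes "puniv P \<noteq> {}" "kval P e (matrix \<phi>) = 1"
  shows "\<exists>c\<in>set (dnf \<phi>). \<forall>l\<in>set c. kval P e (literal_fm l) = 1"
proof -
  have le: "kval P e p \<le> 1" for p using kval_range [OF assms(1), of e p] by auto
  have "kval P e (foldr FOr ps FBot) = 1 \<Longrightarrow> \<exists>p\<in>set ps. kval P e p = 1" for ps
    by (induction ps) (auto simp: max_def split: if_splits)
  moreover have "kval P e (foldr FAnd ps (FNeg FBot)) = 1 \<Longrightarrow> \<forall>p\<in>set ps. kval P e p = 1" for ps
  proof (induction ps)
    case (Cons p ps)
    then show ?case using le [of p] le [of "foldr FAnd ps (FNeg FBot)"] by (auto simp: min_def split: if_splits)
  qed simp
  ultimately show ?thesis using assms(2) unfolding matrix_def by fastforce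
qed

lemma fv_literal: "wf_literal L k l \<Longrightarrow> fv (literal_fm l) \<subseteq> {..<k}"
  by (cases l) auto

lemma sat_literal_cong:
  assumes "wf_literal L k l" "\<And>i. i < k \<Longrightarrow> e i = e' i"
  shows "sat M e (literal_fm l) = sat M e' (literal_fm l)"
  by (rule sat_cong) (use fv_literal [OF assms(1)] assms(2) in auto)

lemma wf_basic_literal: "wf_basic L \<phi> \<Longrightarrow> c \<in> set (dnf \<phi>) \<Longrightarrow> l \<in> set c \<Longrightarrow> wf_literal L (nvars \<phi>) l"
  by (auto simp: wf_basic_def)

lemma sat_matrix_cong:
  assumes "wf_basic L \<phi>" "\<And>i. i < nvars \<phi> \<Longrightarrow> e i = e' i"
  shows "sat M e (matrix \<phi>) = sat M e' (matrix \<phi>)"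
  unfolding sat_matrix using sat_literal_cong [OF wf_basic_literal [OF assms(1)], of _ _ e e' M] assms(2)
  by blast

text \<open>The entry of an L-structure that a literal consults, if any. Equations between variables
  and built-in literals do not depend on the oracle and consult none.\<close>

fun literal_index :: "literal \<Rightarrow> (nat \<Rightarrow> nat) \<Rightarrow> (nat \<times> nat list) set" where
  "literal_index (PosRel (LR S) us) y = {(S, map y us)}"
| "literal_index (NegRel (LR S) us) y = {(S, map y us)}"
| "literal_index (FunEq (LF S) us v) y = {(S, map y us)}"
| "literal_index _ y = {}"

definition all_indices :: "lang \<Rightarrow> nat \<Rightarrow> (nat \<times> nat list) set" where
  "all_indices L u = (SIGMA S : funs L \<union> rels L. tuples {..<u} (ar L S))"

lemma finite_tuples: "finite A \<Longrightarrow> finite (tuples A k)"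
  by (simp add: tuples_def finite_lists_length_eq)

lemma finite_all_indices: "finite_lang L \<Longrightarrow> finite (all_indices L u)"
  unfolding all_indices_def by (intro finite_SigmaI finite_tuples) (auto simp: finite_lang_def)

lemma card_all_indices: "finite_lang L \<Longrightarrow> card (all_indices L u) = max_size L u"
  unfolding all_indices_def max_size_def
  by (subst card_SigmaI) (auto simp: finite_lang_def tuples_def card_lists_length_eq finite_lists_length_eq)

lemma literal_index_subset:
  assumes "wf_literal L k l" "\<And>i. i < k \<Longrightarrow> y i < u"
  shows "literal_index l y \<subseteq> all_indices L u"
proof -
  have "map y us \<in> tuples {..<u} m" if "set us \<subseteq> {..<k}" "length us = m" for us m
    using that assms(2) by (auto simp: tuples_def)
  then show ?thesis using assms(1)
    by (cases "(l, y)" rule: literal_index.cases) (auto simp: all_indices_def)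
qed

lemma card_literal_index: "finite (literal_index l y) \<and> card (literal_index l y) \<le> 1"
  by (cases "(l, y)" rule: literal_index.cases) auto

text \<open>Truth values are coded as numbers so that relations and functions yield one family of
  number-valued decision trees.\<close>

definition struct_value :: "lang \<Rightarrow> nat lstr \<Rightarrow> nat \<times> nat list \<Rightarrow> nat" where
  "struct_value L M = (\<lambda>(S, as). if S \<in> funs L then fn M (LF S) as else of_bool (rl M (LR S) as))"

lemma univ_bin_code [simp]: "univ (bin_code u X) = {..<u}"
  by (simp add: bin_code_def with_PV_def)

lemma bin_code_PV [simp]:
  "fn (bin_code u X) (PVF f) = pv_val {} f" "rl (bin_code u X) PVLess = (\<lambda>as. as ! 0 < as ! 1)"
  by (simp_all add: bin_code_def with_PV_def)

lemma bin_code_rel: "rl (bin_code u X) (LR S) as \<longleftrightarrow> tup (S # as) \<in> X"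
  by (simp add: bin_code_def with_PV_def)

lemma bin_code_fn: "fn (bin_code u X) (LF S) as =
    min (\<Sum>i<blen u. of_bool (tup (S # as @ [i]) \<in> X) * 2 ^ i) (u - 1)"
  by (simp add: bin_code_def with_PV_def)

lemma sat_literal_value_cong:
  assumes "finite_lang L" "wf_literal L k l"
    and "\<And>i. i \<in> literal_index l y \<Longrightarrow> struct_value L (bin_code u X) i = struct_value L (bin_code u X') i"
  shows "sat (bin_code u X) y (literal_fm l) = sat (bin_code u X') y (literal_fm l)"
proof -
  have disj: "S \<notin> funs L" if "S \<in> rels L" for S using assms(1) that by (auto simp: finite_lang_def)
  show ?thesis using assms(2,3) disj
    by (cases "(l, y)" rule: literal_index.cases) (auto simp: struct_value_def comp_def of_bool_def split: if_splits)
qed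

text \<open>Serves the finitely many small universes, about which the asymptotic condition of
  weakness gives no information.\<close>

lemma principle_witness:
  assumes "finitary_principle L \<phi>" "0 < u"
  shows "\<exists>y. \<exists>c\<in>set (dnf \<phi>). (\<forall>j<nvars \<phi>. y j < u) \<and> (\<forall>l\<in>set c. sat (bin_code u X) y (literal_fm l))"
proof -
  have "models (bin_code u X) (sentence \<phi>)"
    unfolding bin_code_def
    by (rule assms(1) [unfolded finitary_principle_def, THEN conjunct2, THEN conjunct2, rule_format, of u])
      (use assms(2) in \<open>auto simp: is_structure_def min_less_iff_disj\<close>)
  then have "sat (bin_code u X) (\<lambda>_. 0) (sentence \<phi>)" using assms(2) by (auto simp: models_def)
  then show ?thesis unfolding sentence_def sat_funpow_FEx sat_matrix by auto
qed

lemma psize_le: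
  assumes "finite_lang L" "puniv P = {..<u}"
  shows "psize L P \<le> max_size L u"
  unfolding psize_def card_all_indices [OF assms(1), symmetric]
  by (rule card_mono [OF finite_all_indices [OF assms(1)]]) (auto simp: all_indices_def assms(2))

text \<open>Undefine all entries outside of J. By determinacy the sentence is still verified, and a
  literal of Kleene value 1 can consult only defined entries, so the disjunct found depends on J
  alone.\<close>

lemma partial_witness:
  assumes "finitary_principle L \<phi>" "0 < u" "J \<subseteq> all_indices L u" "determinacy L \<phi> u \<le> card J"
  shows "\<exists>y. \<exists>c\<in>set (dnf \<phi>). (\<forall>j<nvars \<phi>. y j < u) \<and>
    (\<forall>l\<in>set c. sat (bin_code u X) y (literal_fm l) \<and> literal_index l y \<subseteq> J)"
proof -
  let ?M = "bin_code u X"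
  have fin: "finite_lang L" and wf: "wf_basic L \<phi>" using assms(1) by (auto simp: finitary_principle_def)
  define P :: "nat plstr" where "P = \<lparr>puniv = {..<u},
    pfn = \<lambda>s as. (case s of LF S \<Rightarrow> if (S, as) \<in> J then Some (fn ?M (LF S) as) else None | PVF f \<Rightarrow> None),
    prl = \<lambda>s as. (case s of LR S \<Rightarrow> if (S, as) \<in> J then Some (rl ?M (LR S) as) else None | PVLess \<Rightarrow> None)\<rparr>"
  have "{(S, as). S \<in> funs L \<and> as \<in> tuples (puniv P) (ar L S) \<and> pfn P (LF S) as \<noteq> None} \<union>
      {(S, as). S \<in> rels L \<and> as \<in> tuples (puniv P) (ar L S) \<and> prl P (LR S) as \<noteq> None} = J"
    using assms(3) by (auto simp: P_def all_indices_def split: if_splits)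
  then have size: "psize L P = card J" by (simp add: psize_def)
  have str: "is_pstructure L P"
    using assms(2) by (auto simp: is_pstructure_def P_def bin_code_fn min_less_iff_disj split: if_splits)
  have "verifies (pwith_PV P) (sentence \<phi>)"
  proof -
    let ?D = "\<lambda>m. \<forall>P. puniv P = {..<u} \<and> is_pstructure L P \<and> m \<le> psize L P \<longrightarrow> verifies (pwith_PV P) (sentence \<phi>)"
    \<comment> \<open>No partial structure has this size, so the minimum defining the determinacy is
      taken over a nonempty set.\<close>
    have "?D (Suc (max_size L u))" using psize_le [OF fin] by (metis Suc_n_not_le_n order_trans)
    then have "?D (LEAST m. ?D m)" by (rule LeastI)
    then have "?D (determinacy L \<phi> u)" by (simp only: determinacy_def)
    then show ?thesis using str size assms(4) by (auto simp: P_def)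
  qed
  then have "kval (pwith_PV P) (\<lambda>_. 0) (sentence \<phi>) = 1"
    using assms(2) by (auto simp: verifies_def pwith_PV_def P_def)
  then obtain y where y: "\<forall>i<nvars \<phi>. y i < u" "kval (pwith_PV P) y (matrix \<phi>) = 1"
    unfolding sentence_def using kval_funpow_FEx [of "pwith_PV P" "\<lambda>_. 0" "nvars \<phi>" "matrix \<phi>"] assms(2)
    by (auto simp: pwith_PV_def P_def)
  then obtain c where c: "c \<in> set (dnf \<phi>)" "\<forall>l\<in>set c. kval (pwith_PV P) y (literal_fm l) = 1"
    using kval_matrix [of "pwith_PV P" y \<phi>] assms(2) by (auto simp: pwith_PV_def P_def)
  have None: "None \<notin> set (map (ptval (pwith_PV P) y) (map Var us))" for us by auto
  have the: "map the (map (ptval (pwith_PV P) y) (map Var us)) = map y us" for us by simp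
  have tv: "tv b = 1 \<Longrightarrow> b = Some True" "1 - tv b = 1 \<Longrightarrow> b = Some False" for b
    by (auto simp: tv_def split: option.splits)
  have "sat ?M y (literal_fm l) \<and> literal_index l y \<subseteq> J" if l: "kval (pwith_PV P) y (literal_fm l) = 1" for l
  proof (cases l)
    case (PosRel r us)
    then have "tv (prl (pwith_PV P) r (map y us)) = 1"
      using l unfolding PosRel literal_fm.simps kval.simps Let_def the using None by (simp del: set_map map_map)
    then have "prl (pwith_PV P) r (map y us) = Some True" by (rule tv(1))
    then show ?thesis
      by (cases r) (auto simp: PosRel pwith_PV_def P_def comp_def split: if_splits)
  next
    case (NegRel r us)
    then have "1 - tv (prl (pwith_PV P) r (map y us)) = 1"
      using l unfolding NegRel literal_fm.simps kval.simps Let_def the using None by (simp del: set_map map_map)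
    then have "prl (pwith_PV P) r (map y us) = Some False" by (rule tv(2))
    then show ?thesis
      by (cases r) (auto simp: NegRel pwith_PV_def P_def comp_def split: if_splits)
  next
    case (FunEq f us v)
    have t: "ptval (pwith_PV P) y (Fn f (map Var us)) = pfn (pwith_PV P) f (map y us)"
      unfolding ptval.simps Let_def the using None by (simp del: set_map map_map)
    have "pfn (pwith_PV P) f (map y us) = Some (y v)"
      using l unfolding FunEq literal_fm.simps kval.simps t
      by (auto split: option.splits if_splits)
    then show ?thesis
      by (cases f) (auto simp: FunEq pwith_PV_def P_def comp_def split: if_splits)
  qed (use l in \<open>auto split: if_splits\<close>)
  then show ?thesis using y(1) c by blast
qed

text \<open>As soon as \<open>n powr \<epsilon>\<close> reaches 2, any half of the entries of a
  structure is enough to verify the sentence.\<close>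

lemma weak_half:
  assumes "weak L \<phi>"
  shows "\<exists>u0. \<forall>u\<ge>u0. 2 * determinacy L \<phi> u \<le> max_size L u"
proof -
  obtain \<epsilon> where \<epsilon>: "\<epsilon> > 0" "\<forall>\<^sub>F n in sequentially. real (max_size L n) \<ge> real n powr \<epsilon> * real (determinacy L \<phi> n)"
    using assms by (auto simp: weak_def)
  have "\<forall>\<^sub>F n in sequentially. real n \<ge> 2 powr (1 / \<epsilon>)"
    using filterlim_real_sequentially by (auto simp: filterlim_at_top)
  with \<epsilon>(2) have "\<forall>\<^sub>F n in sequentially. 2 * determinacy L \<phi> n \<le> max_size L n"
  proof eventually_elim
    fix n assume n: "real (max_size L n) \<ge> real n powr \<epsilon> * real (determinacy L \<phi> n)" "real n \<ge> 2 powr (1 / \<epsilon>)"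
    have "2 = (2 powr (1 / \<epsilon>)) powr \<epsilon>" using \<epsilon>(1) by (simp add: powr_powr)
    also have "\<dots> \<le> real n powr \<epsilon>" using n(2) \<epsilon>(1) by (intro powr_mono2) auto
    finally have "2 * real (determinacy L \<phi> n) \<le> real n powr \<epsilon> * real (determinacy L \<phi> n)"
      by (intro mult_right_mono) auto
    then have "real (2 * determinacy L \<phi> n) \<le> real (max_size L n)" using n(1) by simp
    then show "2 * determinacy L \<phi> n \<le> max_size L n" using of_nat_le_iff by blast
  qed
  then show ?thesis by (auto simp: eventually_sequentially)
qed


section \<open>Computing the values of a binary code\<close>

lemma blen_pair:
  assumes "blen a \<le> m" "blen b \<le> m"
  shows "blen (Suc (prod_encode (a, b))) \<le> 2 * m + 3"
proof -
  have ab: "a < 2 ^ m" "b < 2 ^ m" using assms by (simp_all add: blen_iff)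
  have "triangle k \<le> k * k" for k by (induction k) auto
  then have "prod_encode (a, b) \<le> (a + b) * (a + b) + a" by (simp add: prod_encode_def)
  also have "\<dots> < (a + b + 1) * (a + b + 1)" by (simp add: algebra_simps)
  also have "\<dots> \<le> (2 * 2 ^ m) * (2 * 2 ^ m)" using ab by (intro mult_le_mono) auto
  also have "\<dots> = 2 ^ (Suc m + Suc m)" unfolding power_add by simp
  finally have "Suc (prod_encode (a, b)) \<le> 2 ^ (Suc m + Suc m)" by simp
  also have "(2::nat) ^ (Suc m + Suc m) < 2 ^ (2 * m + 3)" by (rule power_strict_increasing) simp_all
  finally have "Suc (prod_encode (a, b)) < 2 ^ (2 * m + 3)" .
  then show ?thesis by (simp add: blen_iff)
qed

text \<open>Pairing takes lengths up to m to at most \<open>2 * m + 3\<close>; adding 3 turns this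
  recursion into pure doubling. The power of two is harmless, because the tuples that occur have
  bounded length.\<close>

lemma blen_tup: "(\<And>x. x \<in> set xs \<Longrightarrow> blen x \<le> b) \<Longrightarrow> blen (tup xs) + 3 \<le> 2 ^ length xs * (b + 3)"
proof (induction xs)
  case Nil
  then show ?case by (simp add: tup_def floorlog_def)
next
  case (Cons x xs)
  let ?m = "max b (blen (tup xs))"
  have "blen (tup (x # xs)) \<le> 2 * ?m + 3"
    unfolding tup_def list_encode.simps by (rule blen_pair) (use Cons.prems in \<open>auto simp: tup_def le_max_iff_disj\<close>)
  moreover have "?m + 3 \<le> 2 ^ length xs * (b + 3)"
  proof -
    have "1 * (b + 3) \<le> 2 ^ length xs * (b + 3)" by (rule mult_le_mono1) simp
    then show ?thesis using Cons by (simp add: max_def)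
  qed
  ultimately show ?case by simp
qed

lemma dtree_alpha_subst:
  assumes "f \<in> PVa" "fst f = Suc m"
  shows "\<exists>d. \<forall>N\<ge>2. \<forall>x zs. blen x \<le> N ^ c \<longrightarrow> length zs = m \<longrightarrow> (\<forall>z\<in>set zs. blen z \<le> N ^ c) \<longrightarrow>
    (\<lambda>A. x \<in> alpha_subst f zs A) \<in> dtree (N ^ d)"
proof -
  obtain d where d: "\<And>N Fs. N \<ge> 2 \<Longrightarrow> length Fs = fst f \<Longrightarrow> (\<And>F. F \<in> set Fs \<Longrightarrow> small c N F) \<Longrightarrow>
      small d N (\<lambda>A. pv_val A f (map (\<lambda>F. F A) Fs))"
    by (rule small_pv_val [OF assms(1), where c = c]) blast
  have "(\<lambda>A. x \<in> alpha_subst f zs A) \<in> dtree (N ^ d)"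
    if "N \<ge> 2" "blen x \<le> N ^ c" "length zs = m" "\<forall>z\<in>set zs. blen z \<le> N ^ c" for N x zs
  proof -
    have "small d N (\<lambda>A. pv_val A f (map (\<lambda>F. F A) (map (\<lambda>x A. x) (x # zs))))"
      by (rule d) (use that assms(2) in \<open>auto simp: small_def\<close>)
    then have "(\<lambda>A. pv_val A f (x # zs)) \<in> dtree (N ^ d)" by (simp add: small_def comp_def)
    from dtree_map [OF this, of "\<lambda>v. v = 0"] show ?thesis by (simp add: alpha_subst_def)
  qed
  then show ?thesis by blast
qed

text \<open>An entry takes one query for a relation and \<open>blen u\<close> queries for a
  function, and each is a membership in the substituted oracle, computed by a run of f.\<close>

lemma dtree_struct_value:
  assumes "f \<in> PVa" "fst f = Suc m" "finite_lang L"
  shows "\<exists>d. \<forall>N\<ge>2. \<forall>u zs. blen u \<le> N ^ c \<longrightarrow> length zs = m \<longrightarrow> (\<forall>z\<in>set zs. blen z \<le> N ^ c) \<longrightarrow>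
    (\<forall>i\<in>all_indices L u. (\<lambda>A. struct_value L (bin_code u (alpha_subst f zs A)) i) \<in> dtree (N ^ d))"
proof -
  define s where "s = (\<Sum>S\<in>funs L \<union> rels L. S)"
  define l where "l = (\<Sum>S\<in>funs L \<union> rels L. ar L S)"
  have fin: "finite (funs L \<union> rels L)" using assms(3) by (simp add: finite_lang_def)
  have s: "S \<le> s" "ar L S \<le> l" if "S \<in> funs L \<union> rels L" for S
    unfolding s_def l_def using member_le_sum [OF that _ fin, of "\<lambda>S. S"] member_le_sum [OF that _ fin, of "ar L"]
    by simp_all
  \<comment> \<open>A query has at most l + 2 components: the symbol, its arguments and a bit
    position. The summand s accounts for the number of the symbol.\<close>
  have "poly_bounded (\<lambda>N. N ^ c + 2 ^ (l + 2) * ((N ^ c + s) + 3))"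
    by (intro poly_bounded_add poly_bounded_mult poly_bounded_const poly_bounded_power)
  then obtain c' where c': "\<forall>N::nat\<ge>2. N ^ c + 2 ^ (l + 2) * ((N ^ c + s) + 3) \<le> N ^ c'"
    unfolding poly_bounded_def by blast
  obtain d where d: "\<And>N x zs. N \<ge> 2 \<Longrightarrow> blen x \<le> N ^ c' \<Longrightarrow> length zs = m \<Longrightarrow> \<forall>z\<in>set zs. blen z \<le> N ^ c' \<Longrightarrow>
    (\<lambda>A. x \<in> alpha_subst f zs A) \<in> dtree (N ^ d)"
    using dtree_alpha_subst [OF assms(1,2), of c'] by blast
  have "poly_bounded (\<lambda>N. N ^ d + N ^ c * N ^ d)"
    by (intro poly_bounded_add poly_bounded_mult poly_bounded_power)
  then obtain d' where d': "\<forall>N::nat\<ge>2. N ^ d + N ^ c * N ^ d \<le> N ^ d'"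
    unfolding poly_bounded_def by blast
  have "(\<lambda>A. struct_value L (bin_code u (alpha_subst f zs A)) i) \<in> dtree (N ^ d')"
    if N: "N \<ge> 2" and u: "blen u \<le> N ^ c" and zs: "length zs = m" "\<forall>z\<in>set zs. blen z \<le> N ^ c"
      and i: "i \<in> all_indices L u" for N u zs i
  proof -
    obtain S as where S: "i = (S, as)" "S \<in> funs L \<union> rels L" "as \<in> tuples {..<u} (ar L S)"
      using i by (auto simp: all_indices_def)
    have zs': "\<forall>z\<in>set zs. blen z \<le> N ^ c'"
      using zs(2) c' [rule_format, OF N] by (meson add_leD1 order_trans)
    have q: "(\<lambda>A. tup xs \<in> alpha_subst f zs A) \<in> dtree (N ^ d)"
      if "\<And>x. x \<in> set xs \<Longrightarrow> blen x \<le> N ^ c + s" "length xs \<le> l + 2" for xs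
    proof (rule d [OF N _ zs(1) zs'])
      have "(2::nat) ^ length xs \<le> 2 ^ (l + 2)" using that(2) by (intro power_increasing) auto
      then have "2 ^ length xs * ((N ^ c + s) + 3) \<le> 2 ^ (l + 2) * ((N ^ c + s) + 3)" by (rule mult_le_mono1)
      then show "blen (tup xs) \<le> N ^ c'"
        using blen_tup [of xs "N ^ c + s", OF that(1)] c' [rule_format, OF N] by linarith
    qed
    have len: "length as \<le> l" using S(3) s(2) [OF S(2)] by (simp add: tuples_def)
    have blen_as: "blen a \<le> N ^ c + s" if "a \<in> set as" for a
    proof -
      have "blen a \<le> blen u" using S(3) that by (intro floorlog_mono) (auto simp: tuples_def)
      then show ?thesis using u by linarith
    qed
    have blen_S: "blen S \<le> N ^ c + s" using le_blen [of S] s(1) [OF S(2)] by linarith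
    show ?thesis
    proof (cases "S \<in> funs L")
      case True
      have "(\<lambda>A. tup (S # as @ [j]) \<in> alpha_subst f zs A) \<in> dtree (N ^ d)" if "j < blen u" for j
        by (rule q) (use le_blen [of j] that u len blen_as blen_S in auto)
      then have "(\<lambda>A. map (\<lambda>j. tup (S # as @ [j]) \<in> alpha_subst f zs A) [0..<blen u]) \<in> dtree (blen u * N ^ d)"
        by (rule dtree_upt)
      from dtree_map [OF this, of "\<lambda>bs. min (\<Sum>j<blen u. of_bool (bs ! j) * 2 ^ j) (u - 1)"]
      have "(\<lambda>A. struct_value L (bin_code u (alpha_subst f zs A)) i) \<in> dtree (blen u * N ^ d)"
        by (simp add: S(1) True struct_value_def bin_code_fn)
      moreover have "blen u * N ^ d \<le> N ^ d'"
        using mult_le_mono1 [OF u, of "N ^ d"] d' [rule_format, OF N] by linarith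
      ultimately show ?thesis by (rule dtree_mono)
    next
      case False
      have "(\<lambda>A. tup (S # as) \<in> alpha_subst f zs A) \<in> dtree (N ^ d)"
        by (rule q) (use len blen_as blen_S in auto)
      from dtree_map [OF this, of of_bool]
      have "(\<lambda>A. struct_value L (bin_code u (alpha_subst f zs A)) i) \<in> dtree (N ^ d)"
        by (simp add: S(1) False struct_value_def bin_code_rel)
      then show ?thesis by (rule dtree_mono) (use d' [rule_format, OF N] in linarith)
    qed
  qed
  then show ?thesis by blast
qed

lemma proj_tup: "proj (tup (map y [0..<k])) j = (if j < k then y j else 0)"
  by (simp add: proj_def tup_def Let_def)


section \<open>Weak principles are forced, strong ones are not\<close>

lemma sharply_bounded_mono: "p \<in> sharply_bounded F \<Longrightarrow> F \<subseteq> G \<Longrightarrow> p \<in> sharply_bounded G"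
proof (induction rule: sharply_bounded.induct)
  case (qf p)
  have "wf_fm F a r p \<Longrightarrow> wf_fm G a r p" for a r
    using qf.prems by (induction p) (auto simp: list_all_iff intro: wf_tm_mono)
  then show ?case using qf.hyps by (intro sharply_bounded.qf)
qed (auto intro: sharply_bounded.intros wf_tm_mono)

lemma sum_of_bool_bit: "v < 2 ^ l \<Longrightarrow> (\<Sum>i<l. of_bool (bit v i) * 2 ^ i) = (v :: nat)"
proof -
  assume "v < 2 ^ l"
  have "(\<Sum>i<l. of_bool (bit v i) * 2 ^ i) = horner_sum of_bool (2 :: nat) (map (bit v) [0..<l])"
    by (simp add: horner_sum_eq_sum lessThan_atLeast0)
  also have "\<dots> = take_bit l v" by (simp add: horner_sum_bit_eq_take_bit)
  also have "\<dots> = v" using \<open>v < 2 ^ l\<close> by (simp add: take_bit_nat_eq_self)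
  finally show ?thesis .
qed

section \<open>No condition forces a solution for a strong principle\<close>

context infinite_structure
begin

lemma cond_close_list:
  assumes "cond n (K, h)" "\<And>S as. (S, as) \<in> set xs \<Longrightarrow> S \<in> funs L \<and> as \<in> tuples {..<n} (ar L S)"
    and "card K + length xs * width \<le> n"
  shows "\<exists>K' h'. cond n (K', h') \<and> K \<subseteq> K' \<and> (\<forall>k\<in>K. h' k = h k) \<and>
    (\<forall>(S, as)\<in>set xs. set as \<subseteq> K' \<and> (\<exists>v\<in>K'. h' v = fn B (LF S) (map h' as)))"
  using assms
proof (induction xs arbitrary: K h)
  case Nil
  then show ?case by (intro exI [of _ K] exI [of _ h]) simp
next
  case (Cons x xs)
  obtain S as where x: "x = (S, as)" by fastforce
  have S: "S \<in> funs L" "as \<in> tuples {..<n} (ar L S)" using Cons.prems(2) [of S as] x by auto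
  have w: "Suc (ar L S) \<le> width" using ar_width S(1) by blast
  have "card K + Suc (ar L S) \<le> n" using Cons.prems(3) w by simp
  then obtain K1 h1 where K1: "cond n (K1, h1)" "K \<subseteq> K1" "set as \<subseteq> K1" "\<forall>k\<in>K. h1 k = h k"
    "card K1 \<le> card K + Suc (ar L S)" "\<exists>v\<in>K1. h1 v = fn B (LF S) (map h1 as)"
    using cond_close [OF Cons.prems(1) S] by blast
  have "card K1 + length xs * width \<le> n" using Cons.prems(3) w K1(5) by simp
  then obtain K' h' where K': "cond n (K', h')" "K1 \<subseteq> K'" "\<forall>k\<in>K1. h' k = h1 k"
    "\<forall>(S, as)\<in>set xs. set as \<subseteq> K' \<and> (\<exists>v\<in>K'. h' v = fn B (LF S) (map h' as))"
    using Cons.IH [OF K1(1) Cons.prems(2)] by auto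
  have "map h' as = map h1 as" using K'(3) K1(3) by auto
  obtain v where v: "v \<in> K1" "h1 v = fn B (LF S) (map h1 as)" using K1(6) by blast
  have "v \<in> K'" "h' v = fn B (LF S) (map h' as)"
    using v K'(2,3) unfolding \<open>map h' as = map h1 as\<close> by auto
  then have "\<exists>v\<in>K'. h' v = fn B (LF S) (map h' as)" by blast
  then show ?case using K' K1(2-4) unfolding x by (intro exI [of _ K'] exI [of _ h']) auto
qed

text \<open>Where the arguments, and for functions also the value, have names, the binary code is
  the structure pulled back from B along the naming.\<close>

lemma bin_code_agree:
  assumes "cond n (K, h)" "agree (lits n (K, h)) A" "set us \<subseteq> K"
  shows "S \<in> rels L \<Longrightarrow> length us = ar L S \<Longrightarrow> rl (bin_code n A) (LR S) us = rl B (LR S) (map h us)"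
    and "S \<in> funs L \<Longrightarrow> length us = ar L S \<Longrightarrow> v \<in> K \<Longrightarrow> h v = fn B (LF S) (map h us) \<Longrightarrow>
      fn (bin_code n A) (LF S) us = v"
proof -
  have us: "us \<in> tuples K (length us)" using assms(3) by (simp add: tuples_def)
  show "rl (bin_code n A) (LR S) us = rl B (LR S) (map h us)" if "S \<in> rels L" "length us = ar L S"
  proof -
    have "rel_code K (tup (S # us)) S us" using that us by (simp add: rel_code_def)
    from lits_rel [OF this, of h n] show ?thesis using assms(2) by (auto simp: agree_def bin_code_rel)
  qed
  show "fn (bin_code n A) (LF S) us = v"
    if S: "S \<in> funs L" "length us = ar L S" and v: "v \<in> K" "h v = fn B (LF S) (map h us)"
  proof -
    have "tup (S # us @ [i]) \<in> A \<longleftrightarrow> bit v i" if i: "i < blen n" for i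
    proof -
      have "fun_code n K (tup (S # us @ [i])) S us i" using i us S by (simp add: fun_code_def)
      from lits_fun [OF this v] show ?thesis using assms(2) by (auto simp: agree_def)
    qed
    then have "(\<Sum>i<blen n. of_bool (tup (S # us @ [i]) \<in> A) * (2 :: nat) ^ i) =
        (\<Sum>i<blen n. of_bool (bit v i) * 2 ^ i)"
      by (intro sum.cong) simp_all
    moreover have vn: "v < n" using assms(1) v(1) by (auto simp: cond_def)
    moreover from vn have "v < 2 ^ blen n" using blen_iff [of n "blen n"] by linarith
    then have "(\<Sum>i<blen n. of_bool (bit v i) * 2 ^ i) = v" by (rule sum_of_bool_bit)
    ultimately have "(\<Sum>i<blen n. of_bool (tup (S # us @ [i]) \<in> A) * 2 ^ i) = v"
      using sum_of_bool_bit [of v "blen n"] by argo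
    \<comment> \<open>The cap at n - 1 has no effect, since names are below n.\<close>
    then show ?thesis unfolding bin_code_fn using vn by simp
  qed
qed

text \<open>A solution y would be a tuple of numbers below n. Naming its components and the function
  values that the matrix mentions turns it into a tuple of B satisfying the matrix. Built-in symbols
  have to be absent because the naming does not transfer their meaning to B.\<close>

lemma not_forces_strong:
  assumes Q: "expresses_Q \<phi> Q" and wf: "wf_basic L \<phi>" and nb: "without_builtin \<phi>"
    and B: "models B (FNeg (sentence \<phi>))"
    and P: "P \<in> Pos" and e: "range e \<subseteq> Nm" and e0: "e 0 = (\<lambda>(n, A). n)"
  shows "\<not> forces P e (FEx Q)"
proof
  assume "forces P e (FEx Q)"
  then obtain R x where R: "R \<in> below P" "x \<in> Nm" "forces R (case_nat x e) Q"
    unfolding forces.simps using dense_belowD below_refl [OF P] by blast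
  have sb: "Q \<in> sharply_bounded PVa"
    using Q sharply_bounded_mono [OF _ PV_subset] by (simp add: expresses_Q_def)
  obtain R1 where R1: "R1 \<in> below R" "SF R1 (case_nat x e) Q"
    using forces_SF [OF sb below_Pos [OF R(1)] range_case_nat [OF R(2) e] R(3)] by blast
  obtain R2 X where R2: "R2 \<in> below R1" "\<forall>(n, A)\<in>pts R2. x (n, A) = X n"
    using decide_name [OF below_Pos [OF R1(1)] R(2)] by blast
  define k where "k = nvars \<phi>"
  \<comment> \<open>The function entries that the matrix consults at y. Their number does not depend
    on y, so a constant number of additional names suffices to give all of them named
    values.\<close>
  define fs where "fs y = concat (map (\<lambda>c. concat (map (\<lambda>l. case l of FunEq (LF S) us v \<Rightarrow> [(S, map y us)] | _ \<Rightarrow> []) c)) (dnf \<phi>))"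
    for y :: "nat \<Rightarrow> nat"
  have len: "length (fs y) = length (fs (\<lambda>_. 0))" for y
    unfolding fs_def length_concat map_map
    by (intro arg_cong [where f = sum_list] map_cong refl)
      (auto simp: length_concat comp_def intro!: arg_cong [where f = sum_list] split: literal.splits fsym.splits)
  \<comment> \<open>The components of y and the entries need room; the successor ensures that n is
    positive.\<close>
  have "poly_bounded (\<lambda>N. Suc k + length (fs (\<lambda>_. 0)) * width)" by (rule poly_bounded_const)
  from below_room [OF below_Pos [OF R2(1)] this]
  obtain R3 where R3: "R3 \<in> below R2"
    "\<forall>n\<in>fst R3. card (fst (snd R3 n)) + (Suc k + length (fs (\<lambda>_. 0)) * width) \<le> n" by blast
  obtain n where n: "n \<in> fst R3" using Pos_nonempty [OF below_Pos [OF R3(1)]] by blast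
  obtain K h where Kh: "snd R3 n = (K, h)" by fastforce
  have cond: "cond n (K, h)" using Pos_cond [OF below_Pos [OF R3(1)] n] Kh by simp
  have room: "card K + (Suc k + length (fs (\<lambda>_. 0)) * width) \<le> n" using R3(2) n Kh by fastforce
  define y where "y = proj (X n)"
  have Qn: "(\<forall>j<k. y j < n) \<and> sat (bin_code n A) y (matrix \<phi>)" if A: "agree (lits n (K, h)) A" for A
  proof -
    have p3: "(n, A) \<in> pts R3" using n A Kh by (simp add: pts_def)
    then have p2: "(n, A) \<in> pts R2" "(n, A) \<in> pts R1" using pts_mono [OF R3(1)] pts_mono [OF R2(1)] by blast+
    have "(\<lambda>i. case_nat x e i (n, A)) = case_nat (X n) (case_nat n (\<lambda>i. e (Suc i) (n, A)))"
      using R2(2) p2(1) e0 by (auto simp: fun_eq_iff split: nat.splits)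
    then have "sat (std A) (case_nat (X n) (case_nat n (\<lambda>i. e (Suc i) (n, A)))) Q"
      using R1(2) p2(2) unfolding SF_def by force
    moreover have "0 < n" using room by simp
    ultimately show ?thesis using Q unfolding expresses_Q_def y_def k_def by blast
  qed
  have yn: "y j < n" if "j < k" for j using Qn agree_exists [OF cond] that by blast
  let ?Y = "y ` {..<k}"
  have Y: "?Y \<subseteq> {..<n}" using yn by auto
  obtain h1 where h1: "cond n (K \<union> ?Y, h1)" "\<forall>k\<in>K. h1 k = h k" using cond_add [OF cond Y] by blast
  have lit_wf: "wf_literal L k l \<and> \<not> builtin_literal l" if "c \<in> set (dnf \<phi>)" "l \<in> set c" for c l
    using that wf nb by (auto simp: wf_basic_def without_builtin_def k_def)
  have fs_wf: "S \<in> funs L \<and> as \<in> tuples {..<n} (ar L S)" if S: "(S, as) \<in> set (fs y)" for S as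
  proof -
    obtain c l where cl: "c \<in> set (dnf \<phi>)" "l \<in> set c" "(S, as) \<in> set (case l of FunEq (LF S) us v \<Rightarrow> [(S, map y us)] | _ \<Rightarrow> [])"
      using S unfolding fs_def by auto
    then obtain us v where l: "l = FunEq (LF S) us v" "as = map y us"
      by (auto split: literal.splits fsym.splits)
    then show ?thesis using lit_wf [OF cl(1,2)] yn by (auto simp: tuples_def)
  qed
  have "card (K \<union> ?Y) \<le> card K + k"
    using card_Un_le [of K ?Y] card_image_le [of "{..<k}" y] by simp
  then have "card (K \<union> ?Y) + length (fs y) * width \<le> n" using room len [of y] by simp
  have "\<exists>K' h'. cond n (K', h') \<and> K \<union> ?Y \<subseteq> K' \<and> (\<forall>k\<in>K \<union> ?Y. h' k = h1 k) \<and>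
    (\<forall>(S, as)\<in>set (fs y). set as \<subseteq> K' \<and> (\<exists>v\<in>K'. h' v = fn B (LF S) (map h' as)))"
    by (rule cond_close_list [OF h1(1) _ \<open>card (K \<union> ?Y) + length (fs y) * width \<le> n\<close>]) (rule fs_wf)
  then obtain K' h' where K': "cond n (K', h')" "K \<union> ?Y \<subseteq> K'" "\<forall>k\<in>K \<union> ?Y. h' k = h1 k"
    "\<forall>(S, as)\<in>set (fs y). set as \<subseteq> K' \<and> (\<exists>v\<in>K'. h' v = fn B (LF S) (map h' as))"
    by (elim exE conjE) (rule that)
  obtain A where A: "agree (lits n (K', h')) A" using agree_exists [OF K'(1)] by blast
  have "lits n (K, h) \<subseteq> lits n (K', h')"
    by (rule ext_lits [OF ext_same]) (use K' h1(2) in auto)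
  then have "sat (bin_code n A) y (matrix \<phi>)" using Qn A agree_mono by blast
  then obtain c where c: "c \<in> set (dnf \<phi>)" "\<forall>l\<in>set c. sat (bin_code n A) y (literal_fm l)"
    unfolding sat_matrix by blast
  have yK: "y j \<in> K'" if "j < k" for j using that K'(2) by auto
  have inj: "inj_on h' K'" and ran: "h' ` K' \<subseteq> univ B" using K'(1) by (auto simp: cond_def)
  have "sat B (\<lambda>j. h' (y j)) (literal_fm l)" if l: "l \<in> set c" for l
  proof -
    have sat: "sat (bin_code n A) y (literal_fm l)" using c(2) l by blast
    have lw: "wf_literal L k l" "\<not> builtin_literal l" using lit_wf [OF c(1) l] by auto
    have yus: "set (map y us) \<subseteq> K'" if "set us \<subseteq> {..<k}" for us using that yK by auto
    show ?thesis
    proof (cases l)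
      case (PosRel r us)
      then obtain S where r: "r = LR S" using lw by (cases r) auto
      then show ?thesis using sat lw bin_code_agree(1) [OF K'(1) A yus, of us S] by (simp add: PosRel comp_def)
    next
      case (NegRel r us)
      then obtain S where r: "r = LR S" using lw by (cases r) auto
      then show ?thesis using sat lw bin_code_agree(1) [OF K'(1) A yus, of us S] by (simp add: NegRel comp_def)
    next
      case (FunEq f us v)
      then obtain S where f: "f = LF S" using lw by (cases f) auto
      have "(S, map y us) \<in> set (fs y)" using c(1) l FunEq f by (force simp: fs_def)
      then obtain w where w: "w \<in> K'" "h' w = fn B (LF S) (map h' (map y us))" using K'(4) by blast
      have "fn (bin_code n A) (LF S) (map y us) = w"
        by (rule bin_code_agree(2) [OF K'(1) A yus]) (use lw w in \<open>auto simp: FunEq f\<close>)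
      moreover have "fn (bin_code n A) (LF S) (map y us) = y v" using sat by (simp add: FunEq f comp_def)
      ultimately show ?thesis using w(2) by (simp add: FunEq f comp_def)
    next
      case (NegEq u v)
      \<comment> \<open>Different names denote different elements.\<close>
      then show ?thesis using sat lw yK inj by (auto simp: inj_on_def)
    next
      case (PosEq u v)
      then show ?thesis using sat by simp
    qed
  qed
  then have "sat B (\<lambda>j. h' (y j)) (matrix \<phi>)" using c(1) unfolding sat_matrix by blast
  obtain b where b: "b \<in> univ B" using infinite_univ by fastforce
  define e' where "e' j = (if j < k then h' (y j) else b)" for j
  have "sat B e' (matrix \<phi>)"
    using \<open>sat B (\<lambda>j. h' (y j)) (matrix \<phi>)\<close> sat_matrix_cong [OF wf, of e' "\<lambda>j. h' (y j)" B] by (simp add: e'_def k_def)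
  moreover have "\<forall>i<k. e' i \<in> univ B" using yK ran by (auto simp: e'_def)
  moreover have "\<forall>i. e' (i + k) = (\<lambda>_. b) i" by (simp add: e'_def)
  ultimately have "sat B (\<lambda>_. b) (sentence \<phi>)" unfolding sentence_def sat_funpow_FEx k_def by blast
  then show False using B b by (auto simp: models_def)
qed

end

section \<open>Solutions for a weak principle are found below every condition\<close>

context large_structure
begin

text \<open>The solution y has to be the same for all oracles that agree with the extension, so that
  it can be the value of a name at n.\<close>

definition solvable :: "basic \<Rightarrow> psym \<Rightarrow> nat \<Rightarrow> 'a naming \<Rightarrow> nat \<Rightarrow> nat list \<Rightarrow> nat \<Rightarrow> bool" where
  "solvable \<phi> f n q u zs k \<longleftrightarrow> (\<exists>q' y. cond n q' \<and> ext n q' q \<and> card (fst q') \<le> card (fst q) + k \<and> blen y \<le> k \<and>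
     (\<forall>A. agree (lits n q') A \<longrightarrow> (\<forall>j<nvars \<phi>. proj y j < u) \<and>
       sat (bin_code u (alpha_subst f zs A)) (proj y) (matrix \<phi>)))"

text \<open>A naming of all numbers below n decides enough entries for some disjunct to be verified.
  That disjunct consults boundedly many entries, and only the names supporting their trees are
  kept.\<close>

lemma weak_witness:
  assumes fp: "finitary_principle L' \<phi>" and weak: "weak L' \<phi>" and f: "f \<in> PVa" "fst f = Suc m"
  shows "\<exists>d. \<forall>\<^sub>F n in sequentially. \<forall>q u zs. cond n q \<longrightarrow> card (fst q) \<le> size_of n ^ c \<longrightarrow> 0 < u \<longrightarrow>
    blen u \<le> size_of n ^ c \<longrightarrow> length zs = m \<longrightarrow> (\<forall>z\<in>set zs. blen z \<le> size_of n ^ c) \<longrightarrow>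
    solvable \<phi> f n q u zs (size_of n ^ d)"
proof -
  have fin: "finite_lang L'" and wf: "wf_basic L' \<phi>" using fp by (auto simp: finitary_principle_def)
  obtain t0 where t0: "\<forall>N\<ge>2. \<forall>u zs. blen u \<le> N ^ c \<longrightarrow> length zs = m \<longrightarrow> (\<forall>z\<in>set zs. blen z \<le> N ^ c) \<longrightarrow>
    (\<forall>i\<in>all_indices L' u. (\<lambda>A. struct_value L' (bin_code u (alpha_subst f zs A)) i) \<in> dtree (N ^ t0))"
    using dtree_struct_value [OF f fin, of c] by blast
  obtain u0 where u0: "\<forall>u\<ge>u0. 2 * determinacy L' \<phi> u \<le> max_size L' u" using weak_half [OF weak] by blast
  \<comment> \<open>Bounds the number of entries for u below u0, where all of them must be
    decided.\<close>
  define M where "M = (\<Sum>u<u0. max_size L' u)"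
  have M: "max_size L' u \<le> M" if "u < u0" for u unfolding M_def by (rule member_le_sum) (use that in auto)
  define b where "b = sum_list (map length (dnf \<phi>))"
  have b: "length ls \<le> b" if "ls \<in> set (dnf \<phi>)" for ls
    unfolding b_def by (rule member_le_sum_list) (use that in auto)
  define k where "k = nvars \<phi>"
  \<comment> \<open>From the loss in \<open>decide_most_trees\<close> with d = 0 and depth
    \<open>N ^ t0\<close>: the proportion of entries lost is at most \<open>X N * g n / r\<close>,
    where r counts the names outside of K.\<close>
  define X where "X N = N ^ t0 * (2 * (N ^ t0 * width))" for N :: nat
  have "poly_bounded (\<lambda>N. b * (N ^ t0 * width) + 2 ^ k * (N ^ c + 3))"
    by (intro poly_bounded_add poly_bounded_mult poly_bounded_const poly_bounded_power)
  then obtain d where d: "\<forall>N::nat\<ge>2. b * (N ^ t0 * width) + 2 ^ k * (N ^ c + 3) \<le> N ^ d"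
    unfolding poly_bounded_def by blast
  \<comment> \<open>Together with \<open>n < 2 * r\<close> this one inequality yields room for the
    reassigned names, a loss of at most half of the entries, and a loss of less than one entry out
    of M.\<close>
  have e1: "\<forall>\<^sub>F n in sequentially. 4 * ((X (size_of n) + 1) * (M + 1)) * g n \<le> n"
    by (rule eventually_subpolynomial) (unfold X_def, intro poly_bounded_add poly_bounded_mult poly_bounded_const poly_bounded_power)
  \<comment> \<open>More than half of the numbers below n lie outside of K.\<close>
  have e2: "\<forall>\<^sub>F n in sequentially. 2 * size_of n ^ c + 2 \<le> n"
    by (rule eventually_poly_bounded_le) (intro poly_bounded_add poly_bounded_mult poly_bounded_const poly_bounded_power)
  from e1 e2 have "\<forall>\<^sub>F n in sequentially. \<forall>q u zs. cond n q \<longrightarrow> card (fst q) \<le> size_of n ^ c \<longrightarrow> 0 < u \<longrightarrow>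
    blen u \<le> size_of n ^ c \<longrightarrow> length zs = m \<longrightarrow> (\<forall>z\<in>set zs. blen z \<le> size_of n ^ c) \<longrightarrow>
    solvable \<phi> f n q u zs (size_of n ^ d)"
  proof (eventually_elim, intro allI impI)
    fix n q u zs
    assume n1: "4 * ((X (size_of n) + 1) * (M + 1)) * g n \<le> n" and n2: "2 * size_of n ^ c + 2 \<le> n"
      and q: "cond n q" "card (fst q) \<le> size_of n ^ c" and u: "0 < u" "blen u \<le> size_of n ^ c"
      and zs: "length zs = m" "\<forall>z\<in>set zs. blen z \<le> size_of n ^ c"
    obtain K h where Kh: "q = (K, h)" by fastforce
    let ?N = "size_of n"
    let ?T = "?N ^ t0"
    let ?J = "all_indices L' u"
    let ?F = "\<lambda>i A. struct_value L' (bin_code u (alpha_subst f zs A)) i"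
    define r where "r = n - card K"
    have K: "K \<subseteq> {..<n}" "card K \<le> ?N ^ c" using q by (auto simp: cond_def Kh)
    have r: "n < 2 * r" using K(2) n2 unfolding r_def by linarith
    have "1 * g n \<le> ((X ?N + 1) * (M + 1)) * g n" by (rule mult_le_mono1) simp
    then have g: "2 * g n \<le> r" using n1 r by linarith
    have Xg: "2 * (X ?N * g n) \<le> r"
    proof -
      have "X ?N * g n \<le> ((X ?N + 1) * (M + 1)) * g n" by (rule mult_le_mono1) simp
      then show ?thesis using n1 r by linarith
    qed
    have MXg: "M * (X ?N * g n) < r"
    proof -
      have "M * X ?N * g n \<le> ((X ?N + 1) * (M + 1)) * g n" by (rule mult_le_mono1) simp
      then show ?thesis using n1 r by (simp only: mult.assoc)
    qed
    have F: "?F i \<in> dtree ?T" if "i \<in> ?J" for i using t0 [rule_format, of ?N u zs i] u(2) zs that by simp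
    have "K \<union> {..<n} = {..<n}" using K(1) by blast
    then obtain h1 where h1: "cond n ({..<n}, h1)" "\<forall>k\<in>K. h1 k = h k"
      using cond_add [of n K h "{..<n}"] q(1) Kh by auto
    have "0 < n" using n2 by simp
    have "\<exists>h' J' D. cond n ({..<n}, h') \<and> (\<forall>E\<subseteq>K. lits n (E, h1) \<subseteq> lits n (E, h')) \<and> J' \<subseteq> ?J \<and>
      card (?J - J') * (n - card K) \<le> ?T * card ?J * (2 * g n * (0 + ?T * width)) \<and>
      (\<forall>i\<in>J'. {} \<subseteq> D i \<and> D i \<subseteq> {..<n} \<and> card (D i) \<le> 0 + ?T * width \<and>
        (\<forall>E\<subseteq>{}. lits n (E, h1) \<subseteq> lits n (E, h')) \<and> (\<exists>v. \<forall>A. agree (lits n (D i, h')) A \<longrightarrow> ?F i A = v))"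
      by (rule decide_most_trees [OF K(1) g [unfolded r_def] \<open>0 < n\<close> h1(1) finite_all_indices [OF fin] F]) simp_all
    then obtain h' J' D where h': "cond n ({..<n}, h')" "\<forall>E\<subseteq>K. lits n (E, h1) \<subseteq> lits n (E, h')" and J': "J' \<subseteq> ?J"
      and lost: "card (?J - J') * (n - card K) \<le> ?T * card ?J * (2 * g n * (0 + ?T * width))"
      and D: "\<forall>i\<in>J'. {} \<subseteq> D i \<and> D i \<subseteq> {..<n} \<and> card (D i) \<le> 0 + ?T * width \<and>
        (\<forall>E\<subseteq>{}. lits n (E, h1) \<subseteq> lits n (E, h')) \<and> (\<exists>v. \<forall>A. agree (lits n (D i, h')) A \<longrightarrow> ?F i A = v)"
      by (elim exE conjE) (rule that)
    have "?T * card ?J * (2 * g n * (0 + ?T * width)) = card ?J * (X ?N * g n)"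
      by (simp add: X_def algebra_simps)
    then have lost: "card (?J - J') * r \<le> card ?J * (X ?N * g n)" using lost by (simp only: r_def)
    have finJ: "finite ?J" by (rule finite_all_indices [OF fin])
    have cardJ: "card ?J = max_size L' u" by (rule card_all_indices [OF fin])
    \<comment> \<open>This oracle only serves to find the witness; by \<open>val\<close> below, the
      entries it consults have the same values for every oracle agreeing with the small
      condition.\<close>
    obtain A0 where A0: "agree (lits n ({..<n}, h')) A0" using agree_exists [OF h'(1)] by blast
    have "\<exists>y. \<exists>ls\<in>set (dnf \<phi>). (\<forall>j<k. y j < u) \<and>
      (\<forall>l\<in>set ls. sat (bin_code u (alpha_subst f zs A0)) y (literal_fm l) \<and> literal_index l y \<subseteq> J')"
    proof (cases "u < u0")
      case True
      have "card (?J - J') * r \<le> M * (X ?N * g n)"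
        using lost mult_le_mono1 [OF M [OF True], of "X ?N * g n"] unfolding cardJ by linarith
      then have "card (?J - J') * r < 1 * r" using MXg by linarith
      then have "card (?J - J') = 0" using mult_less_cancel2 by auto
      then have "J' = ?J" using finJ J' by auto
      obtain y ls where ls: "ls \<in> set (dnf \<phi>)" "\<forall>j<k. y j < u"
        "\<forall>l\<in>set ls. sat (bin_code u (alpha_subst f zs A0)) y (literal_fm l)"
        using principle_witness [OF fp u(1), of "alpha_subst f zs A0"] unfolding k_def by blast
      have "literal_index l y \<subseteq> J'" if "l \<in> set ls" for l
        unfolding \<open>J' = ?J\<close>
        by (rule literal_index_subset [OF wf_basic_literal [OF wf ls(1) that]]) (use ls(2) k_def in blast)
      then show ?thesis using ls by blast
    next
      case False
      have "2 * card (?J - J') * r \<le> card ?J * (2 * (X ?N * g n))" using lost by simp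
      also have "\<dots> \<le> card ?J * r" using Xg by (rule mult_le_mono2)
      finally have "2 * card (?J - J') \<le> card ?J" using r by simp
      moreover have "card (?J - J') = card ?J - card J'" using J' finJ finite_subset by (metis card_Diff_subset)
      ultimately have "determinacy L' \<phi> u \<le> card J'" using u0 [rule_format, of u] False cardJ by linarith
      then show ?thesis using partial_witness [OF fp u(1) J'] unfolding k_def by blast
    qed
    then obtain y ls where ls: "ls \<in> set (dnf \<phi>)" "\<forall>j<k. y j < u"
      "\<forall>l\<in>set ls. sat (bin_code u (alpha_subst f zs A0)) y (literal_fm l) \<and> literal_index l y \<subseteq> J'" by blast
    define I where "I = (\<Union>l\<in>set ls. literal_index l y)"
    have I: "I \<subseteq> J'" "finite I" using ls(3) card_literal_index by (auto simp: I_def)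
    have cardI: "card I \<le> b"
    proof -
      have "card I \<le> (\<Sum>l\<in>set ls. card (literal_index l y))" unfolding I_def by (rule card_UN_le) simp
      also have "\<dots> \<le> (\<Sum>l\<in>set ls. 1)" by (rule sum_mono) (use card_literal_index in blast)
      also have "\<dots> \<le> length ls" using card_length by simp
      finally show ?thesis using b [OF ls(1)] by linarith
    qed
    \<comment> \<open>The full naming of all numbers below n is too large for a condition.
      Restricting it to the old names and the names behind the consulted entries makes it small
      again.\<close>
    define K' where "K' = K \<union> (\<Union>i\<in>I. D i)"
    have DI: "D i \<subseteq> {..<n}" "card (D i) \<le> ?T * width" "\<exists>v. \<forall>A. agree (lits n (D i, h')) A \<longrightarrow> ?F i A = v"
      if "i \<in> I" for i
      using D I(1) that by auto
    have K'n: "K' \<subseteq> {..<n}" using K(1) DI(1) by (auto simp: K'_def)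
    have "card (\<Union>i\<in>I. D i) \<le> (\<Sum>i\<in>I. card (D i))" by (rule card_UN_le [OF I(2)])
    also have "\<dots> \<le> (\<Sum>i\<in>I. ?T * width)" by (rule sum_mono) (rule DI(2))
    also have "\<dots> = card I * (?T * width)" by simp
    also have "\<dots> \<le> b * (?T * width)" using cardI by (rule mult_le_mono1)
    also have "\<dots> \<le> ?N ^ d" using d [rule_format, of ?N] by linarith
    finally have card: "card K' \<le> card K + ?N ^ d"
      unfolding K'_def using card_Un_le [of K "\<Union>i\<in>I. D i"] by linarith
    have ext: "ext n (K', h') (K, h)"
      unfolding ext_def fst_conv snd_conv
    proof (intro conjI allI impI)
      show "K \<subseteq> K'" by (simp add: K'_def)
      fix E assume E: "E \<subseteq> K"
      have "lits n (E, h) \<subseteq> lits n (E, h1)" by (rule lits_cong_subset) (use E h1(2) in auto)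
      then show "lits n (E, h) \<subseteq> lits n (E, h')" using h'(2) E by blast
    qed
    define Y where "Y = tup (map y [0..<k])"
    have proj: "proj Y j = y j" if "j < k" for j using that by (simp add: Y_def proj_tup)
    have "blen Y + 3 \<le> 2 ^ length (map y [0..<k]) * (?N ^ c + 3)"
      unfolding Y_def
    proof (rule blen_tup)
      fix x assume "x \<in> set (map y [0..<k])"
      then have "x \<le> u" using ls(2) by auto
      then show "blen x \<le> ?N ^ c" using floorlog_mono u(2) order_trans by blast
    qed
    then have blenY: "blen Y \<le> ?N ^ d" using d [rule_format, of ?N] by simp
    have "(\<forall>j<nvars \<phi>. proj Y j < u) \<and> sat (bin_code u (alpha_subst f zs A)) (proj Y) (matrix \<phi>)"
      if A: "agree (lits n (K', h')) A" for A
    proof -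
      have val: "?F i A0 = ?F i A" if i: "i \<in> I" for i
      proof -
        have "lits n (D i, h') \<subseteq> lits n (K', h')" "lits n (D i, h') \<subseteq> lits n ({..<n}, h')"
          using lits_mono [of "D i"] i DI(1) [OF i] by (auto simp: K'_def intro!: lits_mono)
        then show ?thesis using DI(3) [OF i] A A0 agree_mono by metis
      qed
      have "sat (bin_code u (alpha_subst f zs A)) y (literal_fm l)" if l: "l \<in> set ls" for l
        using sat_literal_value_cong [OF fin wf_basic_literal [OF wf ls(1) l], of y u "alpha_subst f zs A0" "alpha_subst f zs A"]
          val ls(3) l unfolding I_def by blast
      then have "sat (bin_code u (alpha_subst f zs A)) y (matrix \<phi>)" using ls(1) unfolding sat_matrix by blast
      then show ?thesis using sat_matrix_cong [OF wf, of y "proj Y"] proj ls(2) unfolding k_def by simp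
    qed
    then show "solvable \<phi> f n q u zs (?N ^ d)"
      unfolding solvable_def
      using ext card blenY cond_restrict [OF h'(1) K'n] unfolding Kh
      by (intro exI [of _ "(K', h')"] exI [of _ Y]) simp
  qed
  then show ?thesis by blast
qed

text \<open>After u and the parameters have been decided at each index, \<open>weak_witness\<close>
  extends the condition and provides one solution per index; these solutions are short enough to
  form a name.\<close>

lemma forces_weak:
  assumes fp: "finitary_principle L' \<phi>" and weak: "weak L' \<phi>" and Q: "expresses_Q \<phi> Q"
    and f: "f \<in> PVa" "fst f = Suc m" and P: "P \<in> Pos" and e: "range e \<subseteq> Nm"
  shows "forces P e (FEx (subst_alpha f m 0 Q))"
  unfolding forces.simps
proof (rule dense_belowI)
  fix P1 assume P1: "P1 \<in> below P"
  let ?p = "subst_alpha f m 0 Q"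
  have QPV: "Q \<in> sharply_bounded PV" using Q by (simp add: expresses_Q_def)
  have sb: "?p \<in> sharply_bounded PVa" by (rule sharply_bounded_subst_alpha [OF QPV f])
  have eN: "\<And>i. i \<in> {..m} \<Longrightarrow> e i \<in> Nm" using e by (simp add: range_subsetD)
  obtain R E where R: "R \<in> below P1" and dec': "\<forall>i\<in>{..m}. \<forall>(n, A)\<in>pts R. e i (n, A) = E n i"
    using decide_names [OF finite_atMost below_Pos [OF P1], of m e] eN by blast
  have dec: "decided R e {..m} E" using dec' by (simp add: decided_def)
  obtain c0 where c0: "bounded_on c0 (fst R) {..m} E"
    using decided_bounded [OF below_Pos [OF R] finite_atMost eN dec] by blast
  obtain c1 where c1: "\<forall>n\<in>fst R. card (fst (snd R n)) \<le> size_of n ^ c1" using below_Pos [OF R] by (auto simp: Pos_def)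
  define c where "c = max c0 c1"
  have c: "size_of n ^ c0 \<le> size_of n ^ c" "size_of n ^ c1 \<le> size_of n ^ c" for n
    unfolding c_def by (intro power_increasing; simp)+
  obtain d where "\<forall>\<^sub>F n in sequentially. \<forall>q u zs. cond n q \<longrightarrow> card (fst q) \<le> size_of n ^ c \<longrightarrow> 0 < u \<longrightarrow>
    blen u \<le> size_of n ^ c \<longrightarrow> length zs = m \<longrightarrow> (\<forall>z\<in>set zs. blen z \<le> size_of n ^ c) \<longrightarrow>
    solvable \<phi> f n q u zs (size_of n ^ d)"
    using weak_witness [OF fp weak f, of c] by blast
  then obtain n0 where n0: "\<And>n q u zs. n \<ge> n0 \<Longrightarrow> cond n q \<Longrightarrow> card (fst q) \<le> size_of n ^ c \<Longrightarrow> 0 < u \<Longrightarrow>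
    blen u \<le> size_of n ^ c \<Longrightarrow> length zs = m \<Longrightarrow> (\<forall>z\<in>set zs. blen z \<le> size_of n ^ c) \<Longrightarrow>
    solvable \<phi> f n q u zs (size_of n ^ d)"
    unfolding eventually_sequentially by blast
  have "infinite (fst R - {..<n0})" using below_Pos [OF R] by (simp add: Pos_def)
  from below_subset [OF below_Pos [OF R] this]
  have R1: "(fst R - {..<n0}, snd R) \<in> below R" by blast
  define zs where "zs E' = map (\<lambda>i. E' (Suc i)) [0..<m]" for E' :: "nat \<Rightarrow> nat"
  have sat: "sat (std A) (case_nat y E') ?p \<longleftrightarrow> (0 < E' 0 \<longrightarrow> (\<forall>j<nvars \<phi>. proj y j < E' 0) \<and>
      sat (bin_code (E' 0) (alpha_subst f (zs E') A)) (proj y) (matrix \<phi>))" for E' A y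
  proof -
    have E': "case_nat y E' = case_nat y (case_nat (E' 0) (\<lambda>i. E' (Suc i)))"
      by (auto simp: fun_eq_iff split: nat.splits)
    have "map (\<lambda>i. case_nat y E' (0 + 2 + i)) [0..<m] = zs E'" by (simp add: zs_def)
    then have "sat (std A) (case_nat y E') ?p = sat (std (alpha_subst f (zs E') A)) (case_nat y E') Q"
      using sat_subst_alpha [OF QPV, of A "case_nat y E'" f m 0] by simp
    also have "\<dots> = sat (std (alpha_subst f (zs E') A)) (case_nat y (case_nat (E' 0) (\<lambda>i. E' (Suc i)))) Q"
      by (simp only: E' [symmetric])
    also have "\<dots> \<longleftrightarrow> (0 < E' 0 \<longrightarrow> (\<forall>j<nvars \<phi>. proj y j < E' 0) \<and>
        sat (bin_code (E' 0) (alpha_subst f (zs E') A)) (proj y) (matrix \<phi>))"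
      by (rule Q [unfolded expresses_Q_def, THEN conjunct2, THEN conjunct2, rule_format])
    finally show ?thesis .
  qed
  have "\<exists>S\<in>below (fst R - {..<n0}, snd R). fst S = fst (fst R - {..<n0}, snd R) \<and> (\<forall>n\<in>fst S. \<exists>y. blen y \<le> size_of n ^ d \<and>
      (\<forall>A. agree (lits n (snd S n)) A \<longrightarrow> sat (std A) (case_nat y (E n)) ?p))"
  proof (rule below_refine [OF below_Pos [OF R1] poly_bounded_power [of d]])
    fix n assume "n \<in> fst (fst R - {..<n0}, snd R)"
    then have n: "n \<in> fst R" "n \<ge> n0" by auto
    have cond: "cond n (snd R n)" by (rule Pos_cond [OF below_Pos [OF R] n(1)])
    have bE: "blen (E n i) \<le> size_of n ^ c" if "i \<le> m" for i
      using c0 n(1) that c(1) [of n] unfolding bounded_on_def by (meson atMost_iff order_trans)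
    have "\<exists>q y. cond n q \<and> ext n q (snd R n) \<and> card (fst q) \<le> card (fst (snd R n)) + size_of n ^ d \<and>
        blen y \<le> size_of n ^ d \<and> (\<forall>A. agree (lits n q) A \<longrightarrow> sat (std A) (case_nat y (E n)) ?p)"
    proof (cases "0 < E n 0")
      case True
      have "solvable \<phi> f n (snd R n) (E n 0) (zs (E n)) (size_of n ^ d)"
      proof (rule n0 [OF n(2) cond _ True])
        show "card (fst (snd R n)) \<le> size_of n ^ c" using c1 n(1) c(2) [of n] order_trans by blast
        show "blen (E n 0) \<le> size_of n ^ c" by (rule bE) simp
        show "length (zs (E n)) = m" by (simp add: zs_def)
        show "\<forall>z\<in>set (zs (E n)). blen z \<le> size_of n ^ c" using bE by (auto simp: zs_def)
      qed
      then show ?thesis unfolding sat solvable_def by blast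
    next
      case False
      \<comment> \<open>For u = 0 the formula holds trivially and any y is a solution.\<close>
      then show ?thesis unfolding sat using cond ext_refl
        by (intro exI [of _ "snd R n"] exI [of _ 0]) (simp add: floorlog_def)
    qed
    then show "\<exists>q. cond n q \<and> ext n q (snd (fst R - {..<n0}, snd R) n) \<and>
        card (fst q) \<le> card (fst (snd (fst R - {..<n0}, snd R) n)) + size_of n ^ d \<and>
        (\<exists>y. blen y \<le> size_of n ^ d \<and> (\<forall>A. agree (lits n q) A \<longrightarrow> sat (std A) (case_nat y (E n)) ?p))"
      unfolding snd_conv by blast
  qed
  then obtain S where S: "S \<in> below (fst R - {..<n0}, snd R)" "\<forall>n\<in>fst S. \<exists>y. blen y \<le> size_of n ^ d \<and>
      (\<forall>A. agree (lits n (snd S n)) A \<longrightarrow> sat (std A) (case_nat y (E n)) ?p)" by blast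
  have SR: "S \<in> below R" by (rule below_trans [OF S(1) R1])
  from bchoice [OF S(2)] obtain Y where Y: "\<forall>n\<in>fst S. blen (Y n) \<le> size_of n ^ d \<and>
      (\<forall>A. agree (lits n (snd S n)) A \<longrightarrow> sat (std A) (case_nat (Y n) (E n)) ?p)" by blast
  let ?x = "\<lambda>(n, A). if n \<in> fst S then Y n else 0"
  have x: "?x \<in> Nm" by (rule Nm_const [of _ d]) (use Y in \<open>simp add: blen_0\<close>)
  have "SF S (case_nat ?x e) ?p"
    unfolding SF_def
  proof (clarify)
    fix n A assume A: "(n, A) \<in> pts S"
    then have n: "n \<in> fst S" "agree (lits n (snd S n)) A" by (auto simp: pts_def)
    have eE: "e i (n, A) = E n i" if "i \<le> m" for i
      using decidedD [OF decided_mono [OF dec SR order_refl] _ A] that by simp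
    have "zs (\<lambda>i. e i (n, A)) = zs (E n)" by (simp add: zs_def eE)
    then have "sat (std A) (case_nat (Y n) (\<lambda>i. e i (n, A))) ?p = sat (std A) (case_nat (Y n) (E n)) ?p"
      unfolding sat by (simp add: eE)
    then show "sat (std A) (\<lambda>i. case_nat ?x e i (n, A)) ?p" unfolding case_nat_at using Y n by simp
  qed
  then have "forces S (case_nat ?x e) ?p" by (rule SF_forces [OF sb below_Pos [OF SR] range_case_nat [OF x e]])
  then show "\<exists>S\<in>below P1. \<exists>x\<in>Nm. forces S (case_nat x e) ?p" using x below_trans [OF SR R] by blast
qed

end

theorem theorem1p6:
  fixes L L' :: lang and \<phi> \<phi>' :: basic and Q Q' :: pfm
  assumes "finitary_principle L \<phi>"
    and "without_builtin \<phi>"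
    and "strong TYPE('a) L \<phi>"
    and "finitary_principle L' \<phi>'"
    and "weak L' \<phi>'"
    and "expresses_Q \<phi> Q"
    and "expresses_Q \<phi>' Q'"
  shows "independent all_T12 Q Q'"
proof -
  obtain B :: "'a lstr" and g where B: "is_structure L B" "infinite (univ B)" "models B (FNeg (sentence \<phi>))"
    "subpolynomial g" "large L g B"
    using assms(3) by (auto simp: strong_def)
  have wf: "finite_lang L" "wf_basic L \<phi>" using assms(1) by (auto simp: finitary_principle_def)
  interpret large_structure L B g
    by unfold_locales (use B wf(1) in blast)+
  let ?G = "all_T12 \<union> {(FAll ^^ Suc m) (FEx (subst_alpha f m 0 Q')) | f m. f \<in> PVa \<and> fst f = Suc m}"
  \<comment> \<open>The weakest condition: all indices and no names.\<close>
  let ?P = "(UNIV, \<lambda>n. ({}, \<lambda>_. undefined)) :: 'a condition"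
  \<comment> \<open>All free variables denote the index itself, so the variable x of
    \<open>FEx Q\<close> is the nonstandard n.\<close>
  let ?e = "\<lambda>i :: nat. \<lambda>(n, A :: nat set). n :: nat"
  have P: "?P \<in> Pos" by (simp add: Pos_def cond_def)
  have "(\<lambda>(n, A). n) \<in> Nm" by (rule Nm_const [of _ 1]) simp
  then have e: "range ?e \<subseteq> Nm" by blast
  have "forces ?P ?e q" if "q \<in> ?G" for q
    using that
  proof
    assume "q \<in> all_T12"
    then show ?thesis using forces_T12 P e by blast
  next
    assume "q \<in> {(FAll ^^ Suc m) (FEx (subst_alpha f m 0 Q')) | f m. f \<in> PVa \<and> fst f = Suc m}"
    then obtain f m where "q = (FAll ^^ Suc m) (FEx (subst_alpha f m 0 Q'))" "f \<in> PVa" "fst f = Suc m" by blast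
    then show ?thesis using forces_FAll_funpow [OF forces_weak [OF assms(4,5,7)] e] P by blast
  qed
  then have "forces ?P ?e (FEx Q)" if "?G \<turnstile> FEx Q" using forces_sound [OF that P e] by blast
  moreover have "\<not> forces ?P ?e (FEx Q)"
    by (rule not_forces_strong [OF assms(6) wf(2) assms(2) B(3) P e]) simp
  ultimately show ?thesis unfolding independent_def consequence_def by blast
qed

end
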